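(* Let $\mathbb{F}$ be a finite field of odd order $q$, let $\theta$ be a non-trivial additive character of $\mathbb{F}$, and let $\epsilon=1$ if $q\equiv1\pmod 4$ and $\epsilon=-1$ if $q\equiv3\pmod4$. For $n\ge2$, $0\le s\le n$ and even $r$ with $2\le r\le n$, $$\Psi^{(2)}_n(s,r)=(-\epsilon)^xq^{x^2}\,(q^{2N-(-1)^n};q^{-2})_x\begin{bmatrix} N \\ x \end{bmatrix}_{q^2}K^{\mathrm{Aff}}_y(x;q^{-2N+(-1)^n},N;q^2),$$ where $N=\lfloor\frac n2\rfloor$, $y=\lfloor\frac s2\rfloor$, $x=\frac r2$. Here $\Psi^{(2)}_n$ is the block defined in the context of the matrix of the Fourier transformation of $\operatorname{GL}_n(\mathbb{F})$-invariant functions on symmetric matrices.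
   Context: $\operatorname{Sym}_n$ is the space of $n\times n$ symmetric matrices over $\mathbb{F}$, with $\operatorname{GL}_n(\mathbb{F})$ acting by $a\mapsto ga\,{}^tg$. Fix a non-square $\delta\in\mathbb{F}$. Every non-zero $a\in\operatorname{Sym}_n$ is in the orbit of exactly one of the matrices $\operatorname{diag}(1,\dots,1,0,\dots,0)$ or $\operatorname{diag}(1,\dots,1,\delta,0,\dots,0)$; put $\operatorname{sgn}(a)=1$ in the first case, $-1$ in the second, and $\operatorname{sgn}(0)=1$. Identify $\operatorname{Sym}_n$ with its character group via $a\mapsto\theta_a$, $\theta_a(b)=\theta(\operatorname{trace}({}^tab))$. On $\operatorname{Sym}_n$, let $\chi_r$ ($0\le r\le n$) be the characteristic function of the matrices of rank $r$, and ${}^{\operatorname{sgn}}\chi_r(a)=\operatorname{sgn}(a)\chi_r(a)$ ($1\le r\le n$). These form a basis of the $\operatorname{GL}_n(\mathbb{F})$-invariant functions on $\operatorname{Sym}_n$. Use the same notation on the character group: $\chi_s(\theta_a)=\chi_s(a)$, ${}^{\operatorname{sgn}}\chi_s(\theta_a)={}^{\operatorname{sgn}}\chi_s(a)$. The Fourier transformation is $\mathcal{F}\varphi(\xi)=\sum_{a\in\operatorname{Sym}_n}\overline{\xi(a)}\varphi(a)$. The numbers $\Psi^{(i)}_n(s,r)$ are defined by $$\mathcal{F}(\chi_r)=\sum_{s=0}^n\Psi^{(1)}_n(s,r)\chi_s+\sum_{s=1}^n\Psi^{(3)}_n(s,r)\,{}^{\operatorname{sgn}}\chi_s\quad(0\le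 r\le n),$$ $$\mathcal{F}({}^{\operatorname{sgn}}\chi_r)=\sum_{s=0}^n\Psi^{(2)}_n(s,r)\chi_s+\sum_{s=1}^n\Psi^{(4)}_n(s,r)\,{}^{\operatorname{sgn}}\chi_s\quad(1\le r\le n).$$ Notation: $(a;q)_k=(1-a)(1-aq)\cdots(1-aq^{k-1})$, $(a;q)_0=1$; $\begin{bmatrix} N \\ x \end{bmatrix}_q=\dfrac{(q^N;q^{-1})_x}{(q;q)_x}$. Affine $q$-Krawtchouk polynomial: for integers $0\le y\le N$, $$K^{\mathrm{Aff}}_y(x;a,N;q)=\sum_{k=0}^{y}\frac{(q^{-y};q)_k\,(q^{-x};q)_k}{(q^{-N};q)_k\,(a;q)_k\,(q;q)_k}\,q^k;$$ in the claim these are used with $q$ replaced by $q^2$. *)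

theory Defs
  imports Complex_Main "HOL-Library.Cardinality" "Jordan_Normal_Form.DL_Rank"
begin

section \<open>Symmetric matrices over a finite field\<close>

definition Sym :: "nat \<Rightarrow> 'f::field mat set" where
  "Sym n = {a \<in> carrier_mat n n. transpose_mat a = a}"

definition mat_trace :: "'f::comm_monoid_add mat \<Rightarrow> 'f" where
  "mat_trace a = (\<Sum>i<dim_row a. a $$ (i, i))"

definition same_orbit :: "nat \<Rightarrow> 'f::field mat \<Rightarrow> 'f mat \<Rightarrow> bool" where
  "same_orbit n a b \<longleftrightarrow>
     (\<exists>g\<in>carrier_mat n n. invertible_mat g \<and> a = g * b * transpose_mat g)"

text \<open>\<open>orbit_rep n r c\<close> is \<open>diag(1, \<dots>, 1, c, 0, \<dots>, 0)\<close>, with \<open>r - 1\<close> ones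
  before \<open>c\<close>; it is used for \<open>1 \<le> r \<le> n\<close> and \<open>c \<in> {1, \<delta>}\<close>.\<close>

definition orbit_rep :: "nat \<Rightarrow> nat \<Rightarrow> 'f::field \<Rightarrow> 'f mat" where
  "orbit_rep n r c = mat_diag n (\<lambda>i. if i + 1 < r then 1 else if i + 1 = r then c else 0)"

text \<open>For \<open>a \<in> Sym n\<close> and a non-square \<open>\<delta>\<close> over a finite field of odd order, exactly one
  of the first three cases applies; the value \<open>0\<close> is never attained there.\<close>

definition sym_sgn :: "nat \<Rightarrow> 'f::field \<Rightarrow> 'f mat \<Rightarrow> complex" where
  "sym_sgn n \<delta> a =
     (if a = 0\<^sub>m n n then 1
      else if \<exists>r\<in>{1..n}. same_orbit n a (orbit_rep n r 1) then 1
      else if \<exists>r\<in>{1..n}. same_orbit n a (orbit_rep n r \<delta>) then - 1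
      else 0)"

definition chi :: "nat \<Rightarrow> nat \<Rightarrow> 'f::field mat \<Rightarrow> complex" where
  "chi n r a = (if vec_space.rank n a = r then 1 else 0)"

definition sgn_chi :: "nat \<Rightarrow> 'f::field \<Rightarrow> nat \<Rightarrow> 'f mat \<Rightarrow> complex" where
  "sgn_chi n \<delta> r a = sym_sgn n \<delta> a * chi n r a"


section \<open>Characters and the Fourier transformation\<close>

definition additive_character :: "('f::field \<Rightarrow> complex) \<Rightarrow> bool" where
  "additive_character \<theta> \<longleftrightarrow> (\<forall>x y. \<theta> (x + y) = \<theta> x * \<theta> y) \<and> (\<forall>x. cmod (\<theta> x) = 1)"

definition sym_char :: "('f::field \<Rightarrow> complex) \<Rightarrow> 'f mat \<Rightarrow> 'f mat \<Rightarrow> complex" where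
  "sym_char \<theta> a b = \<theta> (mat_trace (transpose_mat a * b))"

definition fourier :: "nat \<Rightarrow> ('f::field mat \<Rightarrow> complex) \<Rightarrow> ('f mat \<Rightarrow> complex) \<Rightarrow> complex" where
  "fourier n \<phi> \<xi> = (\<Sum>a\<in>Sym n. cnj (\<xi> a) * \<phi> a)"

text \<open>\<open>is_expansion n \<delta> \<theta> F c d\<close>: the function \<open>F\<close> on the characters of \<open>Sym n\<close> is the
  combination of the basis functions \<open>chi n s\<close> (\<open>0 \<le> s \<le> n\<close>) and \<open>sgn_chi n \<delta> s\<close>
  (\<open>1 \<le> s \<le> n\<close>) with coefficients \<open>c s\<close> and \<open>d s\<close>, the value of a basis function at the
  character \<open>sym_char \<theta> a\<close> being its value at \<open>a\<close>. Coefficients outside the index ranges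
  are set to \<open>0\<close>, so that \<open>c\<close> and \<open>d\<close> are determined by \<open>F\<close>.\<close>

definition is_expansion ::
    "nat \<Rightarrow> 'f::field \<Rightarrow> ('f \<Rightarrow> complex) \<Rightarrow> (('f mat \<Rightarrow> complex) \<Rightarrow> complex) \<Rightarrow>
     (nat \<Rightarrow> complex) \<Rightarrow> (nat \<Rightarrow> complex) \<Rightarrow> bool" where
  "is_expansion n \<delta> \<theta> F c d \<longleftrightarrow>
     (\<forall>a\<in>Sym n. F (sym_char \<theta> a) =
        (\<Sum>s=0..n. c s * chi n s a) + (\<Sum>s=1..n. d s * sgn_chi n \<delta> s a)) \<and>
     (\<forall>s. s \<notin> {0..n} \<longrightarrow> c s = 0) \<and> (\<forall>s. s \<notin> {1..n} \<longrightarrow> d s = 0)"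

definition expansion_coeffs ::
    "nat \<Rightarrow> 'f::field \<Rightarrow> ('f \<Rightarrow> complex) \<Rightarrow> (('f mat \<Rightarrow> complex) \<Rightarrow> complex) \<Rightarrow>
     (nat \<Rightarrow> complex) \<times> (nat \<Rightarrow> complex)" where
  "expansion_coeffs n \<delta> \<theta> F = (THE (c, d). is_expansion n \<delta> \<theta> F c d)"

definition Psi1 :: "nat \<Rightarrow> 'f::field \<Rightarrow> ('f \<Rightarrow> complex) \<Rightarrow> nat \<Rightarrow> nat \<Rightarrow> complex" where
  "Psi1 n \<delta> \<theta> s r = fst (expansion_coeffs n \<delta> \<theta> (fourier n (chi n r))) s"

definition Psi2 :: "nat \<Rightarrow> 'f::field \<Rightarrow> ('f \<Rightarrow> complex) \<Rightarrow> nat \<Rightarrow> nat \<Rightarrow> complex" where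
  "Psi2 n \<delta> \<theta> s r = fst (expansion_coeffs n \<delta> \<theta> (fourier n (sgn_chi n \<delta> r))) s"

definition Psi3 :: "nat \<Rightarrow> 'f::field \<Rightarrow> ('f \<Rightarrow> complex) \<Rightarrow> nat \<Rightarrow> nat \<Rightarrow> complex" where
  "Psi3 n \<delta> \<theta> s r = snd (expansion_coeffs n \<delta> \<theta> (fourier n (chi n r))) s"

definition Psi4 :: "nat \<Rightarrow> 'f::field \<Rightarrow> ('f \<Rightarrow> complex) \<Rightarrow> nat \<Rightarrow> nat \<Rightarrow> complex" where
  "Psi4 n \<delta> \<theta> s r = snd (expansion_coeffs n \<delta> \<theta> (fourier n (sgn_chi n \<delta> r))) s"


section \<open>Basic hypergeometric notation\<close>

definition qpoch :: "'a::field \<Rightarrow> 'a \<Rightarrow> nat \<Rightarrow> 'a" where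
  "qpoch a q k = (\<Prod>i<k. 1 - a * q ^ i)"

definition qbinom :: "nat \<Rightarrow> nat \<Rightarrow> 'a::field \<Rightarrow> 'a" where
  "qbinom N x q = qpoch (q ^ N) (inverse q) x / qpoch q q x"

definition affine_q_Krawtchouk :: "nat \<Rightarrow> nat \<Rightarrow> 'a::field \<Rightarrow> nat \<Rightarrow> 'a \<Rightarrow> 'a" where
  "affine_q_Krawtchouk y x a N q =
     (\<Sum>k=0..y. qpoch (q powi (- int y)) q k * qpoch (q powi (- int x)) q k
        / (qpoch (q powi (- int N)) q k * qpoch a q k * qpoch q q k) * q ^ k)"

end

theory Submission
  imports Defs
begin

text \<open>For a symmetric matrix \<open>a\<close> of rank \<open>r\<close> the quadratic Gauss sum \<open>G(a)\<close>, the sum of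
  \<open>\<theta>(v \<bullet> a v)\<close> over all vectors \<open>v\<close>, equals \<open>sgn(a) g\<^sup>r q\<^sup>n\<^sup>-\<^sup>r\<close>, where \<open>g\<close> is the Gauss sum of
  the field and \<open>g\<^sup>2 = \<epsilon> q\<close>. Hence \<open>G(a)\<close> determines rank, sign and orbit, and all
  invariant functions are functions of \<open>G(a)\<close>.

  The coefficient \<open>\<Psi>\<^sup>(\<^sup>2\<^sup>)(s, r)\<close> is the average of the Fourier transform over the two orbits of
  rank \<open>s\<close>, so it can be computed by averaging over all \<open>p \<noteq> 0\<close> at the block matrices \<open>p \<oplus> b\<close> with \<open>b\<close> of
  rank \<open>s - 1\<close>. Summing over all \<open>p\<close> forces the corner entry of \<open>a\<close> to vanish; such an \<open>a\<close> is
  either \<open>0 \<oplus> a'\<close> or contains a hyperbolic plane, whose complement has size \<open>n - 2\<close> and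
  rank \<open>r - 2\<close>. This gives a recurrence in \<open>n\<close> and \<open>s\<close>, and the affine q-Krawtchouk
  polynomials satisfy the same one.\<close>

text \<open>Evaluating at a single matrix would couple the wanted coefficient with the signed part
  of the expansion. For fixed \<open>b\<close>, the sign of \<open>p \<oplus> b\<close> takes both
  values equally often as \<open>p \<noteq> 0\<close> varies, so averaging removes the signed part
  and the recurrence closes. It climbs from rank \<open>s\<close> to \<open>s + 1\<close> and thus
  needs a start at \<open>s = 0\<close>, where no \<open>p\<close> is left to average over; there
  the cancellation comes from the fact that the sign is an odd function of the Gauss sum. Expressing
  invariant functions through the complex number \<open>G(a)\<close> also makes a change of size
  painless: a zero row and column, or a hyperbolic plane, multiplies \<open>G\<close> by
  \<open>q\<close>, so \<open>\<phi>\<close> is only replaced by \<open>\<phi> (q * z)\<close>. The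
  obstacle on the other side is parity. The claim contains \<open>n div 2\<close>,
  \<open>s div 2\<close> and \<open>(- 1) ^ n\<close>, while the recurrence moves \<open>n\<close>
  and \<open>s\<close> by one. In \<open>kraw\<close> the size enters only through
  \<open>X = q ^ n\<close>, and one product over all exponents replaces the two Pochhammer symbols;
  parity returns only in the final translation and in the step from \<open>s\<close> to
  \<open>s + 1\<close>.\<close>

subsection \<open>Recurrences for affine q-Krawtchouk polynomials\<close>

lemma qpoch_0 [simp]: "qpoch a q 0 = 1"
  by (simp add: qpoch_def)

lemma qpoch_Suc: "qpoch a q (Suc k) = qpoch a q k * (1 - a * q ^ k)"
  by (simp add: qpoch_def)

lemma qpoch_Suc_left: "qpoch a q (Suc k) = (1 - a) * qpoch (a * q) q k"
  by (simp add: qpoch_def prod.lessThan_Suc_shift mult.assoc del: prod.lessThan_Suc)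

text \<open>With \<open>X = q ^ n\<close> this is the claimed value of \<open>Psi2\<close> up to \<open>\<epsilon> ^ x\<close>. The recursion
  in \<open>y\<close> is the contiguous relation of the affine q-Krawtchouk polynomials.\<close>

fun kraw :: "'a::field \<Rightarrow> nat \<Rightarrow> 'a \<Rightarrow> nat \<Rightarrow> 'a" where
  "kraw q 0 X x = (- 1) ^ x * q ^ (x\<^sup>2) * (\<Prod>i<2*x. 1 - X / q ^ i) / qpoch (q\<^sup>2) (q\<^sup>2) x"
| "kraw q (Suc y) X 0 = 1"
| "kraw q (Suc y) X (Suc x) = kraw q y X (Suc x) - X\<^sup>2 / q ^ (2 * y + 2) * kraw q y (X / q\<^sup>2) x"

lemma kraw_0 [simp]: "kraw q y X 0 = 1"
  by (cases y) auto

text \<open>The two products share all middle factors and differ only in \<open>1 - X\<close>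
  against \<open>1 - X / q ^ (2 * x + 2)\<close>. Their difference contains
  \<open>1 - q ^ (2 * x + 2)\<close>, the last factor of the denominator, and what remains after
  cancelling is the value at \<open>x\<close>.\<close>

lemma kraw_step0:
  fixes q :: "'a::field"
  assumes q0: "q \<noteq> 0" and q1: "\<And>k. k > 0 \<Longrightarrow> q ^ k \<noteq> 1"
  shows "kraw q 0 X (Suc x)
    = kraw q 0 (X / q) (Suc x) + X / q * (X / q - 1) * kraw q 0 (X / q\<^sup>2) x"
proof -
  define P where "P = (\<Prod>i<2*x. 1 - X / q ^ (i + 2))"
  define D where "D = qpoch (q\<^sup>2) (q\<^sup>2) x"
  have D: "D \<noteq> 0"
    using q1[of "2 * Suc _"] unfolding D_def qpoch_def
    by (auto simp: power_mult[symmetric] power_add[symmetric] mult.commute)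
  have DS: "qpoch (q\<^sup>2) (q\<^sup>2) (Suc x) = D * (1 - q ^ (2 * x + 2))"
    by (simp add: qpoch_Suc D_def power_mult[symmetric] power_add[symmetric] add.commute)
  have c: "1 - q ^ (2 * x + 2) \<noteq> 0"
    using q1[of "2 * x + 2"] by simp
  have p1: "(\<Prod>i<2 * Suc x. 1 - X / q ^ i) = (1 - X) * ((1 - X / q) * P)"
    by (simp add: prod.lessThan_Suc_shift P_def del: prod.lessThan_Suc)
  have "(\<Prod>i<2 * Suc x. 1 - X / q / q ^ i) = (\<Prod>i<2*x+1. 1 - X / q ^ (Suc i)) * (1 - X / q ^ (2*x+2))"
    by (simp add: mult.commute)
  also have "(\<Prod>i<2*x+1. 1 - X / q ^ (Suc i)) = (1 - X / q) * P"
    by (simp add: prod.lessThan_Suc_shift P_def del: prod.lessThan_Suc)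
  finally have p2: "(\<Prod>i<2 * Suc x. 1 - X / q / q ^ i) = (1 - X / q) * P * (1 - X / q ^ (2*x+2))" .
  have p3: "(\<Prod>i<2*x. 1 - X / q\<^sup>2 / q ^ i) = P"
    by (simp add: P_def power2_eq_square mult.assoc)
  have e: "q ^ ((Suc x)\<^sup>2) = q ^ (x\<^sup>2) * q ^ (2 * x + 2) / q"
    using q0 by (simp add: power2_eq_square power_add mult_2 mult_2_right algebra_simps)
  define a where "a = q ^ (2 * x + 2)"
  have a: "a \<noteq> 0" "1 - a \<noteq> 0" using q0 c by (auto simp: a_def)
  define P' where "P' = (1 - X / q) * P"
  define s where "s = (- 1 :: 'a) ^ x * q ^ (x\<^sup>2) * P' / D"
  define d where "d = 1 - a"
  have gen: "- S * (Z * a / q) * (u * P') / (D * d) - - S * (Z * a / q) * (P' * v) / (D * d)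
      = S * Z * P' / D / d * (- a / q) * (u - v)" for S Z u v :: 'a
    using D q0 a(2) by (simp add: d_def[symmetric] field_simps)
  have "kraw q 0 X (Suc x) - kraw q 0 (X / q) (Suc x)
      = s / d * (- a / q) * ((1 - X) - (1 - X / a))"
    unfolding kraw.simps p1 p2 DS e s_def a_def[symmetric] P'_def[symmetric] d_def[symmetric]
    using gen[of "(- 1) ^ x"] by simp
  also have "\<dots> = s * (X / q) * (- 1)"
    using a q0 by (simp add: d_def field_simps)
  also have "\<dots> = X / q * (X / q - 1) * kraw q 0 (X / q\<^sup>2) x"
    unfolding kraw.simps p3 D_def[symmetric] s_def P'_def by (simp add: algebra_simps diff_divide_distrib)
  finally show ?thesis by (simp add: algebra_simps)
qed

text \<open>The Fourier recurrence lowers the size by one, hence replaces \<open>X\<close> by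
  \<open>X / q\<close>, whereas the recursion of \<open>kraw\<close> only knows
  \<open>X / q\<^sup>2\<close>. This relation supplies that step. It survives an increase of
  \<open>y\<close> because unfolding the recursion leaves instances of it at \<open>X\<close> and at
  \<open>X / q\<^sup>2\<close>.\<close>

lemma kraw_step:
  fixes q :: "'a::field"
  assumes q0: "q \<noteq> 0" and q1: "\<And>k. k > 0 \<Longrightarrow> q ^ k \<noteq> 1"
  shows "kraw q y X (Suc x)
    = kraw q y (X / q) (Suc x) + X / q * (X / q ^ (2 * y + 1) - 1) * kraw q y (X / q\<^sup>2) x"
proof (induction y arbitrary: X x)
  case 0
  show ?case using kraw_step0[OF q0 q1, of X x] by simp
next
  case (Suc y)
  \<comment> \<open>With the powers of \<open>q\<close> absorbed into \<open>e\<close>,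
    \<open>f\<close> and \<open>h\<close>, the remaining identity is polynomial.\<close>
  define f where "f = X / q"
  define h where "h = f / q\<^sup>2"
  define e where "e = X / q ^ (2 * y + 3)"
  have e: "X / q ^ (2 * Suc y + 1) = e" "X / q ^ (2 * y + 1) = e * q\<^sup>2"
    "X / q\<^sup>2 / q ^ (2 * y + 1) = e"
    using q0 by (simp_all add: e_def power_add power2_eq_square power3_eq_cube mult.assoc)
  have sq: "X\<^sup>2 / q ^ (2 * y + 2) = f * (e * q\<^sup>2)" "f\<^sup>2 / q ^ (2 * y + 2) = f * e"
    "(X / q\<^sup>2)\<^sup>2 / q ^ (2 * y + 2) = h * e"
    using q0 by (simp_all add: e_def f_def h_def power_add power2_eq_square power3_eq_cube
        mult.commute mult.left_commute)
  have h: "X / q\<^sup>2 / q = h"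
    by (simp add: f_def h_def mult.commute)
  have hq: "h * q\<^sup>2 = f" using q0 by (simp add: h_def)
  note rec = kraw.simps(3)[of q y]
  have swap: "f / q\<^sup>2 = h" by (simp add: h_def)
  show ?case
  \<comment> \<open>The induction hypothesis concerns positive indices only; at index 0 the lower
    term is the constant 1.\<close>
  proof (cases x)
    case 0
    show ?thesis unfolding 0 rec Suc.IH[of X 0] kraw_0 sq e f_def[symmetric]
      by (simp add: algebra_simps)
  next
    case (Suc z)
    have k: "kraw q y (X / q\<^sup>2) (Suc z) = kraw q y h (Suc z) + h * (e - 1) * kraw q y (X / q\<^sup>2 / q\<^sup>2) z"
      using Suc.IH[of "X / q\<^sup>2" z] unfolding h e .
    show ?thesis unfolding Suc rec Suc.IH[of X "Suc z"] sq e swap k f_def[symmetric]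
      by (simp add: algebra_simps)
  qed
qed

section \<open>The contiguous relation in \<open>y\<close> and the translation of
  \<open>kraw\<close>\<close>

lemma affine_q_Krawtchouk_Suc:
  fixes q a :: "'a::field"
  assumes q0: "q \<noteq> 0" and q1: "\<And>k. k > 0 \<Longrightarrow> q ^ k \<noteq> 1"
  shows "affine_q_Krawtchouk (Suc y) (Suc x) a (Suc N) q - affine_q_Krawtchouk y (Suc x) a (Suc N) q
    = - (q powi (- int y)) * (1 - q powi (- int (Suc x))) / ((1 - q powi (- int (Suc N))) * (1 - a))
      * affine_q_Krawtchouk y x (a * q) N q"
proof -
  have shift: "q powi (- int (Suc m)) * q = q powi (- int m)" for m
    using power_int_add[of q "- int (Suc m)" 1] q0 by simp
  define c where "c k = qpoch (q powi (- int (Suc x))) q k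
        / (qpoch (q powi (- int (Suc N))) q k * qpoch a q k * qpoch q q k) * q ^ k" for k
  have K: "affine_q_Krawtchouk z (Suc x) a (Suc N) q = (\<Sum>k=0..z. qpoch (q powi (- int z)) q k * c k)" for z
    by (simp add: affine_q_Krawtchouk_def c_def mult.assoc)
  \<comment> \<open>This lets the sum for \<open>y\<close> run up to \<open>Suc y\<close>, so that
    both sums can be subtracted term by term.\<close>
  have "qpoch (q powi (- int y)) q (Suc y) = 0"
    using q0 by (simp add: qpoch_Suc power_int_minus)
  hence "affine_q_Krawtchouk y (Suc x) a (Suc N) q
      = (\<Sum>k=0..Suc y. qpoch (q powi (- int y)) q k * c k)"
    unfolding K by (subst sum.atLeast0_atMost_Suc) simp
  hence "affine_q_Krawtchouk (Suc y) (Suc x) a (Suc N) q - affine_q_Krawtchouk y (Suc x) a (Suc N) q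
      = (\<Sum>k=0..Suc y. (qpoch (q powi (- int (Suc y))) q k - qpoch (q powi (- int y)) q k) * c k)"
    unfolding K by (simp only: sum_subtractf left_diff_distrib)
  also have "\<dots> = (\<Sum>k=0..y. (qpoch (q powi (- int (Suc y))) q (Suc k) - qpoch (q powi (- int y)) q (Suc k)) * c (Suc k))"
    by (subst sum.atLeast0_atMost_Suc_shift) (simp add: o_def)
  also have "\<dots> = (\<Sum>k=0..y. - (q powi (- int y)) * (1 - q powi (- int (Suc x))) / ((1 - q powi (- int (Suc N))) * (1 - a))
      * (qpoch (q powi (- int y)) q k * qpoch (q powi (- int x)) q k
        / (qpoch (q powi (- int N)) q k * qpoch (a * q) q k * qpoch q q k) * q ^ k))"
  proof (rule sum.cong[OF refl])
    fix k
    define A where "A = qpoch (q powi (- int y)) q k"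
    define e where "e = 1 - q ^ Suc k"
    have e: "e \<noteq> 0" using q1[of "Suc k"] by (simp add: e_def)
    have "qpoch (q powi (- int (Suc y))) q (Suc k) = (1 - q powi (- int (Suc y))) * A"
      unfolding qpoch_Suc_left shift A_def ..
    moreover have "qpoch (q powi (- int y)) q (Suc k) = A * (1 - q powi (- int (Suc y)) * q ^ Suc k)"
      unfolding qpoch_Suc A_def shift[of y, symmetric] by simp
    \<comment> \<open>The factor \<open>e\<close> of this difference is the last factor of
      \<open>qpoch q q (Suc k)\<close> and cancels it; splitting off the first factors of the other
      symbols lowers \<open>x\<close> and \<open>N\<close> and turns \<open>a\<close> into
      \<open>a * q\<close>.\<close>
    ultimately have 1: "qpoch (q powi (- int (Suc y))) q (Suc k) - qpoch (q powi (- int y)) q (Suc k)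
        = - (q powi (- int (Suc y))) * A * e"
      by (simp add: e_def algebra_simps)
    define u where "u = 1 - q powi (- int (Suc x))"
    define v where "v = 1 - q powi (- int (Suc N))"
    define B where "B = qpoch (q powi (- int x)) q k"
    define C where "C = qpoch (q powi (- int N)) q k"
    define D where "D = qpoch (a * q) q k"
    define E where "E = qpoch q q k"
    have 2: "c (Suc k) = (u * B) / ((v * C) * ((1 - a) * D) * (E * e)) * (q ^ k * q)"
      unfolding c_def qpoch_Suc_left[of "q powi _"] qpoch_Suc_left[of a] shift
        qpoch_Suc[of q] u_def v_def B_def C_def D_def E_def e_def by simp
    show "(qpoch (q powi (- int (Suc y))) q (Suc k) - qpoch (q powi (- int y)) q (Suc k)) * c (Suc k)
      = - (q powi (- int y)) * (1 - q powi (- int (Suc x))) / ((1 - q powi (- int (Suc N))) * (1 - a))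
      * (qpoch (q powi (- int y)) q k * qpoch (q powi (- int x)) q k
        / (qpoch (q powi (- int N)) q k * qpoch (a * q) q k * qpoch q q k) * q ^ k)"
      unfolding 1 2 u_def[symmetric] v_def[symmetric] A_def[symmetric] B_def[symmetric]
        C_def[symmetric] D_def[symmetric] E_def[symmetric]
      unfolding shift[of y, symmetric] using e by (simp add: ac_simps)
  qed
  finally show ?thesis
    by (simp add: affine_q_Krawtchouk_def sum_distrib_left)
qed

lemma affine_q_Krawtchouk_x0 [simp]: "affine_q_Krawtchouk y 0 a N q = 1"
proof -
  have "qpoch (1::'a) q (Suc k) = 0" for k
    by (simp add: qpoch_Suc_left)
  thus ?thesis
    unfolding affine_q_Krawtchouk_def by (cases y) (simp_all add: sum.atLeast0_atMost_Suc_shift del: sum.cl_ivl_Suc)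
qed

lemma affine_q_Krawtchouk_y0 [simp]: "affine_q_Krawtchouk 0 x a N q = 1"
  by (simp add: affine_q_Krawtchouk_def)

text \<open>Among the exponents \<open>n - i\<close>, the even and the odd ones form two Pochhammer
  symbols in \<open>q\<^sup>2\<close>. Which of them starts at \<open>q ^ n\<close> depends on the
  parity of \<open>n\<close>; this is the origin of \<open>(- 1) ^ n\<close> in the claim.\<close>

lemma prod_split_parity:
  fixes q :: "'a::field"
  assumes "q \<noteq> 0"
  shows "(\<Prod>i<2*x. 1 - q ^ n / q ^ i)
    = qpoch (q powi (2 * int (n div 2) - (- 1) ^ n)) (q powi (- 2)) x
      * qpoch ((q\<^sup>2) ^ (n div 2)) (inverse (q\<^sup>2)) x"
proof (induction x)
  case (Suc x)
  have p: "(q powi (- 2)) ^ x = 1 / q ^ (2 * x)" "inverse (q\<^sup>2) ^ x = 1 / q ^ (2 * x)"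
    by (simp_all add: power_int_minus power_mult power_inverse inverse_eq_divide power_divide)
  have "(1 - q ^ n / q ^ (2 * x)) * (1 - q ^ n / q ^ Suc (2 * x))
    = (1 - q powi (2 * int (n div 2) - (- 1) ^ n) * (1 / q ^ (2 * x)))
      * (1 - (q\<^sup>2) ^ (n div 2) * (1 / q ^ (2 * x)))"
  proof (cases "even n")
    case True
    then obtain m where m: "n = 2 * m" by auto
    hence "n div 2 = m" "(- 1) ^ n = (1::int)" "(q\<^sup>2) ^ m = q ^ n"
      by (simp_all add: power_mult)
    moreover have "q powi (2 * int m - 1) = q ^ n / q"
      using assms by (simp add: power_int_diff m power_int_mult power_mult)
    ultimately show ?thesis by (simp add: mult.commute)
  next
    case False
    then obtain m where m: "n = 2 * m + 1" by (elim oddE)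
    hence "n div 2 = m" "(- 1) ^ n = (- 1::int)" "(q\<^sup>2) ^ m = q ^ n / q"
      using assms by (simp_all add: power_mult)
    moreover have "q powi (2 * int m + 1) = q ^ n"
      using assms by (simp add: power_int_add m power_int_mult power_mult)
    ultimately show ?thesis by simp
  qed
  thus ?case
    by (simp add: qpoch_Suc p Suc.IH)
qed simp

text \<open>Both sides obey the same recursion in \<open>y\<close> once the prefactors are taken
  out. The bound on \<open>y\<close> guarantees \<open>n \<ge> 2\<close> in the step, so that size
  \<open>n - 2\<close> exists.\<close>

lemma kraw_eq_affine_q_Krawtchouk:
  fixes q :: "'a::field"
  assumes q0: "q \<noteq> 0" and q1: "\<And>k. k > 0 \<Longrightarrow> q ^ k \<noteq> 1" and "y \<le> n div 2"
  shows "kraw q y (q ^ n) x = (- 1) ^ x * q ^ (x\<^sup>2)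
    * qpoch (q powi (2 * int (n div 2) - (- 1) ^ n)) (q powi (- 2)) x * qbinom (n div 2) x (q\<^sup>2)
    * affine_q_Krawtchouk y x (q powi (- 2 * int (n div 2) + (- 1) ^ n)) (n div 2) (q\<^sup>2)"
  using assms(3)
proof (induction y arbitrary: n x)
  case 0
  show ?case
    by (simp add: prod_split_parity[OF q0] qbinom_def)
next
  case (Suc y)
  define m where "m = n - 2"
  have n: "n = m + 2" and y: "y \<le> m div 2" "y \<le> n div 2"
    using Suc.prems by (auto simp: m_def)
  define N where "N = m div 2"
  have N: "n div 2 = Suc N" by (simp add: n N_def)
  show ?case
  proof (cases x)
    case 0
    thus ?thesis by (simp add: qbinom_def)
  next
    case (Suc z)
    define M where "M = 2 * int (Suc N) - (- 1) ^ n"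
    define u w v t where "u = q powi M" and "w = (q\<^sup>2) ^ Suc N" and "v = (q\<^sup>2) ^ Suc z"
      and "t = (q\<^sup>2) ^ y"
    \<comment> \<open>The exponents \<open>M\<close> and \<open>2 * Suc N\<close> are
      \<open>n\<close> and \<open>n - 1\<close> in some order, so \<open>u * w\<close> is
      \<open>q ^ (2 * n - 1)\<close> for both parities.\<close>
    have M: "M > 0" "M + 2 * int (Suc N) = 2 * int n - 1"
      by (cases "even n"; force simp: M_def n N_def elim: evenE oddE)+
    have "u = q ^ nat M" using M(1) by (simp add: u_def power_int_def)
    hence u: "u \<noteq> 1" "u \<noteq> 0" using q1[of "nat M"] M(1) q0 by auto
    have w: "w \<noteq> 1" "w \<noteq> 0" using q1[of "2 * Suc N"] q0 unfolding w_def power_mult[symmetric] by auto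
    have v: "v \<noteq> 1" "v \<noteq> 0" using q1[of "2 * Suc z"] q0 unfolding v_def power_mult[symmetric] by auto
    have t: "t \<noteq> 0" using q0 by (simp add: t_def)
    have w': "w = q powi (2 * int (Suc N))"
      unfolding w_def power_mult[symmetric] by (simp add: power_int_def nat_add_distrib nat_mult_distrib)
    have "u * w = q powi (2 * int n - 1)"
      using q0 unfolding u_def w' M(2)[symmetric] by (subst power_int_add) auto
    also have "\<dots> = (q ^ n)\<^sup>2 / q"
      using q0 by (simp add: power_int_diff power_int_mult power_mult power2_eq_square)
        (simp add: power_mult_distrib power_add mult_2)
    finally have uw: "(q ^ n)\<^sup>2 = u * w * q" using q0 by simp
    \<comment> \<open>The prefactor of the claim for \<open>m\<close> and \<open>z\<close>; passing
      to \<open>n\<close> and \<open>Suc z\<close> multiplies it by \<open>- Z\<close>, with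
      \<open>Z\<close> as below.\<close>
    define R where "R = (- 1) ^ z * q ^ (z\<^sup>2)
      * qpoch (q powi (2 * int N - (- 1) ^ m)) (q powi (- 2)) z * qbinom N z (q\<^sup>2)"
    define a where "a = q powi (- 2 * int (Suc N) + (- 1) ^ n)"
    have a: "a = inverse u" by (simp add: a_def u_def M_def power_int_minus[symmetric] algebra_simps)
    have aq: "a * q\<^sup>2 = q powi (- 2 * int N + (- 1) ^ m)"
    proof -
      have "a * q\<^sup>2 = q powi (- 2 * int (Suc N) + (- 1) ^ n) * q powi 2"
        by (simp add: a_def)
      also have "\<dots> = q powi (- 2 * int N + (- 1) ^ m)"
        using q0 by (subst power_int_add[symmetric]) (auto simp: n)
      finally show ?thesis .
    qed
    have pre: "(- 1) ^ Suc z * q ^ ((Suc z)\<^sup>2)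
        * qpoch (q powi M) (q powi (- 2)) (Suc z) * qbinom (Suc N) (Suc z) (q\<^sup>2)
        = - R * (v / q) * (1 - u) * (1 - w) / (1 - v)"
    proof -
      have 1: "q powi M * q powi (- 2) = q powi (2 * int N - (- 1) ^ m)"
        using q0 by (subst power_int_add[symmetric]) (auto simp: M_def n)
      have 2: "(q\<^sup>2) ^ Suc N * inverse (q\<^sup>2) = (q\<^sup>2) ^ N" using q0 by (simp add: field_simps)
      have 3: "q ^ ((Suc z)\<^sup>2) = q ^ (z\<^sup>2) * (v / q)"
        using q0 by (simp add: power2_eq_square power_add v_def power_mult_distrib mult_2 mult_2_right algebra_simps)
      have 4: "q\<^sup>2 * (q\<^sup>2) ^ z = v" by (simp add: v_def)
      show ?thesis
        unfolding qbinom_def qpoch_Suc_left[of "q powi M"] qpoch_Suc_left[of "(q\<^sup>2) ^ Suc N"]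
          qpoch_Suc[of "q\<^sup>2" "q\<^sup>2"] 1 2 3 4 R_def
        unfolding u_def[symmetric] w_def[symmetric] by (simp add: ac_simps)
    qed
    have q1': "(q\<^sup>2) ^ k \<noteq> 1" if "k > 0" for k
      using q1[of "2 * k"] that by (simp add: power_mult)
    have inv: "(q\<^sup>2) powi (- int k) = inverse ((q\<^sup>2) ^ k)" for k
      by (simp add: power_int_minus)
    define K where "K = affine_q_Krawtchouk y (Suc z) a (Suc N) (q\<^sup>2)"
    define K' where "K' = affine_q_Krawtchouk y z (a * q\<^sup>2) N (q\<^sup>2)"
    have "affine_q_Krawtchouk (Suc y) (Suc z) a (Suc N) (q\<^sup>2) - K
        = - inverse t * (1 - inverse v) / ((1 - inverse w) * (1 - inverse u)) * K'"
      using affine_q_Krawtchouk_Suc[of "q\<^sup>2" y z a N, OF _ q1'] q0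
      unfolding inv t_def[symmetric] v_def[symmetric] w_def[symmetric] a[symmetric]
        K_def[symmetric] K'_def[symmetric] by simp
    hence K: "affine_q_Krawtchouk (Suc y) (Suc z) a (Suc N) (q\<^sup>2)
        = K - inverse t * (1 - inverse v) / ((1 - inverse w) * (1 - inverse u)) * K'"
      by (simp only: diff_eq_eq) simp
    have IH1: "kraw q y (q ^ n) (Suc z) = - R * (v / q) * (1 - u) * (1 - w) / (1 - v) * K"
      using Suc.IH[OF y(2), of "Suc z"] unfolding N a_def[symmetric] K_def[symmetric]
        M_def[symmetric] pre .
    have IH2: "kraw q y (q ^ m) z = R * K'"
      using Suc.IH[OF y(1), of z] unfolding N_def[symmetric] aq[symmetric] K'_def[symmetric]
        R_def[symmetric] .
    have m: "q ^ n / q\<^sup>2 = q ^ m" using q0 by (simp add: n power_add power2_eq_square)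
    have t': "q ^ (2 * y + 2) = t * q\<^sup>2" by (simp only: t_def power_mult power_add)
    have inv': "1 - inverse a = - ((1 - a) / a)" if "a \<noteq> 0" for a :: 'a
      using that by (simp add: field_simps)
    define Z where "Z = (v / q) * (1 - u) * (1 - w) / (1 - v)"
    define Y where "Y = inverse t * (1 - inverse v) / ((1 - inverse w) * (1 - inverse u))"
    \<comment> \<open>Here the recursions meet: \<open>Z * Y\<close> is
      \<open>- (X\<^sup>2 / q ^ (2 * y + 2))\<close> for \<open>X = q ^ n\<close>, the coefficient
      in \<open>kraw\<close>.\<close>
    have ZY: "Z * Y = - (u * w * q / (t * q\<^sup>2))"
      using u w v t q0 unfolding Z_def Y_def inv'[OF u(2)] inv'[OF v(2)] inv'[OF w(2)]
      by (simp add: power2_eq_square inverse_eq_divide) (simp add: ac_simps)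
    have "- R * Z * (K - Y * K') = - R * Z * K + R * (Z * Y) * K'"
      by (simp add: algebra_simps)
    also have "\<dots> = - R * Z * K - u * w * q / (t * q\<^sup>2) * (R * K')"
      unfolding ZY by (simp only: mult_minus_left mult_minus_right diff_conv_add_uminus) (simp add: ac_simps)
    finally have "- R * Z * (K - Y * K') = - R * Z * K - u * w * q / (t * q\<^sup>2) * (R * K')" .
    thus ?thesis
      unfolding Suc kraw.simps m IH1 IH2 N M_def[symmetric] a_def[symmetric] K pre uw t' Z_def Y_def
      by (simp add: mult.assoc)
  qed
qed

subsection \<open>Symmetric matrices and their quadratic forms\<close>

text \<open>Row and column of the border are independent because non-symmetric matrices of this
  shape serve as coordinate changes.\<close>

definition bordered :: "'a \<Rightarrow> 'a vec \<Rightarrow> 'a vec \<Rightarrow> 'a mat \<Rightarrow> 'a mat" where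
  "bordered c r s H = mat (Suc (dim_row H)) (Suc (dim_col H))
     (\<lambda>(i, j). case i of 0 \<Rightarrow> (case j of 0 \<Rightarrow> c | Suc j \<Rightarrow> r $ j)
        | Suc i \<Rightarrow> (case j of 0 \<Rightarrow> s $ i | Suc j \<Rightarrow> H $$ (i, j)))"

definition quad_form :: "'a::semiring_0 mat \<Rightarrow> 'a vec \<Rightarrow> 'a" where
  "quad_form a v = v \<bullet> (a *\<^sub>v v)"

text \<open>The rank-one correction that occurs in Schur complements of bordered symmetric
  matrices.\<close>

definition outer_square :: "'a::times vec \<Rightarrow> 'a mat" where
  "outer_square w = mat (dim_vec w) (dim_vec w) (\<lambda>(i, j). w $ i * w $ j)"

lemma bordered_carrier [simp]:
  "H \<in> carrier_mat n m \<Longrightarrow> bordered c r s H \<in> carrier_mat (Suc n) (Suc m)"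
  by (auto simp: bordered_def)

lemma dim_bordered [simp]:
  "dim_row (bordered c r s H) = Suc (dim_row H)" "dim_col (bordered c r s H) = Suc (dim_col H)"
  by (auto simp: bordered_def)

lemma bordered_mult_vec:
  assumes "r \<in> carrier_vec n" "s \<in> carrier_vec n" "H \<in> carrier_mat n n" "u \<in> carrier_vec n"
  shows "bordered c r s H *\<^sub>v vCons t u = vCons (c * t + r \<bullet> u) (t \<cdot>\<^sub>v s + H *\<^sub>v (u :: 'a::comm_semiring_1 vec))"
proof (rule eq_vecI)
  fix i assume i: "i < dim_vec (vCons (c * t + r \<bullet> u) (t \<cdot>\<^sub>v s + H *\<^sub>v u))"
  have r0: "row (bordered c r s H) 0 = vCons c r"
    using assms by (intro eq_vecI) (auto simp: bordered_def vec_index_vCons split: nat.splits)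
  have rS: "row (bordered c r s H) (Suc k) = vCons (s $ k) (row H k)" if "k < n" for k
    using assms that by (intro eq_vecI) (auto simp: bordered_def vec_index_vCons split: nat.splits)
  show "(bordered c r s H *\<^sub>v vCons t u) $ i = vCons (c * t + r \<bullet> u) (t \<cdot>\<^sub>v s + H *\<^sub>v u) $ i"
    using i assms by (cases i) (auto simp: r0 rS mult.commute)
qed (use assms in auto)

lemma transpose_bordered:
  assumes "r \<in> carrier_vec n" "s \<in> carrier_vec n" "H \<in> carrier_mat n n"
  shows "transpose_mat (bordered c r s H) = bordered c s r (transpose_mat H)"
  using assms by (intro eq_matI) (auto simp: bordered_def split: nat.splits)

lemma bordered_Sym [simp]:
  assumes "w \<in> carrier_vec n" "A \<in> Sym n"
  shows "bordered c w w A \<in> Sym (Suc n)"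
  using assms transpose_bordered[of w n w A c] by (auto simp: Sym_def)

lemma Sym_carrier: "a \<in> Sym n \<Longrightarrow> a \<in> carrier_mat n n"
  by (simp add: Sym_def)

lemma bordered_inject:
  assumes "w \<in> carrier_vec n" "w' \<in> carrier_vec n" "A \<in> carrier_mat n n" "A' \<in> carrier_mat n n"
  shows "bordered c w w A = bordered c' w' w' A' \<longleftrightarrow> c = c' \<and> w = w' \<and> A = A'"
proof
  assume eq: "bordered c w w A = bordered c' w' w' A'"
  have e: "bordered c w w A $$ (i, j) = bordered c' w' w' A' $$ (i, j)" for i j
    using eq by simp
  have "c = c'" using e[of 0 0] assms by (simp add: bordered_def)
  moreover have "w = w'"
  proof (rule eq_vecI)
    fix i assume "i < dim_vec w'"
    thus "w $ i = w' $ i" using e[of 0 "Suc i"] assms by (simp add: bordered_def)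
  qed (use assms in simp)
  moreover have "A = A'"
  proof (rule eq_matI)
    fix i j assume "i < dim_row A'" "j < dim_col A'"
    thus "A $$ (i, j) = A' $$ (i, j)" using e[of "Suc i" "Suc j"] assms by (simp add: bordered_def)
  qed (use assms in simp_all)
  ultimately show "c = c' \<and> w = w' \<and> A = A'" by simp
qed simp

lemma Sym_Suc_cases:
  assumes "a \<in> Sym (Suc n)"
  obtains c w A where "w \<in> carrier_vec n" "A \<in> Sym n" "a = bordered c w w A"
proof -
  have a: "a \<in> carrier_mat (Suc n) (Suc n)" and t: "transpose_mat a = a"
    using assms by (auto simp: Sym_def)
  have sym: "a $$ (i, j) = a $$ (j, i)" if "i < Suc n" "j < Suc n" for i j
    using that a arg_cong[OF t, of "\<lambda>m. m $$ (i, j)"] by auto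
  show thesis
  proof (rule that[of "vec n (\<lambda>i. a $$ (0, Suc i))" "mat n n (\<lambda>(i, j). a $$ (Suc i, Suc j))" "a $$ (0, 0)"])
    show "mat n n (\<lambda>(i, j). a $$ (Suc i, Suc j)) \<in> Sym n"
      using sym by (auto simp: Sym_def intro!: eq_matI)
    show "a = bordered (a $$ (0, 0)) (vec n (\<lambda>i. a $$ (0, Suc i))) (vec n (\<lambda>i. a $$ (0, Suc i)))
        (mat n n (\<lambda>(i, j). a $$ (Suc i, Suc j)))"
      using a sym by (intro eq_matI) (auto simp: bordered_def split: nat.splits)
  qed simp
qed

lemma sum_Sym_Suc:
  fixes f :: "'a::field mat \<Rightarrow> 'b::comm_monoid_add"
  shows "(\<Sum>a\<in>Sym (Suc n). f a) = (\<Sum>c\<in>UNIV. \<Sum>w\<in>carrier_vec n. \<Sum>A\<in>Sym n. f (bordered c w w A))"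
proof -
  have "bij_betw (\<lambda>(c, w, A). bordered c w w A) ((UNIV :: 'a set) \<times> carrier_vec n \<times> Sym n) (Sym (Suc n))"
  proof (rule bij_betwI')
    fix x y :: "'a \<times> 'a vec \<times> 'a mat"
    assume "x \<in> UNIV \<times> carrier_vec n \<times> Sym n" "y \<in> UNIV \<times> carrier_vec n \<times> Sym n"
    then obtain c w A c' w' A' where "x = (c, w, A)" "y = (c', w', A')"
      "w \<in> carrier_vec n" "w' \<in> carrier_vec n" "A \<in> Sym n" "A' \<in> Sym n" by auto
    thus "(case x of (c, w, A) \<Rightarrow> bordered c w w A) = (case y of (c, w, A) \<Rightarrow> bordered c w w A)
        \<longleftrightarrow> x = y"
      by (simp add: bordered_inject[of w n w' A A' c c'] Sym_carrier)
  next
    fix x :: "'a \<times> 'a vec \<times> 'a mat" assume "x \<in> UNIV \<times> carrier_vec n \<times> Sym n"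
    thus "(case x of (c, w, A) \<Rightarrow> bordered c w w A) \<in> Sym (Suc n)" by auto
  next
    fix y :: "'a mat" assume "y \<in> Sym (Suc n)"
    then obtain c w A where "w \<in> carrier_vec n" "A \<in> Sym n" "y = bordered c w w A"
      by (rule Sym_Suc_cases)
    thus "\<exists>x\<in>UNIV \<times> carrier_vec n \<times> Sym n. y = (case x of (c, w, A) \<Rightarrow> bordered c w w A)"
      by (intro bexI[of _ "(c, w, A)"]) auto
  qed
  from sum.reindex_bij_betw[OF this, of f, symmetric] show ?thesis
    by (simp add: sum.cartesian_product split_def)
qed

lemma carrier_vec_Suc_cases:
  assumes "v \<in> carrier_vec (Suc n)"
  obtains t u where "u \<in> carrier_vec n" "v = vCons t u"
  using assms by (cases v) auto

lemma carrier_vec_Suc: "carrier_vec (Suc n) = (\<lambda>(t, u). vCons t u) ` (UNIV \<times> carrier_vec n)"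
proof (intro equalityI subsetI)
  fix v :: "'a vec" assume "v \<in> carrier_vec (Suc n)"
  then obtain t u where "u \<in> carrier_vec n" "v = vCons t u" by (rule carrier_vec_Suc_cases)
  thus "v \<in> (\<lambda>(t, u). vCons t u) ` (UNIV \<times> carrier_vec n)"
    by (intro image_eqI[of _ _ "(t, u)"]) simp_all
next
  fix v :: "'a vec" assume "v \<in> (\<lambda>(t, u). vCons t u) ` (UNIV \<times> carrier_vec n)"
  then obtain t u where "u \<in> carrier_vec n" "v = vCons t u" by auto
  thus "v \<in> carrier_vec (Suc n)" by simp
qed

lemma sum_carrier_vec_Suc:
  "(\<Sum>v\<in>carrier_vec (Suc n). f v) = (\<Sum>t\<in>UNIV. \<Sum>u\<in>carrier_vec n. f (vCons t u))"
  unfolding carrier_vec_Suc by (subst sum.reindex) (auto simp: inj_on_def sum.cartesian_product split_def)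

lemma carrier_vec_0 [simp]: "carrier_vec 0 = {vNil}"
proof (intro equalityI subsetI)
  fix v :: "'a vec" assume "v \<in> carrier_vec 0"
  hence "dim_vec v = 0" by (rule carrier_vecD)
  hence "v = vNil" by (intro eq_vecI) simp_all
  thus "v \<in> {vNil}" by simp
next
  fix v :: "'a vec" assume "v \<in> {vNil}"
  hence "v = vNil" by simp
  thus "v \<in> carrier_vec 0" by (simp only: vec_carrier)
qed

lemma finite_carrier_vec [simp]: "finite (carrier_vec n :: 'a::finite vec set)"
  by (induction n) (simp_all add: carrier_vec_Suc)

lemma Sym_0: "Sym 0 = {0\<^sub>m 0 0}"
  by (auto simp: Sym_def intro!: eq_matI)

lemma card_carrier_vec: "card (carrier_vec n :: 'a::finite vec set) = CARD('a) ^ n"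
proof (induction n)
  case (Suc n)
  have "card (carrier_vec (Suc n) :: 'a vec set) = (\<Sum>v\<in>(carrier_vec (Suc n) :: 'a vec set). 1)"
    by simp
  also have "\<dots> = CARD('a) ^ Suc n"
    unfolding sum_carrier_vec_Suc using Suc by simp
  finally show ?case .
qed simp

lemma finite_Sym [simp]: "finite (Sym n :: 'a::{field,finite} mat set)"
proof (induction n)
  case (Suc n)
  have "Sym (Suc n) \<subseteq> (\<lambda>(c, w, A). bordered c w w A) ` ((UNIV :: 'a set) \<times> carrier_vec n \<times> Sym n)"
  proof
    fix a :: "'a mat" assume "a \<in> Sym (Suc n)"
    then obtain c w A where "w \<in> carrier_vec n" "A \<in> Sym n" "a = bordered c w w A"
      by (rule Sym_Suc_cases)
    thus "a \<in> (\<lambda>(c, w, A). bordered c w w A) ` ((UNIV :: 'a set) \<times> carrier_vec n \<times> Sym n)"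
      by (intro image_eqI[of _ _ "(c, w, A)"]) simp_all
  qed
  thus ?case by (rule finite_subset) (simp add: Suc)
qed (simp add: Sym_0)

lemma zero_Sym [simp]: "0\<^sub>m n n \<in> Sym n"
  by (simp add: Sym_def)

lemma quad_form_bordered:
  assumes "w \<in> carrier_vec n" "A \<in> carrier_mat n n" "u \<in> carrier_vec n"
  shows "quad_form (bordered c w w A) (vCons t u)
    = c * t\<^sup>2 + 2 * t * (w \<bullet> u) + quad_form A (u :: 'a::comm_ring_1 vec)"
proof -
  have "u \<bullet> (t \<cdot>\<^sub>v w + A *\<^sub>v u) = t * (w \<bullet> u) + quad_form A u"
    using assms by (simp add: scalar_prod_add_distrib[of _ n] quad_form_def comm_scalar_prod[of u n w])
  thus ?thesis
    using assms by (simp add: quad_form_def bordered_mult_vec power2_eq_square algebra_simps)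
qed

lemma quad_form_congruence:
  assumes "h \<in> carrier_mat n n" "a \<in> carrier_mat n n" "v \<in> carrier_vec n"
  shows "quad_form (h * a * transpose_mat h) v = quad_form a (transpose_mat h *\<^sub>v (v :: 'a::comm_ring_1 vec))"
proof -
  have "(h * a * transpose_mat h) *\<^sub>v v = h *\<^sub>v (a *\<^sub>v (transpose_mat h *\<^sub>v v))"
    using assms by (simp add: assoc_mult_mat_vec[of _ n n _ n])
  thus ?thesis
    using assms transpose_vec_mult_scalar[of h n n "a *\<^sub>v (transpose_mat h *\<^sub>v v)" v]
    by (simp add: quad_form_def)
qed

lemma congruence_Sym:
  assumes "h \<in> carrier_mat n n" "a \<in> Sym n"
  shows "h * a * transpose_mat h \<in> Sym n"
proof -
  have a: "a \<in> carrier_mat n n" "transpose_mat a = a" using assms(2) by (auto simp: Sym_def)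
  have "transpose_mat (h * a * transpose_mat h) = h * (a * transpose_mat h)"
    using assms a by (simp add: transpose_mult[of _ n n _ n])
  also have "\<dots> = h * a * transpose_mat h"
    using assms a by (simp add: assoc_mult_mat[of _ n n _ n _ n])
  finally show ?thesis using assms a by (simp add: Sym_def)
qed

lemma quad_form_smult:
  assumes "a \<in> carrier_mat n n" "v \<in> carrier_vec n"
  shows "quad_form a (k \<cdot>\<^sub>v v) = k\<^sup>2 * quad_form a (v :: 'a::field vec)"
  using assms by (simp add: quad_form_def mult_mat_vec[of _ n n] power2_eq_square
      smult_scalar_prod_distrib[of _ n] scalar_prod_smult_distrib[of _ n] mult.assoc)

lemma Sym_scalar_prod_commute:
  assumes "a \<in> Sym n" "u \<in> carrier_vec n" "v \<in> carrier_vec n"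
  shows "v \<bullet> (a *\<^sub>v u) = (a *\<^sub>v v) \<bullet> u"
  using transpose_vec_mult_scalar[of a n n u v] assms by (simp add: Sym_def)

lemma quad_form_add:
  assumes "a \<in> Sym n" "u \<in> carrier_vec n" "v \<in> carrier_vec n"
  shows "quad_form a (u + v) = quad_form a u + 2 * ((a *\<^sub>v u) \<bullet> v) + quad_form a v"
proof -
  have a: "a \<in> carrier_mat n n" using assms by (simp add: Sym_carrier)
  have "u \<bullet> (a *\<^sub>v v) = (a *\<^sub>v u) \<bullet> v" by (rule Sym_scalar_prod_commute) (use assms in auto)
  moreover have "v \<bullet> (a *\<^sub>v u) = (a *\<^sub>v u) \<bullet> v"
    by (rule comm_scalar_prod[of _ n]) (use assms a in auto)
  ultimately show ?thesis
    using assms a by (simp add: quad_form_def mult_add_distrib_mat_vec[of _ n n]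
        add_scalar_prod_distrib[of _ n] scalar_prod_add_distrib[of _ n])
qed

lemma mat_mult_unit_vec:
  assumes "a \<in> carrier_mat n n" "j < n"
  shows "a *\<^sub>v unit_vec n j = col (a :: 'a::semiring_1 mat) j"
  using assms by (intro eq_vecI) auto

lemma mat_mult_zero_vec: "A \<in> carrier_mat n m \<Longrightarrow> A *\<^sub>v 0\<^sub>v m = 0\<^sub>v n"
  by (intro eq_vecI) auto

lemma mat_eq_if_mult_vec_eq:
  assumes "a \<in> carrier_mat n n" "b \<in> carrier_mat n n"
    and "\<And>v. v \<in> carrier_vec n \<Longrightarrow> a *\<^sub>v v = b *\<^sub>v (v :: 'a::field vec)"
  shows "a = b"
proof (rule eq_matI)
  fix i j assume "i < dim_row b" "j < dim_col b"
  hence ij: "i < n" "j < n" using assms by auto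
  have "col a j = col b j"
    using assms(3)[of "unit_vec n j"] ij assms(1,2) by (simp add: mat_mult_unit_vec)
  hence "col a j $ i = col b j $ i" by simp
  thus "a $$ (i, j) = b $$ (i, j)" using ij assms by simp
qed (use assms in auto)

text \<open>Polarization, using division by 2. It allows congruences to be checked on values of
  forms instead of matrix entries.\<close>

lemma Sym_eq_if_quad_form_eq:
  assumes two: "(2::'a::field) \<noteq> 0" and ab: "a \<in> Sym n" "b \<in> Sym n"
    and eq: "\<And>v. v \<in> carrier_vec n \<Longrightarrow> quad_form a v = quad_form b (v :: 'a vec)"
  shows "a = b"
proof (rule mat_eq_if_mult_vec_eq)
  fix u :: "'a vec" assume u: "u \<in> carrier_vec n"
  have "2 * ((a *\<^sub>v u) \<bullet> v) = 2 * ((b *\<^sub>v u) \<bullet> v)" if v: "v \<in> carrier_vec n" for v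
  proof -
    have "quad_form b u + 2 * ((a *\<^sub>v u) \<bullet> v) + quad_form b v
        = quad_form b u + 2 * ((b *\<^sub>v u) \<bullet> v) + quad_form b v"
      unfolding quad_form_add[OF ab(2) u v, symmetric]
      using quad_form_add[OF ab(1) u v] eq[OF u] eq[OF v] eq[of "u + v"] u v by simp
    thus ?thesis by (simp only: add_right_cancel add_left_cancel)
  qed
  hence *: "(a *\<^sub>v u) \<bullet> v = (b *\<^sub>v u) \<bullet> v" if "v \<in> carrier_vec n" for v
    using that two by simp
  show "a *\<^sub>v u = b *\<^sub>v u"
  proof (rule eq_vecI)
    fix i assume "i < dim_vec (b *\<^sub>v u)"
    hence "i < n" using ab by (auto simp: Sym_def)
    thus "(a *\<^sub>v u) $ i = (b *\<^sub>v u) $ i"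
      using *[of "unit_vec n i"] ab u by (simp add: scalar_prod_right_unit[of _ n] Sym_carrier)
  qed (use ab in \<open>auto simp: Sym_def\<close>)
qed (use ab in \<open>auto simp: Sym_carrier\<close>)

section \<open>Invertible matrices and congruence orbits\<close>

lemma invertible_mat_obtain_inverse:
  assumes "h \<in> carrier_mat n n" "invertible_mat (h :: 'a::semiring_1 mat)"
  obtains k where "k \<in> carrier_mat n n" "h * k = 1\<^sub>m n" "k * h = 1\<^sub>m n"
proof -
  obtain k where k: "inverts_mat h k" "inverts_mat k h"
    using assms(2) by (auto simp: invertible_mat_def)
  have hk: "h * k = 1\<^sub>m n" using k(1) assms(1) by (simp add: inverts_mat_def)
  have kh: "k * h = 1\<^sub>m (dim_row k)" using k(2) by (simp add: inverts_mat_def)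
  have "dim_col k = n" using arg_cong[OF hk, of dim_col] by simp
  moreover have "dim_row k = n" using arg_cong[OF kh, of dim_col] assms(1) by simp
  ultimately show thesis using hk kh by (intro that[of k]) auto
qed

lemma invertible_matI:
  assumes "h \<in> carrier_mat n n" "k \<in> carrier_mat n n" "h * k = 1\<^sub>m n" "k * h = 1\<^sub>m n"
  shows "invertible_mat h"
  using assms by (auto simp: invertible_mat_def inverts_mat_def square_mat.simps intro!: exI[of _ k])

lemma invertible_mat_if_inj:
  assumes h: "h \<in> carrier_mat n n"
    and inj: "\<And>v. v \<in> carrier_vec n \<Longrightarrow> h *\<^sub>v v = 0\<^sub>v n \<Longrightarrow> v = 0\<^sub>v n"
  shows "invertible_mat (h :: 'a::field mat)"
proof -
  have "det h \<noteq> 0" using det_0_iff_vec_prod_zero_field[OF h] inj by blast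
  hence "h \<in> Units (ring_mat TYPE('a) n ())" by (rule det_non_zero_imp_unit[OF h])
  then obtain k where "k \<in> carrier_mat n n" "k * h = 1\<^sub>m n" "h * k = 1\<^sub>m n"
    unfolding Units_def by (auto simp: ring_mat_def)
  thus ?thesis by (intro invertible_matI[OF h])
qed

lemma invertible_mat_transpose:
  assumes "h \<in> carrier_mat n n" "invertible_mat (h :: 'a::comm_ring_1 mat)"
  shows "invertible_mat (transpose_mat h)"
proof -
  obtain k where k: "k \<in> carrier_mat n n" "h * k = 1\<^sub>m n" "k * h = 1\<^sub>m n"
    using invertible_mat_obtain_inverse[OF assms] .
  have "transpose_mat h * transpose_mat k = 1\<^sub>m n" "transpose_mat k * transpose_mat h = 1\<^sub>m n"
    using transpose_mult[of h n n k n, symmetric] transpose_mult[of k n n h n, symmetric] assms(1) k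
    by simp_all
  thus ?thesis by (intro invertible_matI[of _ n "transpose_mat k"]) (use assms k in auto)
qed

lemma same_orbit_intro:
  "g \<in> carrier_mat n n \<Longrightarrow> invertible_mat g \<Longrightarrow> a = g * b * transpose_mat g \<Longrightarrow> same_orbit n a b"
  unfolding same_orbit_def by blast

lemma same_orbit_refl: "a \<in> carrier_mat n n \<Longrightarrow> same_orbit n a (a :: 'a::field mat)"
  by (rule same_orbit_intro[of "1\<^sub>m n"]) (simp_all add: invertible_matI[of "1\<^sub>m n" n "1\<^sub>m n"])

lemma same_orbit_trans:
  assumes "same_orbit n a b" "same_orbit n b c" "c \<in> carrier_mat n n"
  shows "same_orbit n a (c :: 'a::field mat)"
proof -
  obtain g h where g: "g \<in> carrier_mat n n" "invertible_mat g" "a = g * b * transpose_mat g"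
    and h: "h \<in> carrier_mat n n" "invertible_mat h" "b = h * c * transpose_mat h"
    using assms by (auto simp: same_orbit_def)
  obtain g' h' where g': "g' \<in> carrier_mat n n" "g * g' = 1\<^sub>m n" "g' * g = 1\<^sub>m n"
    and h': "h' \<in> carrier_mat n n" "h * h' = 1\<^sub>m n" "h' * h = 1\<^sub>m n"
    by (rule invertible_mat_obtain_inverse[OF g(1,2)], rule invertible_mat_obtain_inverse[OF h(1,2)])
  note assoc = assoc_mult_mat[of _ n n _ n _ n]
  have "(g * h) * (h' * g') = g * (h * h') * g'" "(h' * g') * (g * h) = h' * (g' * g) * h"
    using g(1) h(1) g'(1) h'(1) by (simp_all add: assoc)
  hence "invertible_mat (g * h)"
    using g(1) h(1) g' h' by (intro invertible_matI[of _ n "h' * g'"]) simp_all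
  moreover have "a = (g * h) * c * transpose_mat (g * h)"
    using g(1) h(1) assms(3) by (simp add: g(3) h(3) assoc transpose_mult[of g n n h n])
  ultimately show ?thesis
    using g(1) h(1) by (intro same_orbit_intro[of "g * h"]) simp_all
qed

lemma same_orbit_sym:
  assumes "same_orbit n a b" "b \<in> carrier_mat n n"
  shows "same_orbit n b (a :: 'a::field mat)"
proof -
  obtain g where g: "g \<in> carrier_mat n n" "invertible_mat g" "a = g * b * transpose_mat g"
    using assms by (auto simp: same_orbit_def)
  obtain k where k: "k \<in> carrier_mat n n" "g * k = 1\<^sub>m n" "k * g = 1\<^sub>m n"
    using invertible_mat_obtain_inverse[OF g(1,2)] .
  have "transpose_mat g * transpose_mat k = 1\<^sub>m n"
    using transpose_mult[of k n n g n] g k by simp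
  moreover have "k * a * transpose_mat k = (k * g) * b * (transpose_mat g * transpose_mat k)"
    using g(1) k(1) assms(2) by (simp add: g(3) assoc_mult_mat[of _ n n _ n _ n])
  ultimately have "b = k * a * transpose_mat k" using k(3) assms(2) by simp
  moreover have "invertible_mat k" using g k by (intro invertible_matI[of k n g])
  ultimately show ?thesis using k(1) by (intro same_orbit_intro)
qed

text \<open>Acting by \<open>g\<close> substitutes \<open>transpose_mat g\<close> into the form, so
  a substitution by an injective \<open>h\<close> is the action of
  \<open>transpose_mat h\<close>.\<close>

lemma same_orbitI:
  assumes two: "(2::'a::field) \<noteq> 0" and ab: "a \<in> Sym n" "b \<in> Sym n" and h: "h \<in> carrier_mat n n"
    and inj: "\<And>v. v \<in> carrier_vec n \<Longrightarrow> h *\<^sub>v v = 0\<^sub>v n \<Longrightarrow> v = 0\<^sub>v n"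
    and eq: "\<And>v. v \<in> carrier_vec n \<Longrightarrow> quad_form a v = quad_form b (h *\<^sub>v (v :: 'a vec))"
  shows "same_orbit n a b"
proof -
  have h': "transpose_mat h \<in> carrier_mat n n" using h by simp
  have "a = transpose_mat h * b * transpose_mat (transpose_mat h)"
  proof (rule Sym_eq_if_quad_form_eq[OF two ab(1) congruence_Sym[OF h' ab(2)]])
    fix v :: "'a vec" assume v: "v \<in> carrier_vec n"
    show "quad_form a v = quad_form (transpose_mat h * b * transpose_mat (transpose_mat h)) v"
      unfolding quad_form_congruence[OF h' Sym_carrier[OF ab(2)] v] using eq[OF v] by simp
  qed
  moreover have "invertible_mat (transpose_mat h)"
    by (rule invertible_mat_transpose[OF h invertible_mat_if_inj[OF h inj]])
  ultimately show ?thesis using h' by (intro same_orbit_intro)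
qed

lemma same_orbit_quad_form:
  assumes "same_orbit n a b" "b \<in> carrier_mat n n" "v \<in> carrier_vec n"
  obtains u where "u \<in> carrier_vec n" "quad_form a v = quad_form b (u :: 'a::field vec)"
proof -
  obtain g where g: "g \<in> carrier_mat n n" "a = g * b * transpose_mat g"
    using assms(1) by (auto simp: same_orbit_def)
  show thesis
    using quad_form_congruence[OF g(1) assms(2,3)] g assms(3)
    by (intro that[of "transpose_mat g *\<^sub>v v"]) auto
qed

text \<open>The column \<open>(t, u)\<close> is completed by a row \<open>- r\<close> and an
  identity block. The determinant is then \<open>t + r \<bullet> u\<close>, so the task is to choose
  \<open>r\<close> with this value non-zero.\<close>

lemma exists_invertible_first_col:
  assumes v: "v \<in> carrier_vec (Suc n)" "v \<noteq> 0\<^sub>v (Suc n)"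
  obtains h where "h \<in> carrier_mat (Suc n) (Suc n)" "invertible_mat h"
    "h *\<^sub>v vCons 1 (0\<^sub>v n) = (v :: 'a::field vec)"
proof -
  obtain t u where u: "u \<in> carrier_vec n" and vt: "v = vCons t u"
    using v(1) by (rule carrier_vec_Suc_cases)
  obtain r where r: "r \<in> carrier_vec n" "t + r \<bullet> u \<noteq> 0"
  proof (cases "t = 0")
    case False
    thus ?thesis using u by (intro that[of "0\<^sub>v n"]) auto
  next
    case True
    hence "u \<noteq> 0\<^sub>v n" using v vt by (auto simp: zero_vec_Suc)
    then obtain i where "i < n" "u $ i \<noteq> 0" using u by (metis eq_vecI carrier_vecD index_zero_vec)
    thus ?thesis using True u by (intro that[of "unit_vec n i"]) auto
  qed
  define h where "h = bordered t (- r) u (1\<^sub>m n)"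
  have h: "h \<in> carrier_mat (Suc n) (Suc n)" by (simp add: h_def)
  have mult: "h *\<^sub>v vCons x y = vCons (t * x - r \<bullet> y) (x \<cdot>\<^sub>v u + y)" if "y \<in> carrier_vec n" for x y
  proof -
    have "- r \<bullet> y = - (r \<bullet> y)" by (rule uminus_scalar_prod[OF r(1) that, symmetric])
    thus ?thesis
      unfolding h_def bordered_mult_vec[OF uminus_carrier_vec[THEN iffD2, OF r(1)] u one_carrier_mat that]
      using that by simp
  qed
  have "invertible_mat h"
  proof (rule invertible_mat_if_inj[OF h])
    fix w assume w: "w \<in> carrier_vec (Suc n)" "h *\<^sub>v w = 0\<^sub>v (Suc n)"
    then obtain x y where y: "y \<in> carrier_vec n" and wx: "w = vCons x y"
      by (elim carrier_vec_Suc_cases)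
    have 1: "t * x = r \<bullet> y" and 2: "x \<cdot>\<^sub>v u + y = 0\<^sub>v n"
      using w(2) unfolding wx mult[OF y] by (auto simp: zero_vec_Suc)
    have "r \<bullet> (x \<cdot>\<^sub>v u + y) = 0" using r unfolding 2 by simp
    hence "x * (t + r \<bullet> u) = 0"
      using r u y 1 by (simp add: scalar_prod_add_distrib[of _ n] algebra_simps)
    hence "x = 0" using r by simp
    moreover from this have "y = 0\<^sub>v n"
    proof -
      have "0 \<cdot>\<^sub>v u = 0\<^sub>v n" using u by (intro eq_vecI) auto
      thus ?thesis using 2 y \<open>x = 0\<close> by simp
    qed
    ultimately show "w = 0\<^sub>v (Suc n)" by (simp add: wx zero_vec_Suc)
  qed
  moreover have "h *\<^sub>v vCons 1 (0\<^sub>v n) = v"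
    using r u by (simp add: mult vt)
  ultimately show thesis using h by (intro that)
qed

lemma bordered_zero: "bordered 0 (0\<^sub>v n) (0\<^sub>v n) (0\<^sub>m n n) = 0\<^sub>m (Suc n) (Suc n)"
  by (intro eq_matI) (auto simp: bordered_def split: nat.splits)

section \<open>The trace pairing and bordered matrices\<close>

lemma mat_trace_transpose_mult:
  assumes "B \<in> carrier_mat n n" "A \<in> carrier_mat n n"
  shows "mat_trace (transpose_mat B * A) = (\<Sum>i<n. \<Sum>j<n. B $$ (j, i) * A $$ (j, i))"
  using assms by (simp add: mat_trace_def scalar_prod_def atLeast0LessThan)

lemma mat_trace_mult_commute:
  assumes "A \<in> carrier_mat n n" "B \<in> carrier_mat n n"
  shows "mat_trace (A * B) = mat_trace (B * (A :: 'a::comm_semiring_0 mat))"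
proof -
  have "mat_trace (A * B) = (\<Sum>i<n. \<Sum>j<n. A $$ (i, j) * B $$ (j, i))"
    using assms by (simp add: mat_trace_def scalar_prod_def atLeast0LessThan)
  also have "\<dots> = (\<Sum>j<n. \<Sum>i<n. B $$ (j, i) * A $$ (i, j))"
    by (subst sum.swap) (simp add: mult.commute)
  also have "\<dots> = mat_trace (B * A)"
    using assms by (simp add: mat_trace_def scalar_prod_def atLeast0LessThan)
  finally show ?thesis .
qed

text \<open>The adjoint of a congruence under the trace pairing is again a congruence, which is why
  Fourier transforms of invariant functions are invariant.\<close>

lemma mat_trace_congruence:
  assumes "g \<in> carrier_mat n n" "b \<in> carrier_mat n n" "a \<in> carrier_mat n n"
  shows "mat_trace (transpose_mat (g * b * transpose_mat g) * a)
    = mat_trace (transpose_mat b * (transpose_mat g * a * (g :: 'a::comm_ring_1 mat)))"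
proof -
  note assoc = assoc_mult_mat[of _ n n _ n _ n]
  have "transpose_mat (g * b * transpose_mat g) * a = g * (transpose_mat b * transpose_mat g * a)"
    using assms by (simp add: assoc transpose_mult[of _ n n _ n])
  also have "mat_trace \<dots> = mat_trace (transpose_mat b * transpose_mat g * a * g)"
    using assms by (intro mat_trace_mult_commute[of _ n]) auto
  also have "transpose_mat b * transpose_mat g * a * g = transpose_mat b * (transpose_mat g * a * g)"
    using assms by (simp add: assoc)
  finally show ?thesis .
qed

lemma mat_trace_bordered:
  assumes "z \<in> carrier_vec n" "w \<in> carrier_vec n" "B \<in> carrier_mat n n" "A \<in> carrier_mat n n"
  shows "mat_trace (transpose_mat (bordered p z z B) * bordered c w w A)
    = p * c + 2 * (z \<bullet> w) + mat_trace (transpose_mat B * (A :: 'a::comm_ring_1 mat))"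
proof -
  have zw: "z \<bullet> w = (\<Sum>i<n. z $ i * w $ i)"
    using assms by (simp add: scalar_prod_def atLeast0LessThan)
  have "mat_trace (transpose_mat (bordered p z z B) * bordered c w w A)
    = p * c + (\<Sum>i<n. z $ i * w $ i) + ((\<Sum>i<n. z $ i * w $ i) + (\<Sum>i<n. \<Sum>j<n. B $$ (j, i) * A $$ (j, i)))"
    using assms
    by (subst mat_trace_transpose_mult[of _ "Suc n"])
      (auto simp: sum.lessThan_Suc_shift sum.distrib bordered_def simp del: sum.lessThan_Suc)
  thus ?thesis using assms by (simp add: zw mat_trace_transpose_mult)
qed

lemma outer_square_Sym [simp]: "w \<in> carrier_vec n \<Longrightarrow> outer_square (w :: 'a::field vec) \<in> Sym n"
  by (auto simp: Sym_def outer_square_def mult.commute intro!: eq_matI)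

lemma quad_form_outer_square:
  assumes "w \<in> carrier_vec n" "u \<in> carrier_vec n"
  shows "quad_form (outer_square w) u = (w \<bullet> (u :: 'a::field vec))\<^sup>2"
proof -
  have "outer_square w *\<^sub>v u = (w \<bullet> u) \<cdot>\<^sub>v w"
    using assms by (intro eq_vecI)
      (auto simp: outer_square_def scalar_prod_def sum_distrib_left mult.assoc mult.commute mult.left_commute)
  thus ?thesis
    using assms by (simp add: quad_form_def comm_scalar_prod[of u n w] power2_eq_square)
qed

lemma Sym_add: "A \<in> Sym n \<Longrightarrow> B \<in> Sym n \<Longrightarrow> A + B \<in> Sym n"
  by (auto simp: Sym_def transpose_add[of _ n n])

lemma Sym_smult:
  assumes "A \<in> Sym n"
  shows "k \<cdot>\<^sub>m A \<in> Sym n"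
proof -
  have "transpose_mat (k \<cdot>\<^sub>m A) = k \<cdot>\<^sub>m transpose_mat A" by (intro eq_matI) auto
  thus ?thesis using assms by (simp add: Sym_def)
qed

lemma quad_form_add_smult:
  assumes "A \<in> carrier_mat n n" "B \<in> carrier_mat n n" "u \<in> carrier_vec n"
  shows "quad_form (A + k \<cdot>\<^sub>m B) u = quad_form A u + k * quad_form B (u :: 'a::field vec)"
proof -
  have "(A + k \<cdot>\<^sub>m B) *\<^sub>v u = A *\<^sub>v u + k \<cdot>\<^sub>v (B *\<^sub>v u)"
    using assms by (subst add_mult_distrib_mat_vec[of _ n n]) (auto intro!: eq_vecI)
  thus ?thesis
    using assms by (simp add: quad_form_def scalar_prod_add_distrib[of _ n])
qed

lemma orbit_rep_carrier [simp]: "orbit_rep n r c \<in> carrier_mat n n"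
  by (simp add: orbit_rep_def)

lemma orbit_rep_Sym [simp]: "orbit_rep n r c \<in> Sym n"
  by (auto simp: Sym_def orbit_rep_def mat_diag_def intro!: eq_matI)

lemma orbit_rep_0: "orbit_rep n 0 c = 0\<^sub>m n n"
  by (auto simp: orbit_rep_def mat_diag_def intro!: eq_matI)

lemma orbit_rep_Suc_1: "orbit_rep (Suc n) 1 c = bordered c (0\<^sub>v n) (0\<^sub>v n) (0\<^sub>m n n)"
  by (auto simp: orbit_rep_def mat_diag_def bordered_def intro!: eq_matI split: nat.splits)

lemma orbit_rep_Suc_Suc:
  "orbit_rep (Suc n) (Suc (Suc r)) c = bordered 1 (0\<^sub>v n) (0\<^sub>v n) (orbit_rep n (Suc r) c)"
  by (auto simp: orbit_rep_def mat_diag_def bordered_def intro!: eq_matI split: nat.splits)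

subsection \<open>Rank and kernel over a finite field\<close>

text \<open>Coordinates identify the space with the functions from a basis to the scalars.\<close>

lemma (in vectorspace) card_carrier_eq_power_dim:
  assumes "finite (carrier V)"
  shows "card (carrier V) = card (carrier K) ^ dim"
proof -
  have "gen_set (carrier V)"
    using span_is_subset2[of "carrier V"] in_own_span[of "carrier V"] by auto
  hence "fin_dim" unfolding fin_dim_def using assms by blast
  then obtain B where B: "finite B" "basis B" using finite_basis_exists by blast
  hence BV: "B \<subseteq> carrier V" by (simp add: basis_def)
  have "bij_betw (\<lambda>a. lincomb a B) (B \<rightarrow>\<^sub>E carrier K) (carrier V)"
  proof (rule bij_betwI')
    fix a b assume a: "a \<in> B \<rightarrow>\<^sub>E carrier K" and b: "b \<in> B \<rightarrow>\<^sub>E carrier K"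
    have "lincomb b B \<in> carrier V" using b BV by (intro lincomb_closed) auto
    thus "lincomb a B = lincomb b B \<longleftrightarrow> a = b"
      using basis_criterion[OF B(1) BV] B(2) a b by metis
  next
    fix a assume "a \<in> B \<rightarrow>\<^sub>E carrier K"
    thus "lincomb a B \<in> carrier V" using BV by (intro lincomb_closed) auto
  next
    fix v assume "v \<in> carrier V"
    thus "\<exists>a\<in>B \<rightarrow>\<^sub>E carrier K. v = lincomb a B"
      using basis_criterion[OF B(1) BV] B(2) by metis
  qed
  thus ?thesis
    using bij_betw_same_card card_PiE[OF B(1), of "\<lambda>_. carrier K"] dim_basis[OF B] by fastforce
qed

text \<open>All non-empty fibres of multiplication by \<open>A\<close> are translates of the kernel,
  and the image is the column space. The count ties the rank to kernel sizes, the form in which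
  Gauss sums detect it.\<close>

lemma card_kernel_mult_rank:
  fixes A :: "'a::{field,finite} mat"
  assumes A: "A \<in> carrier_mat n n"
  shows "card {v \<in> carrier_vec n. A *\<^sub>v v = 0\<^sub>v n} * CARD('a) ^ vec_space.rank n A = CARD('a) ^ n"
proof -
  interpret vec_space "TYPE('a)" n .
  define W where "W = span_vs (set (cols A))"
  have cols: "set (cols A) \<subseteq> carrier_vec n" using A cols_dim[of A] by auto
  interpret W: vectorspace class_ring W
    unfolding W_def by (rule subspace_is_vs[OF span_is_subspace[OF cols]])
  have img: "carrier W = (\<lambda>v. A *\<^sub>v v) ` carrier_vec n"
    using col_space_eq[OF A] A by (auto simp: W_def col_space_def)
  have "card (carrier W) = card (carrier (class_ring :: 'a ring)) ^ W.dim"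
    by (rule W.card_carrier_eq_power_dim) (simp add: img)
  moreover have "rank A = W.dim" by (simp add: rank_def W_def)
  ultimately have card_W: "card ((\<lambda>v. A *\<^sub>v v) ` carrier_vec n) = CARD('a) ^ rank A"
    unfolding img by (simp add: class_ring_simps)
  have fib: "card {v \<in> carrier_vec n. A *\<^sub>v v = y} = card {v \<in> carrier_vec n. A *\<^sub>v v = 0\<^sub>v n}"
    if y: "y \<in> (\<lambda>v. A *\<^sub>v v) ` carrier_vec n" for y
  proof -
    obtain u where u: "u \<in> carrier_vec n" "y = A *\<^sub>v u" using y by auto
    have "bij_betw (\<lambda>v. v + u) {v \<in> carrier_vec n. A *\<^sub>v v = 0\<^sub>v n} {v \<in> carrier_vec n. A *\<^sub>v v = y}"
      using A u by (intro bij_betwI[where g = "\<lambda>v. v - u"])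
        (auto simp: mult_add_distrib_mat_vec[of _ n n] mult_minus_distrib_mat_vec[of _ n n])
    from bij_betw_same_card[OF this] show ?thesis by (rule sym)
  qed
  have "CARD('a) ^ n = (\<Sum>v\<in>(carrier_vec n :: 'a vec set). 1)"
    by (simp add: card_carrier_vec)
  also have "\<dots> = (\<Sum>y\<in>(\<lambda>v. A *\<^sub>v v) ` carrier_vec n. \<Sum>v\<in>{v \<in> carrier_vec n. A *\<^sub>v v = y}. 1)"
    by (rule sum.image_gen) simp
  also have "\<dots> = card {v \<in> carrier_vec n. A *\<^sub>v v = 0\<^sub>v n} * CARD('a) ^ rank A"
    by (simp add: fib card_W mult.commute)
  finally show ?thesis by simp
qed

subsection \<open>Gauss sums over a finite field of odd order\<close>

text \<open>Pairs \<open>{x, h x}\<close> are removed one by one. Inversion on the non-zero squares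
  is the application: it decides whether -1 is a square.\<close>

lemma even_card_involution:
  assumes "finite A" and "\<And>x. x \<in> A \<Longrightarrow> h x \<in> A \<and> h (h x) = x \<and> h x \<noteq> x"
  shows "even (card A)"
  using assms
proof (induction A rule: finite_psubset_induct)
  case (psubset A)
  show ?case
  proof (cases "A = {}")
    case False
    then obtain x where x: "x \<in> A" by auto
    have "even (card (A - {x, h x}))"
    proof (rule psubset.IH)
      fix y assume y: "y \<in> A - {x, h x}"
      hence "h y \<noteq> x" using psubset.prems[of y] by auto
      moreover have "h y \<noteq> h x"
        using y psubset.prems[of y] psubset.prems[OF x] by (metis DiffD1 DiffD2 insertI1)
      ultimately
      show "h y \<in> A - {x, h x} \<and> h (h y) = y \<and> h y \<noteq> y"
        using y psubset.prems[of y] by auto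
    qed (use x in auto)
    moreover have "card {x, h x} = 2" "{x, h x} \<subseteq> A"
      using psubset.prems[OF x] x by auto
    hence "card A = card (A - {x, h x}) + 2"
      using psubset.hyps(1) card_mono[of A "{x, h x}"] by (simp add: card_Diff_subset)
    ultimately show ?thesis by simp
  qed simp
qed

locale finite_field_character =
  fixes \<theta> :: "'f::{field,finite} \<Rightarrow> complex" and \<delta> :: 'f and q \<epsilon> :: complex
  assumes odd_card: "odd CARD('f)"
    and additive: "additive_character \<theta>"
    and nontrivial: "\<exists>t. \<theta> t \<noteq> 1"
    and nonsquare: "\<nexists>t. \<delta> = t\<^sup>2"
    and q_def: "q = of_nat CARD('f)"
    and \<epsilon>_def: "\<epsilon> = (if CARD('f) mod 4 = 1 then 1 else - 1)"
begin

text \<open>The quadratic character of the field, extended by 0.\<close>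

definition \<eta> :: "'f \<Rightarrow> complex" where
  "\<eta> c = (if c = 0 then 0 else if \<exists>t. c = t\<^sup>2 then 1 else - 1)"

definition gauss_sum :: complex where
  "gauss_sum = (\<Sum>t\<in>UNIV. \<theta> (t\<^sup>2))"

text \<open>Translating the sum of all elements by 1 shows that \<open>CARD('f)\<close> is 0 in the
  field; were 2 zero, an odd number would be 1 there.\<close>

lemma two_neq_0: "(2::'f) \<noteq> 0"
proof
  assume two: "(2::'f) = 0"
  have "(\<Sum>x\<in>UNIV. x::'f) = (\<Sum>x\<in>UNIV. x + 1)"
    by (rule sum.reindex_bij_witness[of _ "\<lambda>x. x + 1" "\<lambda>x. x - 1"]) auto
  hence "(of_nat CARD('f) :: 'f) = 0"
    by (simp add: sum.distrib)
  moreover from odd_card obtain k where "CARD('f) = 2 * k + 1" by (elim oddE)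
  ultimately show False using two by simp
qed

lemma q_gt: "q \<noteq> 0" "CARD('f) \<ge> 2"
proof -
  have "card {0, 1::'f} \<le> CARD('f)" by (rule card_mono) auto
  thus "CARD('f) \<ge> 2" by simp
qed (simp add: q_def)

lemma q_power_neq_1: "k > 0 \<Longrightarrow> q ^ k \<noteq> 1"
  using q_gt(2) by (simp add: q_def flip: of_nat_power)

lemma \<theta>_add: "\<theta> (x + y) = \<theta> x * \<theta> y"
  and \<theta>_norm: "cmod (\<theta> x) = 1"
  using additive by (auto simp: additive_character_def)

lemma \<theta>_nz: "\<theta> x \<noteq> 0"
  using \<theta>_norm[of x] by auto

lemma \<theta>_0 [simp]: "\<theta> 0 = 1"
  using \<theta>_add[of 0 0] \<theta>_nz[of 0] by simp

lemma \<theta>_minus: "\<theta> (- x) = cnj (\<theta> x)"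
proof -
  have "\<theta> x * \<theta> (- x) = \<theta> x * cnj (\<theta> x)"
    using \<theta>_add[of x "- x"] \<theta>_norm[of x] by (simp flip: complex_norm_square)
  thus ?thesis using \<theta>_nz[of x] by simp
qed

lemma sum_\<theta>_mult: "(\<Sum>x\<in>UNIV. \<theta> (a * x)) = (if a = 0 then q else 0)"
proof (cases "a = 0")
  case False
  obtain t where t: "\<theta> t \<noteq> 1" using nontrivial by auto
  define s where "s = t / a"
  have s: "\<theta> (a * s) \<noteq> 1" using t False by (simp add: s_def)
  have "(\<Sum>x\<in>UNIV. \<theta> (a * x)) = (\<Sum>x\<in>UNIV. \<theta> (a * (x + s)))"
    by (rule sum.reindex_bij_witness[of _ "\<lambda>x. x + s" "\<lambda>x. x - s"]) auto
  also have "\<dots> = \<theta> (a * s) * (\<Sum>x\<in>UNIV. \<theta> (a * x))"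
    by (simp add: distrib_left \<theta>_add sum_distrib_left mult.commute)
  finally show ?thesis using s False by simp
qed (simp add: q_def)

text \<open>A counting argument: no value is attained more than twice by the two maps together, and
  \<open>2 * CARD('f)\<close> arguments are spread over \<open>CARD('f)\<close> values, so the bound
  is attained everywhere.\<close>

lemma square_fibre_card:
  assumes c: "\<nexists>t. c = (t::'f)\<^sup>2"
  shows "card {t. t\<^sup>2 = u} + card {t. c * t\<^sup>2 = (u::'f)} = 2"
proof -
  have c0: "c \<noteq> 0" using c by (metis zero_power2)
  have le: "card {t. a * t\<^sup>2 = v} \<le> 2" if "a \<noteq> 0" for a v :: 'f
  proof (cases "\<exists>t. a * t\<^sup>2 = v")
    case True
    then obtain t where t: "a * t\<^sup>2 = v" by auto
    have "{t. a * t\<^sup>2 = v} \<subseteq> {t, - t}"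
      using that t by (auto simp: power2_eq_iff)
    hence "card {t. a * t\<^sup>2 = v} \<le> card {t, - t}" by (intro card_mono) auto
    also have "\<dots> \<le> 2" by (simp add: card_insert_if)
    finally show ?thesis .
  qed auto
  have N: "card {t. t\<^sup>2 = v} + card {t. c * t\<^sup>2 = v} \<le> 2" for v
  proof (cases "v = 0")
    case False
    have "{t. t\<^sup>2 = v} = {} \<or> {t. c * t\<^sup>2 = v} = {}"
    proof (rule ccontr)
      assume "\<not> ?thesis"
      then obtain t s where "t\<^sup>2 = v" "c * s\<^sup>2 = v" by auto
      moreover from this have "s \<noteq> 0" using False by auto
      ultimately have "c = (t / s)\<^sup>2" by (simp add: power_divide field_simps)
      thus False using c by blast
    qed
    thus ?thesis using le[OF c0, of v] le[of 1 v] by auto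
  next
    case True
    thus ?thesis using c0 by simp
  qed
  have total: "(\<Sum>v\<in>UNIV. card {t. h t = v}) = CARD('f)" for h :: "'f \<Rightarrow> 'f"
    using sum.group[of UNIV UNIV h "\<lambda>_. 1::nat"] by simp
  have "(\<Sum>v\<in>UNIV. card {t. t\<^sup>2 = v} + card {t. c * t\<^sup>2 = v}) = (\<Sum>v\<in>(UNIV::'f set). 2)"
    by (simp only: sum.distrib total) simp
  thus ?thesis
    by (rule sum_mono_inv) (use N in auto)
qed

lemma square_cases:
  assumes c: "\<nexists>t. c = (t::'f)\<^sup>2"
  obtains t where "u = t\<^sup>2" | t where "u = c * t\<^sup>2"
proof -
  have "{t. t\<^sup>2 = u} \<noteq> {} \<or> {t. c * t\<^sup>2 = u} \<noteq> {}"
    using square_fibre_card[OF c, of u] by (metis card.empty add_0 zero_neq_numeral)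
  thus thesis using that by blast
qed

lemma sum_over_squares:
  fixes f :: "'f \<Rightarrow> complex"
  assumes c: "\<nexists>t. c = (t::'f)\<^sup>2"
  shows "(\<Sum>t\<in>UNIV. f (t\<^sup>2)) + (\<Sum>t\<in>UNIV. f (c * t\<^sup>2)) = 2 * (\<Sum>u\<in>UNIV. f u)"
proof -
  have fib: "(\<Sum>t\<in>UNIV. f (h t)) = (\<Sum>u\<in>UNIV. of_nat (card {t. h t = u}) * f u)" for h :: "'f \<Rightarrow> 'f"
  proof -
    have "(\<Sum>t\<in>UNIV. f (h t)) = (\<Sum>u\<in>UNIV. \<Sum>t\<in>{t\<in>UNIV. h t = u}. f (h t))"
      by (rule sum.group[symmetric]) auto
    also have "\<dots> = (\<Sum>u\<in>UNIV. of_nat (card {t. h t = u}) * f u)"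
    proof (rule sum.cong[OF refl])
      fix u
      have "(\<Sum>t\<in>{t\<in>UNIV. h t = u}. f (h t)) = (\<Sum>t\<in>{t. h t = u}. f u)"
        by (rule sum.cong) auto
      thus "(\<Sum>t\<in>{t\<in>UNIV. h t = u}. f (h t)) = of_nat (card {t. h t = u}) * f u"
        by simp
    qed
    finally show ?thesis .
  qed
  have "(\<Sum>t\<in>UNIV. f (t\<^sup>2)) + (\<Sum>t\<in>UNIV. f (c * t\<^sup>2))
      = (\<Sum>u\<in>UNIV. of_nat (card {t. t\<^sup>2 = u} + card {t. c * t\<^sup>2 = u}) * f u)"
    by (simp only: fib[of "\<lambda>t. t\<^sup>2"] fib[of "\<lambda>t. c * t\<^sup>2"] sum.distrib[symmetric]
        distrib_right of_nat_add)
  thus ?thesis by (simp only: square_fibre_card[OF c] sum_distrib_left of_nat_numeral)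
qed

lemma \<eta>_1 [simp]: "\<eta> 1 = 1" and \<eta>_\<delta> [simp]: "\<eta> \<delta> = - 1"
  and \<delta>_neq_0 [simp]: "\<delta> \<noteq> 0"
proof -
  show "\<delta> \<noteq> 0" using nonsquare by (metis zero_power2)
  thus "\<eta> \<delta> = - 1" using nonsquare by (simp add: \<eta>_def)
  have "\<exists>t. (1::'f) = t\<^sup>2" by (rule exI[of _ 1]) simp
  thus "\<eta> 1 = 1" by (simp add: \<eta>_def)
qed

lemma \<eta>_cases: "c \<noteq> 0 \<Longrightarrow> \<eta> c = 1 \<or> \<eta> c = - 1"
  by (auto simp: \<eta>_def)

lemma sum_\<theta>_square: "c \<noteq> 0 \<Longrightarrow> (\<Sum>t\<in>UNIV. \<theta> (c * t\<^sup>2)) = \<eta> c * gauss_sum"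
proof (cases "\<exists>d. c = d\<^sup>2")
  case True
  assume c: "c \<noteq> 0"
  from True obtain d where d: "c = d\<^sup>2" by auto
  have "(\<Sum>t\<in>UNIV. \<theta> (c * t\<^sup>2)) = (\<Sum>t\<in>UNIV. \<theta> (t\<^sup>2))"
    using c d by (intro sum.reindex_bij_witness[of _ "\<lambda>t. t / d" "\<lambda>t. d * t"])
      (auto simp: power_mult_distrib)
  thus ?thesis using True c by (simp add: \<eta>_def gauss_sum_def)
next
  case False
  assume "c \<noteq> 0"
  thus ?thesis using sum_over_squares[OF False, of \<theta>] sum_\<theta>_mult[of 1] False
    by (simp add: \<eta>_def gauss_sum_def add_eq_0_iff2)
qed

text \<open>For \<open>t \<noteq> 0\<close> the elements \<open>t\<^sup>2\<close> and
  \<open>\<delta> * t\<^sup>2\<close> have signs 1 and -1 and together cover every non-zero element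
  twice, so both signs are equally frequent.\<close>

lemma sum_\<eta>:
  "2 * (\<Sum>c\<in>UNIV-{0}. F (\<eta> c)) = (q - 1) * (F 1 + F (- 1) :: complex)"
proof -
  have s: "\<eta> (t\<^sup>2) = 1" "\<eta> (\<delta> * t\<^sup>2) = - 1" if t: "t \<noteq> 0" for t
  proof -
    have "\<not> (\<exists>s. \<delta> * t\<^sup>2 = s\<^sup>2)"
    proof
      assume "\<exists>s. \<delta> * t\<^sup>2 = s\<^sup>2"
      then obtain s where "\<delta> * t\<^sup>2 = s\<^sup>2" ..
      hence "\<delta> = (s / t)\<^sup>2" using t by (simp add: power_divide field_simps)
      thus False using nonsquare by blast
    qed
    thus "\<eta> (t\<^sup>2) = 1" "\<eta> (\<delta> * t\<^sup>2) = - 1" using t by (auto simp: \<eta>_def)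
  qed
  define f where "f u = (if u = 0 then 0 else F (\<eta> u))" for u
  have c: "of_nat (card (UNIV - {0::'f})) = q - 1"
    using q_gt(2) by (simp add: card_Diff_singleton of_nat_diff q_def)
  have "(\<Sum>t\<in>UNIV. f (t\<^sup>2)) = (\<Sum>t\<in>UNIV-{0::'f}. F 1)"
    by (rule sum.mono_neutral_cong_right) (auto simp: f_def s)
  hence 1: "(\<Sum>t\<in>UNIV. f (t\<^sup>2)) = (q - 1) * F 1"
    by (simp only: sum_constant c)
  have "(\<Sum>t\<in>UNIV. f (\<delta> * t\<^sup>2)) = (\<Sum>t\<in>UNIV-{0::'f}. F (- 1))"
    by (rule sum.mono_neutral_cong_right) (auto simp: f_def s)
  hence 2: "(\<Sum>t\<in>UNIV. f (\<delta> * t\<^sup>2)) = (q - 1) * F (- 1)"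
    by (simp only: sum_constant c)
  have 3: "(\<Sum>u\<in>UNIV. f u) = (\<Sum>u\<in>UNIV-{0}. F (\<eta> u))"
    by (rule sum.mono_neutral_cong_right) (auto simp: f_def)
  show ?thesis
    using sum_over_squares[OF nonsquare, of f] unfolding 1 2 3 by (simp add: distrib_left)
qed

lemma card_nonzero_squares: "2 * card {u::'f. u \<noteq> 0 \<and> (\<exists>t. u = t\<^sup>2)} = CARD('f) - 1"
proof -
  have "(\<Sum>c\<in>UNIV-{0}. if \<eta> c = 1 then 1 else (0::complex))
      = (\<Sum>c\<in>{u::'f. u \<noteq> 0 \<and> (\<exists>t. u = t\<^sup>2)}. 1)"
    by (rule sum.mono_neutral_cong_right) (auto simp: \<eta>_def split: if_splits)
  hence "of_nat (2 * card {u::'f. u \<noteq> 0 \<and> (\<exists>t. u = t\<^sup>2)}) = (of_nat (CARD('f) - 1) :: complex)"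
    using sum_\<eta>[of "\<lambda>z. if z = 1 then 1 else 0"] q_gt(2) by (simp add: of_nat_diff q_def)
  thus ?thesis by (simp only: of_nat_eq_iff)
qed

text \<open>Inversion pairs off the non-zero squares except for 1 and, if it is a square, -1. Hence
  the parity of their number, \<open>(CARD('f) - 1) / 2\<close>, decides the question.\<close>

lemma \<eta>_minus_1: "\<eta> (- 1) = \<epsilon>"
proof -
  define A where "A = {u::'f. u \<noteq> 0 \<and> (\<exists>t. u = t\<^sup>2)}"
  define B where "B = A - {1, - 1}"
  have m1: "(- 1::'f) \<noteq> 1" using two_neq_0 by (simp add: eq_neg_iff_add_eq_0 eq_commute[of "- 1"])
  have "even (card B)"
  proof (rule even_card_involution[where h = inverse])
    fix u assume u: "u \<in> B"
    then obtain t where t: "u = t\<^sup>2" "u \<noteq> 0" "u \<noteq> 1" "u \<noteq> - 1" by (auto simp: B_def A_def)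
    have "inverse u = (inverse t)\<^sup>2" by (simp add: t power_inverse)
    moreover have "inverse u \<noteq> u"
    proof
      assume "inverse u = u"
      hence "u\<^sup>2 = 1" using t(2) by (metis power2_eq_square left_inverse)
      thus False using t(3,4) by (simp only: power2_eq_1_iff) blast
    qed
    moreover have "inverse u \<noteq> 1" "inverse u \<noteq> - 1" "inverse u \<noteq> 0"
      using t(2-4) inverse_inverse_eq[of u] by (auto simp del: inverse_inverse_eq)
    ultimately have "inverse u \<in> B" "inverse u \<noteq> u"
      unfolding B_def A_def by blast+
    thus "inverse u \<in> B \<and> inverse (inverse u) = u \<and> inverse u \<noteq> u"
      by (intro conjI inverse_inverse_eq)
  qed (simp add: B_def)
  have "\<exists>t. (1::'f) = t\<^sup>2" by (rule exI[of _ 1]) simp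
  hence 1: "1 \<in> A" by (simp add: A_def)
  have card: "2 * card A = CARD('f) - 1"
    using card_nonzero_squares by (simp add: A_def)
  show ?thesis
  proof (cases "\<exists>t. (- 1::'f) = t\<^sup>2")
    case True
    hence "- 1 \<in> A" unfolding A_def by simp
    hence "A = insert 1 (insert (- 1) B)" using 1 by (auto simp: B_def)
    hence "card A = card (insert 1 (insert (- 1) B))" by simp
    also have "\<dots> = card B + 2" using m1 by (subst card_insert_disjoint) (auto simp: B_def)
    finally have "card A = card B + 2" .
    hence "even (card A)" using \<open>even (card B)\<close> by simp
    then obtain k where "card A = 2 * k" by (elim evenE)
    hence "CARD('f) = 1 + 4 * k" using card q_gt(2) by linarith
    hence "CARD('f) mod 4 = 1" by (simp only: mod_mult_self2) simp
    thus ?thesis using True by (simp add: \<eta>_def \<epsilon>_def)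
  next
    case False
    hence "- 1 \<notin> A" unfolding A_def by simp
    hence "A = insert 1 B" using 1 by (auto simp: B_def)
    hence "card A = card (insert 1 B)" by simp
    also have "\<dots> = card B + 1" by (subst card_insert_disjoint) (auto simp: B_def)
    finally have "card A = card B + 1" .
    hence "odd (card A)" using \<open>even (card B)\<close> by simp
    then obtain k where "card A = 2 * k + 1" by (elim oddE)
    hence "CARD('f) = 3 + 4 * k" using card q_gt(2) by linarith
    hence "CARD('f) mod 4 \<noteq> 1" by (simp only: mod_mult_self2) simp
    thus ?thesis using False by (simp add: \<eta>_def \<epsilon>_def)
  qed
qed

lemma \<epsilon>_sq [simp]: "\<epsilon> * \<epsilon> = 1" and \<epsilon>_nz [simp]: "\<epsilon> \<noteq> 0"
  by (simp_all add: \<epsilon>_def)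

lemma gauss_sum_cnj: "cnj gauss_sum = \<epsilon> * gauss_sum"
  using sum_\<theta>_square[of "- 1"] by (simp add: gauss_sum_def \<theta>_minus \<eta>_minus_1)

text \<open>In the double sum for the squared modulus, \<open>s = w + t\<close> makes the exponent
  linear in \<open>t\<close>, and only \<open>w = 0\<close> survives. Conjugation merely multiplies
  the Gauss sum by \<open>\<epsilon>\<close>, which turns the squared modulus into the
  square.\<close>

lemma gauss_sum_square: "gauss_sum * gauss_sum = \<epsilon> * q"
proof -
  have "gauss_sum * cnj gauss_sum = (\<Sum>t\<in>UNIV. \<Sum>s\<in>UNIV. \<theta> (s\<^sup>2 - t\<^sup>2))"
    by (subst sum.swap) (simp add: gauss_sum_def sum_product \<theta>_minus[symmetric] \<theta>_add[symmetric])
  also have "\<dots> = (\<Sum>t\<in>UNIV. \<Sum>w\<in>UNIV. \<theta> (w\<^sup>2) * \<theta> (2 * w * t))"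
  proof (rule sum.cong[OF refl])
    fix t
    show "(\<Sum>s\<in>UNIV. \<theta> (s\<^sup>2 - t\<^sup>2)) = (\<Sum>w\<in>UNIV. \<theta> (w\<^sup>2) * \<theta> (2 * w * t))"
      by (rule sum.reindex_bij_witness[of _ "\<lambda>w. w + t" "\<lambda>s. s - t"])
        (auto simp: \<theta>_add[symmetric] power2_eq_square algebra_simps)
  qed
  also have "\<dots> = (\<Sum>w\<in>UNIV. \<theta> (w\<^sup>2) * (\<Sum>t\<in>UNIV. \<theta> (2 * w * t)))"
    by (subst sum.swap) (simp add: sum_distrib_left)
  also have "\<dots> = (\<Sum>w\<in>UNIV. if w = (0::'f) then q else 0)"
    by (rule sum.cong) (auto simp: sum_\<theta>_mult two_neq_0)
  finally have "gauss_sum * cnj gauss_sum = q" by simp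
  hence "\<epsilon> * (gauss_sum * (\<epsilon> * gauss_sum)) = \<epsilon> * q" by (simp add: gauss_sum_cnj)
  thus ?thesis by (simp add: mult.left_commute mult.assoc[symmetric])
qed

lemma gauss_sum_nz: "gauss_sum \<noteq> 0"
  using gauss_sum_square q_gt(1) by auto

text \<open>Pigeonhole: \<open>c * x\<^sup>2\<close> and \<open>1 - d * y\<^sup>2\<close> each take
  \<open>(CARD('f) + 1) / 2\<close> values, more than half of the field.\<close>

lemma binary_form_represents_1:
  assumes c: "c \<noteq> 0" and d: "d \<noteq> 0"
  obtains x y :: 'f where "c * x\<^sup>2 + d * y\<^sup>2 = 1"
proof -
  define A where "A = {u::'f. \<exists>t. u = t\<^sup>2}"
  have "A = insert 0 {u::'f. u \<noteq> 0 \<and> (\<exists>t. u = t\<^sup>2)}"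
    by (auto simp: A_def)
  hence A: "2 * card A = CARD('f) + 1"
    using card_nonzero_squares q_gt(2) by simp
  have "card ((\<lambda>u. c * u) ` A) = card A" "card ((\<lambda>u. 1 - d * u) ` A) = card A"
    using c d by (auto intro!: card_image inj_onI)
  moreover have "card ((\<lambda>u. c * u) ` A \<union> (\<lambda>u. 1 - d * u) ` A) \<le> CARD('f)"
    by (rule card_mono) auto
  ultimately have "(\<lambda>u. c * u) ` A \<inter> (\<lambda>u. 1 - d * u) ` A \<noteq> {}"
    using A card_Un_Int[of "(\<lambda>u. c * u) ` A" "(\<lambda>u. 1 - d * u) ` A"] by auto
  then obtain x y where "c * x\<^sup>2 = 1 - d * y\<^sup>2" by (auto simp: A_def)
  thus thesis by (intro that[of x y]) simp
qed


subsection \<open>Gauss sums of quadratic forms\<close>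

definition quad_gauss_sum :: "nat \<Rightarrow> 'f mat \<Rightarrow> complex" where
  "quad_gauss_sum n a = (\<Sum>v\<in>carrier_vec n. \<theta> (quad_form a v))"

lemma card_power_q: "of_nat (CARD('f) ^ n) = q ^ n"
  by (simp add: q_def)

lemma sum_\<theta>_scalar_prod:
  assumes "w \<in> carrier_vec n"
  shows "(\<Sum>v\<in>carrier_vec n. \<theta> (w \<bullet> v)) = (if w = 0\<^sub>v n then q ^ n else 0)"
  using assms
proof (induction n arbitrary: w)
  case 0
  hence "w = vNil" by simp
  thus ?case by (simp add: scalar_prod_def)
next
  case (Suc n)
  then obtain a u where u: "u \<in> carrier_vec n" "w = vCons a u" by (elim carrier_vec_Suc_cases)
  have "(\<Sum>v\<in>carrier_vec (Suc n). \<theta> (w \<bullet> v))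
      = (\<Sum>t\<in>UNIV. \<theta> (a * t) * (\<Sum>v\<in>carrier_vec n. \<theta> (u \<bullet> v)))"
    by (simp add: sum_carrier_vec_Suc u \<theta>_add sum_distrib_left)
  also have "\<dots> = (if a = 0 then q else 0) * (if u = 0\<^sub>v n then q ^ n else 0)"
    by (simp only: sum_distrib_right[symmetric] sum_\<theta>_mult Suc.IH[OF u(1)])
  finally show ?case by (simp add: u zero_vec_Suc)
qed

lemma bij_invertible_carrier_vec:
  assumes h: "h \<in> carrier_mat n n" "invertible_mat h"
  shows "bij_betw (\<lambda>v. h *\<^sub>v v) (carrier_vec n) (carrier_vec n :: 'f vec set)"
proof -
  obtain k where k: "k \<in> carrier_mat n n" "h * k = 1\<^sub>m n" "k * h = 1\<^sub>m n"
    using invertible_mat_obtain_inverse[OF h] .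
  have "k *\<^sub>v (h *\<^sub>v v) = v" "h *\<^sub>v (k *\<^sub>v v) = v" if "v \<in> carrier_vec n" for v
    using that h k by (simp_all flip: assoc_mult_mat_vec[of _ n n _ n])
  thus ?thesis using h k by (intro bij_betwI[where g = "\<lambda>v. k *\<^sub>v v"]) auto
qed

lemma bij_congruence_Sym:
  assumes h: "h \<in> carrier_mat n n" "invertible_mat h"
  shows "bij_betw (\<lambda>a. h * a * transpose_mat h) (Sym n) (Sym n :: 'f mat set)"
proof -
  obtain k where k: "k \<in> carrier_mat n n" "h * k = 1\<^sub>m n" "k * h = 1\<^sub>m n"
    using invertible_mat_obtain_inverse[OF h] .
  have inv: "g * (g' * a * transpose_mat g') * transpose_mat g = a"
    if "g \<in> carrier_mat n n" "g' \<in> carrier_mat n n" "g * g' = 1\<^sub>m n" "a \<in> carrier_mat n n"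
    for g g' a :: "'f mat"
  proof -
    have "g * (g' * a * transpose_mat g') * transpose_mat g = (g * g') * a * transpose_mat (g * g')"
      using that(1,2,4) by (simp add: assoc_mult_mat[of _ n n _ n _ n] transpose_mult[of g n n g' n])
    thus ?thesis using that by simp
  qed
  show ?thesis
    by (rule bij_betwI[where g = "\<lambda>a. k * a * transpose_mat k"])
      (use h k in \<open>auto simp: congruence_Sym inv Sym_carrier simp del: assoc_mult_mat\<close>)
qed

lemma quad_gauss_sum_congruence:
  assumes h: "h \<in> carrier_mat n n" "invertible_mat h" and a: "a \<in> carrier_mat n n"
  shows "quad_gauss_sum n (h * a * transpose_mat h) = quad_gauss_sum n a"
proof -
  have "quad_gauss_sum n (h * a * transpose_mat h) = (\<Sum>v\<in>carrier_vec n. \<theta> (quad_form a (transpose_mat h *\<^sub>v v)))"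
    unfolding quad_gauss_sum_def by (intro sum.cong refl arg_cong[where f = \<theta>] quad_form_congruence[OF h(1) a])
  also have "\<dots> = quad_gauss_sum n a"
    unfolding quad_gauss_sum_def using h
    by (intro sum.reindex_bij_betw[OF bij_invertible_carrier_vec] invertible_mat_transpose) auto
  finally show ?thesis .
qed

lemma quad_gauss_sum_same_orbit: "same_orbit n a b \<Longrightarrow> b \<in> carrier_mat n n \<Longrightarrow> quad_gauss_sum n a = quad_gauss_sum n b"
  by (auto simp: same_orbit_def quad_gauss_sum_congruence simp del: assoc_mult_mat)

lemma quad_gauss_sum_bordered:
  assumes "w \<in> carrier_vec n" "A \<in> carrier_mat n n"
  shows "quad_gauss_sum (Suc n) (bordered c w w A)
    = (\<Sum>u\<in>carrier_vec n. (\<Sum>t\<in>UNIV. \<theta> (c * t\<^sup>2 + 2 * t * (w \<bullet> u))) * \<theta> (quad_form A u))"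
  unfolding quad_gauss_sum_def sum_carrier_vec_Suc
  by (subst sum.swap) (simp add: quad_form_bordered[OF assms] \<theta>_add sum_distrib_right)

text \<open>Completing the square in the first coordinate replaces the block by its Schur
  complement. Adding the correction beforehand makes the result independent of the border
  \<open>w\<close>.\<close>

lemma quad_gauss_sum_bordered_nz:
  assumes w: "w \<in> carrier_vec n" and A: "A \<in> carrier_mat n n" and c: "c \<noteq> 0"
  shows "quad_gauss_sum (Suc n) (bordered c w w (A + inverse c \<cdot>\<^sub>m outer_square w)) = \<eta> c * gauss_sum * quad_gauss_sum n A"
proof -
  have O: "outer_square w \<in> carrier_mat n n" using w by (simp add: Sym_carrier)
  have "(\<Sum>t\<in>UNIV. \<theta> (c * t\<^sup>2 + 2 * t * s)) * \<theta> (x + inverse c * s\<^sup>2) = \<eta> c * gauss_sum * \<theta> x" for s x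
  proof -
    have "c * t\<^sup>2 + 2 * t * s + (x + inverse c * s\<^sup>2) = c * (t + s / c)\<^sup>2 + x" for t
      using c by (simp add: field_simps power2_eq_square)
    hence "(\<Sum>t\<in>UNIV. \<theta> (c * t\<^sup>2 + 2 * t * s)) * \<theta> (x + inverse c * s\<^sup>2)
        = (\<Sum>t\<in>UNIV. \<theta> (c * (t + s / c)\<^sup>2)) * \<theta> x"
      unfolding sum_distrib_right
      by (simp only: \<theta>_add[symmetric])
    also have "(\<Sum>t\<in>UNIV. \<theta> (c * (t + s / c)\<^sup>2)) = (\<Sum>t\<in>UNIV. \<theta> (c * t\<^sup>2))"
      by (rule sum.reindex_bij_witness[of _ "\<lambda>t. t - s / c" "\<lambda>t. t + s / c"]) auto
    finally show ?thesis using sum_\<theta>_square[OF c] by simp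
  qed
  thus ?thesis
    using A O by (subst quad_gauss_sum_bordered[OF w])
      (simp_all add: quad_form_add_smult[OF A O] quad_form_outer_square[OF w] quad_gauss_sum_def sum_distrib_left)
qed

lemma quad_gauss_sum_bordered_diag:
  assumes A: "A \<in> carrier_mat n n" and c: "c \<noteq> 0"
  shows "quad_gauss_sum (Suc n) (bordered c (0\<^sub>v n) (0\<^sub>v n) A) = \<eta> c * gauss_sum * quad_gauss_sum n A"
  using sum_\<theta>_square[OF c] A
  by (subst quad_gauss_sum_bordered) (simp_all add: quad_gauss_sum_def sum_distrib_left)

text \<open>With corner 0 the first coordinate occurs only linearly, and summing over it confines
  \<open>u\<close> to the hyperplane orthogonal to \<open>w\<close>.\<close>

lemma quad_gauss_sum_bordered_0:
  assumes w: "w \<in> carrier_vec n" and A: "A \<in> carrier_mat n n"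
  shows "quad_gauss_sum (Suc n) (bordered 0 w w A)
    = q * (\<Sum>u\<in>carrier_vec n. if w \<bullet> u = 0 then \<theta> (quad_form A u) else 0)"
proof -
  have "(\<Sum>t\<in>UNIV. \<theta> (0 * t\<^sup>2 + 2 * t * s)) = (if s = 0 then q else 0)" for s
    using sum_\<theta>_mult[of "2 * s"] two_neq_0 by (simp add: ac_simps)
  thus ?thesis
    unfolding quad_gauss_sum_bordered[OF assms] sum_distrib_left by (intro sum.cong) auto
qed

lemma quad_gauss_sum_bordered_zero:
  assumes A: "A \<in> carrier_mat n n"
  shows "quad_gauss_sum (Suc n) (bordered 0 (0\<^sub>v n) (0\<^sub>v n) A) = q * quad_gauss_sum n A"
  using A by (subst quad_gauss_sum_bordered_0) (auto simp: quad_gauss_sum_def intro!: sum.cong)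

text \<open>As for the Gauss sum of the field, \<open>u = w + v\<close> makes the difference of two
  values linear in \<open>v\<close>; the sum over \<open>v\<close> then tests whether
  \<open>w\<close> lies in the kernel.\<close>

lemma quad_gauss_sum_norm_kernel:
  assumes a: "a \<in> Sym n"
  shows "quad_gauss_sum n a * cnj (quad_gauss_sum n a) = q ^ n * of_nat (card {v \<in> carrier_vec n. a *\<^sub>v v = 0\<^sub>v n})"
proof -
  have ac: "a \<in> carrier_mat n n" using a by (rule Sym_carrier)
  have "quad_gauss_sum n a * cnj (quad_gauss_sum n a)
      = (\<Sum>v\<in>carrier_vec n. \<Sum>u\<in>carrier_vec n. \<theta> (quad_form a u - quad_form a v))"
    by (subst sum.swap) (simp add: quad_gauss_sum_def sum_product \<theta>_minus[symmetric] \<theta>_add[symmetric])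
  also have "\<dots> = (\<Sum>v\<in>carrier_vec n. \<Sum>w\<in>carrier_vec n. \<theta> (quad_form a w) * \<theta> ((2 \<cdot>\<^sub>v (a *\<^sub>v w)) \<bullet> v))"
  proof (rule sum.cong[OF refl])
    fix v :: "'f vec" assume v: "v \<in> carrier_vec n"
    show "(\<Sum>u\<in>carrier_vec n. \<theta> (quad_form a u - quad_form a v))
      = (\<Sum>w\<in>carrier_vec n. \<theta> (quad_form a w) * \<theta> ((2 \<cdot>\<^sub>v (a *\<^sub>v w)) \<bullet> v))"
    proof (rule sum.reindex_bij_witness[of _ "\<lambda>w. w + v" "\<lambda>u. u - v"])
      fix u :: "'f vec" assume u: "u \<in> carrier_vec n"
      show "u - v + v = u" using u v by auto
      have "quad_form a u = quad_form a ((u - v) + v)" using u v by (simp add: \<open>u - v + v = u\<close>)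
      also have "\<dots> = quad_form a (u - v) + 2 * ((a *\<^sub>v (u - v)) \<bullet> v) + quad_form a v"
        using u v by (intro quad_form_add[OF a]) auto
      finally show "\<theta> (quad_form a (u - v)) * \<theta> ((2 \<cdot>\<^sub>v (a *\<^sub>v (u - v))) \<bullet> v) = \<theta> (quad_form a u - quad_form a v)"
        using u v ac by (simp add: \<theta>_add[symmetric] smult_scalar_prod_distrib[of _ n])
    qed (use v in auto)
  qed
  also have "\<dots> = (\<Sum>w\<in>carrier_vec n. \<theta> (quad_form a w) * (\<Sum>v\<in>carrier_vec n. \<theta> ((2 \<cdot>\<^sub>v (a *\<^sub>v w)) \<bullet> v)))"
    by (subst sum.swap) (simp add: sum_distrib_left)
  also have "\<dots> = (\<Sum>w\<in>carrier_vec n. if a *\<^sub>v w = 0\<^sub>v n then q ^ n else 0)"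
  proof (rule sum.cong[OF refl])
    fix w :: "'f vec" assume w: "w \<in> carrier_vec n"
    have "2 \<cdot>\<^sub>v (a *\<^sub>v w) = 0\<^sub>v n \<longleftrightarrow> a *\<^sub>v w = 0\<^sub>v n"
    proof
      assume *: "2 \<cdot>\<^sub>v (a *\<^sub>v w) = 0\<^sub>v n"
      show "a *\<^sub>v w = 0\<^sub>v n"
      proof (rule eq_vecI)
        fix i assume "i < dim_vec (0\<^sub>v n :: 'f vec)"
        thus "(a *\<^sub>v w) $ i = 0\<^sub>v n $ i"
          using arg_cong[OF *, of "\<lambda>v. v $ i"] ac two_neq_0 by simp
      qed (use ac in auto)
    qed (use ac in \<open>auto intro!: eq_vecI\<close>)
    moreover have "quad_form a w = 0" if "a *\<^sub>v w = 0\<^sub>v n" using that w by (simp add: quad_form_def)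
    moreover have "(\<Sum>v\<in>carrier_vec n. \<theta> ((2 \<cdot>\<^sub>v (a *\<^sub>v w)) \<bullet> v))
        = (if 2 \<cdot>\<^sub>v (a *\<^sub>v w) = 0\<^sub>v n then q ^ n else 0)"
      using ac w by (intro sum_\<theta>_scalar_prod) auto
    ultimately show "\<theta> (quad_form a w) * (\<Sum>v\<in>carrier_vec n. \<theta> ((2 \<cdot>\<^sub>v (a *\<^sub>v w)) \<bullet> v))
        = (if a *\<^sub>v w = 0\<^sub>v n then q ^ n else 0)"
      by (simp only: if_cancel mult_1_left \<theta>_0 mult_zero_right split: if_split) simp
  qed
  also have "\<dots> = (\<Sum>w\<in>{w \<in> carrier_vec n. a *\<^sub>v w = 0\<^sub>v n}. q ^ n)"
    by (rule sum.inter_filter[symmetric]) simp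
  finally show ?thesis by simp
qed

text \<open>Kernel size and rank are complementary, so the modulus of the Gauss sum reveals the
  rank. The product form avoids truncated subtraction.\<close>

lemma quad_gauss_sum_norm_rank:
  assumes a: "a \<in> Sym n"
  shows "quad_gauss_sum n a * cnj (quad_gauss_sum n a) * q ^ vec_space.rank n a = q ^ (2 * n)"
proof -
  have "of_nat (card {v \<in> carrier_vec n. a *\<^sub>v v = 0\<^sub>v n} * CARD('f) ^ vec_space.rank n a) = q ^ n"
    unfolding card_kernel_mult_rank[OF Sym_carrier[OF a]] by (rule card_power_q)
  thus ?thesis
    unfolding quad_gauss_sum_norm_kernel[OF a] by (simp add: q_def mult.assoc power_add mult_2)
qed

lemma quad_gauss_sum_zero: "quad_gauss_sum n (0\<^sub>m n n) = q ^ n"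
proof -
  have "quad_gauss_sum n (0\<^sub>m n n) = (\<Sum>v\<in>(carrier_vec n :: 'f vec set). 1)"
    unfolding quad_gauss_sum_def
  proof (rule sum.cong[OF refl])
    fix v :: "'f vec" assume v: "v \<in> carrier_vec n"
    have "0\<^sub>m n n *\<^sub>v v = 0\<^sub>v n" using v by (intro eq_vecI) auto
    thus "\<theta> (quad_form (0\<^sub>m n n) v) = 1" using v by (simp add: quad_form_def)
  qed
  thus ?thesis by (simp add: card_carrier_vec q_def)
qed

lemma quad_gauss_sum_orbit_rep:
  assumes "r \<le> n" "c \<noteq> 0"
  shows "quad_gauss_sum n (orbit_rep n r c) = (if r = 0 then 1 else \<eta> c) * gauss_sum ^ r * q ^ (n - r)"
  using assms
proof (induction n arbitrary: r)
  case (Suc n)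
  consider "r = 0" | "r = 1" | k where "r = Suc (Suc k)" by (metis One_nat_def not0_implies_Suc)
  thus ?case
  proof cases
    case 3
    thus ?thesis
      using Suc.IH[of "Suc k"] Suc.prems by (simp add: orbit_rep_Suc_Suc quad_gauss_sum_bordered_diag)
  next
    case 2
    thus ?thesis
      using Suc.prems by (simp add: orbit_rep_Suc_1[unfolded One_nat_def] quad_gauss_sum_bordered_diag quad_gauss_sum_zero)
  qed (simp add: orbit_rep_0 quad_gauss_sum_zero)
qed (simp add: orbit_rep_0 quad_gauss_sum_zero)


subsection \<open>Classification of the orbits\<close>

lemma q_power_inject: "q ^ m = q ^ n \<Longrightarrow> m = n"
  using q_gt(2) by (simp add: q_def flip: of_nat_power)

text \<open>A vector of value \<open>c\<close> is moved to the first basis vector, which puts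
  \<open>c\<close> in the corner; completing the square then clears the border.\<close>

lemma split_off_diagonal:
  assumes a: "a \<in> Sym (Suc n)" and v: "v \<in> carrier_vec (Suc n)" and c: "quad_form a v = c" "c \<noteq> (0::'f)"
  obtains A where "A \<in> Sym n" "same_orbit (Suc n) a (bordered c (0\<^sub>v n) (0\<^sub>v n) A)"
proof -
  have ac: "a \<in> carrier_mat (Suc n) (Suc n)" using a by (rule Sym_carrier)
  have "v \<noteq> 0\<^sub>v (Suc n)" using c ac by (auto simp: quad_form_def)
  then obtain h where h: "h \<in> carrier_mat (Suc n) (Suc n)" "invertible_mat h"
    "h *\<^sub>v vCons 1 (0\<^sub>v n) = v"
    using exists_invertible_first_col[OF v] by blast
  define g where "g = transpose_mat h"
  have g: "g \<in> carrier_mat (Suc n) (Suc n)" "invertible_mat g" "transpose_mat g = h"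
    using h invertible_mat_transpose[OF h(1,2)] by (simp_all add: g_def)
  define b where "b = g * a * transpose_mat g"
  have b: "b \<in> Sym (Suc n)" unfolding b_def by (rule congruence_Sym[OF g(1) a])
  have ba: "same_orbit (Suc n) b a" by (rule same_orbit_intro[OF g(1,2) b_def])
  obtain c' w B where w: "w \<in> carrier_vec n" and B: "B \<in> Sym n" and bw: "b = bordered c' w w B"
    using b by (rule Sym_Suc_cases)
  have Bc: "B \<in> carrier_mat n n" using B by (rule Sym_carrier)
  have "c' = quad_form b (vCons 1 (0\<^sub>v n))"
    using w Bc by (simp add: bw quad_form_bordered[of w n]) (simp add: quad_form_def)
  also have "\<dots> = c"
    unfolding b_def using quad_form_congruence[OF g(1) ac, of "vCons 1 (0\<^sub>v n)"] h(3) g(3) c by simp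
  finally have c': "c' = c" .
  define A where "A = B + (- inverse c) \<cdot>\<^sub>m outer_square w"
  have O: "outer_square w \<in> Sym n" using w by simp
  have A: "A \<in> Sym n" unfolding A_def by (intro Sym_add Sym_smult B O)
  have Ac: "A \<in> carrier_mat n n" using A by (rule Sym_carrier)
  \<comment> \<open>\<open>H\<close> shifts the first coordinate by
    \<open>(w \<bullet> u) / c\<close>, the substitution that completes the square; \<open>A\<close>
    is the Schur complement of the corner.\<close>
  define H where "H = bordered 1 (inverse c \<cdot>\<^sub>v w) (0\<^sub>v n) (1\<^sub>m n)"
  have Hm: "H *\<^sub>v vCons t u = vCons (t + (w \<bullet> u) / c) u" if "u \<in> carrier_vec n" for t u
    unfolding H_def using w that
    by (subst bordered_mult_vec[of _ n]) (simp_all add: smult_scalar_prod_distrib[of w n u] divide_inverse mult.commute,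
      intro eq_vecI, simp_all)
  have "same_orbit (Suc n) b (bordered c (0\<^sub>v n) (0\<^sub>v n) A)"
  proof (rule same_orbitI[OF two_neq_0 b])
    show "bordered c (0\<^sub>v n) (0\<^sub>v n) A \<in> Sym (Suc n)" using A by simp
    show "H \<in> carrier_mat (Suc n) (Suc n)" by (simp add: H_def)
    fix x :: "'f vec" assume "x \<in> carrier_vec (Suc n)"
    then obtain t u where u: "u \<in> carrier_vec n" and x: "x = vCons t u" by (rule carrier_vec_Suc_cases)
    {
      assume "H *\<^sub>v x = 0\<^sub>v (Suc n)"
      hence *: "t + (w \<bullet> u) / c = 0" "u = 0\<^sub>v n"
        unfolding x Hm[OF u] zero_vec_Suc vCons_eq_vCons by (elim conjunct1 conjunct2)+
      hence "t = 0" using w by simp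
      thus "x = 0\<^sub>v (Suc n)" using * by (simp add: x zero_vec_Suc)
    }
    have "quad_form A u = quad_form B u - inverse c * (w \<bullet> u)\<^sup>2"
      unfolding A_def quad_form_add_smult[OF Bc Sym_carrier[OF O] u] quad_form_outer_square[OF w u] by simp
    moreover have "c * t\<^sup>2 + 2 * t * s = c * (t + s / c)\<^sup>2 - inverse c * s\<^sup>2" for s
      using c(2) by (simp add: field_simps power2_eq_square)
    ultimately show "quad_form b x = quad_form (bordered c (0\<^sub>v n) (0\<^sub>v n) A) (H *\<^sub>v x)"
      unfolding x Hm[OF u] bw c' quad_form_bordered[OF w Bc u]
        quad_form_bordered[OF zero_carrier_vec Ac u] using u by simp
  qed
  hence "same_orbit (Suc n) a (bordered c (0\<^sub>v n) (0\<^sub>v n) A)"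
    using same_orbit_trans[OF same_orbit_sym[OF ba ac]] Ac by simp
  thus thesis using that A by blast
qed

lemma same_orbit_bordered:
  assumes AB: "same_orbit n A B" and A: "A \<in> Sym n" and B: "B \<in> Sym n"
  shows "same_orbit (Suc n) (bordered c (0\<^sub>v n) (0\<^sub>v n) A) (bordered c (0\<^sub>v n) (0\<^sub>v n) (B :: 'f mat))"
proof -
  obtain g where g: "g \<in> carrier_mat n n" "invertible_mat g" "A = g * B * transpose_mat g"
    using AB by (auto simp: same_orbit_def)
  have Ac: "A \<in> carrier_mat n n" and Bc: "B \<in> carrier_mat n n"
    using A B by (simp_all add: Sym_carrier)
  define h where "h = transpose_mat g"
  have h: "h \<in> carrier_mat n n" "invertible_mat h"
    using g invertible_mat_transpose[OF g(1,2)] by (simp_all add: h_def)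
  obtain k where k: "k \<in> carrier_mat n n" "k * h = 1\<^sub>m n"
    using invertible_mat_obtain_inverse[OF h] by blast
  define H where "H = bordered 1 (0\<^sub>v n) (0\<^sub>v n) h"
  have Hm: "H *\<^sub>v vCons t u = vCons t (h *\<^sub>v u)" if "u \<in> carrier_vec n" for t u
    unfolding H_def using h that
    by (subst bordered_mult_vec[of _ n]) (simp_all, intro eq_vecI, simp_all)
  show ?thesis
  proof (rule same_orbitI[OF two_neq_0])
    show "bordered c (0\<^sub>v n) (0\<^sub>v n) A \<in> Sym (Suc n)" "bordered c (0\<^sub>v n) (0\<^sub>v n) B \<in> Sym (Suc n)"
      using A B by simp_all
    show "H \<in> carrier_mat (Suc n) (Suc n)" using h by (simp add: H_def)
    fix x :: "'f vec" assume "x \<in> carrier_vec (Suc n)"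
    then obtain t u where u: "u \<in> carrier_vec n" and x: "x = vCons t u" by (rule carrier_vec_Suc_cases)
    have hu: "h *\<^sub>v u \<in> carrier_vec n" using h u by simp
    {
      assume "H *\<^sub>v x = 0\<^sub>v (Suc n)"
      hence *: "t = 0" "h *\<^sub>v u = 0\<^sub>v n" unfolding x Hm[OF u] zero_vec_Suc by simp_all
      have "u = (k * h) *\<^sub>v u" using k u by simp
      also have "\<dots> = k *\<^sub>v (h *\<^sub>v u)" by (rule assoc_mult_mat_vec[OF k(1) h(1) u])
      also have "\<dots> = 0\<^sub>v n" unfolding *(2) using k(1) by (intro eq_vecI) auto
      finally show "x = 0\<^sub>v (Suc n)" using * by (simp add: x zero_vec_Suc)
    }
    have "quad_form A u = quad_form B (h *\<^sub>v u)"
      unfolding g(3) h_def by (rule quad_form_congruence[OF g(1) Bc u])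
    thus "quad_form (bordered c (0\<^sub>v n) (0\<^sub>v n) A) x = quad_form (bordered c (0\<^sub>v n) (0\<^sub>v n) B) (H *\<^sub>v x)"
      unfolding x Hm[OF u] quad_form_bordered[OF zero_carrier_vec Ac u]
        quad_form_bordered[OF zero_carrier_vec Bc hu] using u hu by simp
  qed
qed

lemma quad_form_zero_mat:
  assumes "v \<in> carrier_vec n"
  shows "quad_form (0\<^sub>m n n) v = (0::'f)"
proof -
  have "0\<^sub>m n n *\<^sub>v v = 0\<^sub>v n" using assms by (intro eq_vecI) auto
  thus ?thesis using assms by (simp add: quad_form_def)
qed

lemma exists_quad_form_neq_0:
  assumes a: "a \<in> Sym n" "a \<noteq> 0\<^sub>m n n"
  obtains v where "v \<in> carrier_vec n" "quad_form a v \<noteq> (0::'f)"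
proof -
  show thesis
    using Sym_eq_if_quad_form_eq[OF two_neq_0 a(1) zero_Sym] a(2) that quad_form_zero_mat by metis
qed

lemma same_orbit_scale_first:
  assumes t: "t \<noteq> (0::'f)"
  shows "same_orbit (Suc n) (bordered (c * t\<^sup>2) (0\<^sub>v n) (0\<^sub>v n) (0\<^sub>m n n)) (bordered c (0\<^sub>v n) (0\<^sub>v n) (0\<^sub>m n n))"
proof -
  define H where "H = bordered t (0\<^sub>v n) (0\<^sub>v n) (1\<^sub>m n)"
  have Hm: "H *\<^sub>v vCons s u = vCons (t * s) u" if "u \<in> carrier_vec n" for s u
    unfolding H_def using that
    by (subst bordered_mult_vec[of _ n]) (simp_all, intro eq_vecI, simp_all)
  show ?thesis
  proof (rule same_orbitI[OF two_neq_0])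
    show "H \<in> carrier_mat (Suc n) (Suc n)" by (simp add: H_def)
    fix x :: "'f vec" assume "x \<in> carrier_vec (Suc n)"
    then obtain s u where u: "u \<in> carrier_vec n" and x: "x = vCons s u" by (rule carrier_vec_Suc_cases)
    {
      assume "H *\<^sub>v x = 0\<^sub>v (Suc n)"
      hence "s = 0" "u = 0\<^sub>v n" using t unfolding x Hm[OF u] zero_vec_Suc by simp_all
      thus "x = 0\<^sub>v (Suc n)" by (simp add: x zero_vec_Suc)
    }
    show "quad_form (bordered (c * t\<^sup>2) (0\<^sub>v n) (0\<^sub>v n) (0\<^sub>m n n)) x
      = quad_form (bordered c (0\<^sub>v n) (0\<^sub>v n) (0\<^sub>m n n)) (H *\<^sub>v x)"
      unfolding x Hm[OF u] quad_form_bordered[OF zero_carrier_vec zero_carrier_mat u]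
      using u by (simp add: power_mult_distrib)
  qed simp_all
qed

text \<open>Splitting off the value \<open>1\<close> whenever the form represents it makes the diagonal consist
  of ones except for the last entry.\<close>

lemma exists_orbit_rep:
  assumes "a \<in> Sym n"
  shows "\<exists>r\<le>n. \<exists>c\<in>{1, \<delta>}. same_orbit n a (orbit_rep n r c)"
  using assms
proof (induction n arbitrary: a)
  case 0
  hence "a = orbit_rep 0 0 1" by (simp add: Sym_0 orbit_rep_0)
  thus ?case using same_orbit_refl[OF orbit_rep_carrier] by blast
next
  case (Suc n)
  show ?case
  proof (cases "\<exists>v\<in>carrier_vec (Suc n). quad_form a v = 1")
    case True
    then obtain A where A: "A \<in> Sym n" "same_orbit (Suc n) a (bordered 1 (0\<^sub>v n) (0\<^sub>v n) A)"
      using split_off_diagonal[OF Suc.prems] by (metis one_neq_zero)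
    from Suc.IH[OF A(1)] obtain r c where r: "r \<le> n" "c \<in> {1, \<delta>}" "same_orbit n A (orbit_rep n r c)"
      by blast
    have *: "same_orbit (Suc n) a (bordered 1 (0\<^sub>v n) (0\<^sub>v n) (orbit_rep n r c))"
      by (rule same_orbit_trans[OF A(2) same_orbit_bordered[OF r(3) A(1)]]) simp_all
    show ?thesis
    \<comment> \<open>If the remainder is zero, its entry \<open>c\<close> is void and the 1 just
      split off is the last diagonal entry.\<close>
    proof (cases r)
      case 0
      hence "same_orbit (Suc n) a (orbit_rep (Suc n) 1 1)"
        using * unfolding orbit_rep_Suc_1 by (simp add: orbit_rep_0)
      thus ?thesis by (intro exI[of _ 1] conjI bexI[of _ 1]) simp_all
    next
      case (Suc k)
      hence "same_orbit (Suc n) a (orbit_rep (Suc n) (Suc r) c)"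
        using * by (simp add: orbit_rep_Suc_Suc)
      thus ?thesis using r(1,2) by blast
    qed
  next
    case no1: False
    show ?thesis
    proof (cases "a = 0\<^sub>m (Suc n) (Suc n)")
      case True
      hence "a = orbit_rep (Suc n) 0 1" by (simp add: orbit_rep_0)
      thus ?thesis using same_orbit_refl[OF orbit_rep_carrier] by blast
    next
      case False
      then obtain v where v: "v \<in> carrier_vec (Suc n)" "quad_form a v \<noteq> 0"
        using exists_quad_form_neq_0[OF Suc.prems] by blast
      define c where "c = quad_form a v"
      have c: "c \<noteq> 0" using v by (simp add: c_def)
      obtain A where A: "A \<in> Sym n" and orb: "same_orbit (Suc n) a (bordered c (0\<^sub>v n) (0\<^sub>v n) A)"
        using split_off_diagonal[OF Suc.prems v(1) c_def[symmetric] c] .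
      have Ac: "A \<in> carrier_mat n n" using A by (rule Sym_carrier)
      have not1: "quad_form (bordered c (0\<^sub>v n) (0\<^sub>v n) A) x \<noteq> 1" if x: "x \<in> carrier_vec (Suc n)" for x
        using same_orbit_quad_form[OF same_orbit_sym[OF orb] Sym_carrier[OF Suc.prems] x] no1 Ac
        by (metis bordered_carrier)
      \<comment> \<open>A non-zero value of \<open>A\<close> would form, together with
        \<open>c\<close>, a binary form, and such a form represents 1.\<close>
      have A0: "A = 0\<^sub>m n n"
      proof (rule ccontr)
        assume "A \<noteq> 0\<^sub>m n n"
        then obtain u where u: "u \<in> carrier_vec n" "quad_form A u \<noteq> 0"
          using exists_quad_form_neq_0[OF A] by blast
        obtain x y where xy: "c * x\<^sup>2 + quad_form A u * y\<^sup>2 = 1"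
          using binary_form_represents_1[OF c u(2)] .
        have yu: "y \<cdot>\<^sub>v u \<in> carrier_vec n" using u by simp
        have "quad_form (bordered c (0\<^sub>v n) (0\<^sub>v n) A) (vCons x (y \<cdot>\<^sub>v u)) = 1"
          unfolding quad_form_bordered[OF zero_carrier_vec Ac yu] quad_form_smult[OF Ac u(1)]
          using xy yu by (simp add: mult.commute)
        thus False using not1[of "vCons x (y \<cdot>\<^sub>v u)"] yu by simp
      qed
      \<comment> \<open>A square corner could be scaled to the value 1, which is excluded; so
        \<open>c\<close> is \<open>\<delta>\<close> times a square.\<close>
      have nsq: "c \<noteq> t\<^sup>2" for t
      proof
        assume ct: "c = t\<^sup>2"
        have "quad_form (0\<^sub>m n n) (0\<^sub>v n) = (0::'f)"
          by (rule quad_form_zero_mat) simp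
        hence "quad_form (bordered c (0\<^sub>v n) (0\<^sub>v n) A) (vCons (inverse t) (0\<^sub>v n)) = 1"
          unfolding A0 quad_form_bordered[OF zero_carrier_vec zero_carrier_mat zero_carrier_vec]
          using c ct by (simp add: power_inverse)
        thus False using not1[of "vCons (inverse t) (0\<^sub>v n)"] by simp
      qed
      obtain t where t: "c = \<delta> * t\<^sup>2"
        using nsq square_cases[OF nonsquare, of c] by metis
      hence "t \<noteq> 0" using c by auto
      from same_orbit_scale_first[OF this, of n \<delta>]
      have "same_orbit (Suc n) (bordered c (0\<^sub>v n) (0\<^sub>v n) A) (orbit_rep (Suc n) 1 \<delta>)"
        unfolding orbit_rep_Suc_1 A0 t .
      hence "same_orbit (Suc n) a (orbit_rep (Suc n) 1 \<delta>)"
        by (rule same_orbit_trans[OF orb]) simp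
      thus ?thesis by (intro exI[of _ 1] conjI bexI[of _ \<delta>]) simp_all
    qed
  qed
qed

lemma gauss_sum_norm: "gauss_sum * cnj gauss_sum = q"
  using gauss_sum_square by (simp add: gauss_sum_cnj mult.left_commute mult.assoc[symmetric])

lemma quad_gauss_sum_norm_orbit_rep:
  assumes "r \<le> n" "c \<in> {1, \<delta>}"
  shows "quad_gauss_sum n (orbit_rep n r c) * cnj (quad_gauss_sum n (orbit_rep n r c)) * q ^ r = q ^ (2 * n)"
proof -
  define s where "s = (if r = 0 then 1 else \<eta> c)"
  have s: "s * cnj s = 1" using assms(2) by (auto simp: s_def)
  have q: "cnj q = q" by (simp add: q_def)
  have "quad_gauss_sum n (orbit_rep n r c) = s * gauss_sum ^ r * q ^ (n - r)"
    unfolding s_def using assms by (intro quad_gauss_sum_orbit_rep) auto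
  hence "quad_gauss_sum n (orbit_rep n r c) * cnj (quad_gauss_sum n (orbit_rep n r c)) * q ^ r
      = (s * cnj s) * (gauss_sum * cnj gauss_sum) ^ r * (q ^ (n - r) * q ^ (n - r)) * q ^ r"
    by (simp add: q power_mult_distrib ac_simps)
  also have "\<dots> = (q ^ r * q ^ (n - r)) * (q ^ r * q ^ (n - r))"
    by (simp add: s gauss_sum_norm ac_simps)
  also have "\<dots> = q ^ (2 * n)"
    using assms(1) by (simp add: power_add[symmetric] mult_2)
  finally show ?thesis .
qed

lemma quad_gauss_sum_nz: "a \<in> Sym n \<Longrightarrow> quad_gauss_sum n a \<noteq> 0"
  using quad_gauss_sum_norm_rank[of a n] q_gt(1) by auto

text \<open>The modulus determines \<open>r\<close>, and then the remaining sign determines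
  \<open>c\<close>. The condition \<open>r > 0\<close> is there because
  \<open>orbit_rep n 0 c\<close> does not contain \<open>c\<close>.\<close>

lemma quad_gauss_sum_orbit_rep_inject:
  assumes "r \<le> n" "c \<in> {1, \<delta>}" "r' \<le> n" "c' \<in> {1, \<delta>}"
    and eq: "quad_gauss_sum n (orbit_rep n r c) = quad_gauss_sum n (orbit_rep n r' c')"
  shows "r = r'" "r > 0 \<Longrightarrow> c = c'"
proof -
  define z where "z = quad_gauss_sum n (orbit_rep n r c)"
  have z: "z \<noteq> 0" unfolding z_def by (rule quad_gauss_sum_nz) simp
  have "z * cnj z * q ^ r = z * cnj z * q ^ r'"
    using quad_gauss_sum_norm_orbit_rep[OF assms(1,2)] quad_gauss_sum_norm_orbit_rep[OF assms(3,4)] eq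
    by (simp add: z_def)
  hence "q ^ r = q ^ r'" using z by simp
  thus r: "r = r'" by (rule q_power_inject)
  assume r0: "r > 0"
  have nz: "gauss_sum ^ r * q ^ (n - r) \<noteq> 0" using gauss_sum_nz q_gt(1) by simp
  have "\<eta> c * (gauss_sum ^ r * q ^ (n - r)) = \<eta> c' * (gauss_sum ^ r * q ^ (n - r))"
    using eq r r0 assms quad_gauss_sum_orbit_rep[of r n c] quad_gauss_sum_orbit_rep[of r n c'] by auto
  hence "\<eta> c = \<eta> c'" using nz by (simp only: mult_right_cancel[OF nz])
  thus "c = c'" using assms(2,4) by auto
qed

text \<open>Every matrix has a representative, and representatives with equal Gauss sums coincide.
  This reduces comparisons of orbits to equations between complex numbers.\<close>

lemma same_orbit_if_gauss_eq:
  assumes a: "a \<in> Sym n" and b: "b \<in> Sym n" and eq: "quad_gauss_sum n a = quad_gauss_sum n b"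
  shows "same_orbit n a b"
proof -
  obtain r c where r: "r \<le> n" "c \<in> {1, \<delta>}" "same_orbit n a (orbit_rep n r c)"
    using exists_orbit_rep[OF a] by blast
  obtain r' c' where r': "r' \<le> n" "c' \<in> {1, \<delta>}" "same_orbit n b (orbit_rep n r' c')"
    using exists_orbit_rep[OF b] by blast
  have "quad_gauss_sum n (orbit_rep n r c) = quad_gauss_sum n (orbit_rep n r' c')"
    using eq quad_gauss_sum_same_orbit[OF r(3)] quad_gauss_sum_same_orbit[OF r'(3)] by simp
  from quad_gauss_sum_orbit_rep_inject[OF r(1,2) r'(1,2) this]
  have "orbit_rep n r c = orbit_rep n r' c'" by (cases r) (simp_all add: orbit_rep_0)
  thus ?thesis
    using same_orbit_trans[OF r(3)] same_orbit_sym[OF r'(3)] b by (simp add: Sym_carrier)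
qed

lemma rank_same_orbit:
  assumes a: "a \<in> Sym n" and r: "r \<le> n" "c \<in> {1, \<delta>}" "same_orbit n a (orbit_rep n r c)"
  shows "vec_space.rank n a = r"
proof -
  have eq: "quad_gauss_sum n a = quad_gauss_sum n (orbit_rep n r c)" by (rule quad_gauss_sum_same_orbit[OF r(3)]) simp
  have "quad_gauss_sum n a * cnj (quad_gauss_sum n a) * q ^ vec_space.rank n a = quad_gauss_sum n a * cnj (quad_gauss_sum n a) * q ^ r"
    using quad_gauss_sum_norm_rank[OF a] quad_gauss_sum_norm_orbit_rep[OF r(1,2)] unfolding eq by simp
  hence "q ^ vec_space.rank n a = q ^ r" using quad_gauss_sum_nz[OF a] by simp
  thus ?thesis by (rule q_power_inject)
qed

text \<open>The cases in \<open>sym_sgn\<close> are tried in order; the Gauss sums of the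
  representatives show that at most one of them can apply.\<close>

lemma sym_sgn_same_orbit:
  assumes a: "a \<in> Sym n" and r: "r \<le> n" "c \<in> {1, \<delta>}" "same_orbit n a (orbit_rep n r c)"
  shows "sym_sgn n \<delta> a = (if r = 0 then 1 else \<eta> c)"
proof (cases "r = 0")
  case True
  obtain g where g: "g \<in> carrier_mat n n" "a = g * orbit_rep n r c * transpose_mat g"
    using r(3) by (auto simp: same_orbit_def)
  hence "a = 0\<^sub>m n n" by (simp add: True orbit_rep_0)
  thus ?thesis using True by (simp add: sym_sgn_def)
next
  case False
  have eq: "quad_gauss_sum n a = quad_gauss_sum n (orbit_rep n r c)" by (rule quad_gauss_sum_same_orbit[OF r(3)]) simp
  have a0: "a \<noteq> 0\<^sub>m n n"
  proof
    assume "a = 0\<^sub>m n n"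
    hence "quad_gauss_sum n (orbit_rep n r c) = quad_gauss_sum n (orbit_rep n 0 1)" using eq by (simp add: orbit_rep_0)
    thus False using quad_gauss_sum_orbit_rep_inject(1)[OF r(1,2), of 0 1] False by simp
  qed
  have rn: "r \<in> {1..n}" using False r(1) by simp
  show ?thesis
  proof (cases "c = 1")
    case True
    thus ?thesis using a0 rn r(3) False by (auto simp: sym_sgn_def)
  next
    case c: False
    hence c\<delta>: "c = \<delta>" using r(2) by simp
    have "\<not> (\<exists>r'\<in>{1..n}. same_orbit n a (orbit_rep n r' 1))"
    proof
      assume "\<exists>r'\<in>{1..n}. same_orbit n a (orbit_rep n r' 1)"
      then obtain r' where r': "r' \<le> n" "same_orbit n a (orbit_rep n r' 1)" by auto
      have "quad_gauss_sum n (orbit_rep n r c) = quad_gauss_sum n (orbit_rep n r' 1)"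
        using eq quad_gauss_sum_same_orbit[OF r'(2)] by simp
      from quad_gauss_sum_orbit_rep_inject(2)[OF r(1,2) r'(1) _ this] False c show False by simp
    qed
    moreover have "\<exists>r'\<in>{1..n}. same_orbit n a (orbit_rep n r' \<delta>)"
      using r(3) rn c\<delta> by blast
    ultimately show ?thesis using a0 False c\<delta> by (simp add: sym_sgn_def)
  qed
qed

lemma quad_gauss_sum_eq_sym_sgn:
  assumes a: "a \<in> Sym n"
  shows "quad_gauss_sum n a = sym_sgn n \<delta> a * gauss_sum ^ vec_space.rank n a * q ^ (n - vec_space.rank n a)"
    and "vec_space.rank n a \<le> n"
proof -
  obtain r c where r: "r \<le> n" "c \<in> {1, \<delta>}" "same_orbit n a (orbit_rep n r c)"
    using exists_orbit_rep[OF a] by blast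
  have "quad_gauss_sum n a = quad_gauss_sum n (orbit_rep n r c)" by (rule quad_gauss_sum_same_orbit[OF r(3)]) simp
  also have "\<dots> = (if r = 0 then 1 else \<eta> c) * gauss_sum ^ r * q ^ (n - r)"
    using r by (intro quad_gauss_sum_orbit_rep) auto
  finally show "quad_gauss_sum n a = sym_sgn n \<delta> a * gauss_sum ^ vec_space.rank n a * q ^ (n - vec_space.rank n a)"
    by (simp only: rank_same_orbit[OF a r] sym_sgn_same_orbit[OF a r])
  show "vec_space.rank n a \<le> n" using r(1) by (simp only: rank_same_orbit[OF a r])
qed


subsection \<open>Fourier transforms of invariant functions\<close>

text \<open>The Fourier transform, at the character of \<open>b\<close>, of the invariant function
  that \<open>\<phi>\<close> induces through the Gauss sum. As \<open>\<phi>\<close> lives on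
  complex numbers, it can be carried between sizes.\<close>

definition gauss_fourier :: "nat \<Rightarrow> (complex \<Rightarrow> complex) \<Rightarrow> 'f mat \<Rightarrow> complex" where
  "gauss_fourier n \<phi> b = (\<Sum>a\<in>Sym n. cnj (\<theta> (mat_trace (transpose_mat b * a))) * \<phi> (quad_gauss_sum n a))"

text \<open>The terms with corner 0 in the transform at \<open>p \<oplus> b\<close>; their pairing
  involves neither \<open>p\<close> nor the border \<open>w\<close>.\<close>

definition border_sum :: "nat \<Rightarrow> (complex \<Rightarrow> complex) \<Rightarrow> 'f mat \<Rightarrow> complex" where
  "border_sum n \<phi> b = (\<Sum>w\<in>carrier_vec n. \<Sum>a\<in>Sym n.
     cnj (\<theta> (mat_trace (transpose_mat b * a))) * \<phi> (quad_gauss_sum (Suc n) (bordered 0 w w a)))"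

lemma cnj_sum_\<theta>: "(\<Sum>x\<in>UNIV. cnj (\<theta> (a * x))) = (if a = 0 then q else 0)"
proof -
  have "(\<Sum>x\<in>UNIV. cnj (\<theta> (a * x))) = cnj (\<Sum>x\<in>UNIV. \<theta> (a * x))" by simp
  thus ?thesis unfolding sum_\<theta>_mult by (simp add: q_def)
qed

text \<open>The congruence between \<open>b\<close> and \<open>b'\<close> is moved to the summation
  variable, where the Gauss sum does not notice it.\<close>

lemma gauss_fourier_cong_gauss:
  assumes b: "b \<in> Sym n" and b': "b' \<in> Sym n" and eq: "quad_gauss_sum n b = quad_gauss_sum n b'"
  shows "gauss_fourier n \<phi> b = gauss_fourier n \<phi> b'"
proof -
  obtain g where g: "g \<in> carrier_mat n n" "invertible_mat g" "b = g * b' * transpose_mat g"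
    using same_orbit_if_gauss_eq[OF b b' eq] by (auto simp: same_orbit_def)
  define h where "h = transpose_mat g"
  have h: "h \<in> carrier_mat n n" "invertible_mat h" "transpose_mat h = g"
    using g invertible_mat_transpose[OF g(1,2)] by (simp_all add: h_def)
  have "gauss_fourier n \<phi> b = (\<Sum>a\<in>Sym n. cnj (\<theta> (mat_trace (transpose_mat b' * (h * a * transpose_mat h))))
      * \<phi> (quad_gauss_sum n (h * a * transpose_mat h)))"
    unfolding gauss_fourier_def
  proof (rule sum.cong[OF refl])
    fix a :: "'f mat" assume "a \<in> Sym n"
    hence a: "a \<in> carrier_mat n n" by (rule Sym_carrier)
    have "mat_trace (transpose_mat b * a) = mat_trace (transpose_mat b' * (h * a * transpose_mat h))"
      unfolding h(3) unfolding h_def g(3) by (rule mat_trace_congruence[OF g(1) Sym_carrier[OF b'] a])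
    moreover have "quad_gauss_sum n (h * a * transpose_mat h) = quad_gauss_sum n a"
      by (rule quad_gauss_sum_congruence[OF h(1,2) a])
    ultimately show "cnj (\<theta> (mat_trace (transpose_mat b * a))) * \<phi> (quad_gauss_sum n a)
      = cnj (\<theta> (mat_trace (transpose_mat b' * (h * a * transpose_mat h)))) * \<phi> (quad_gauss_sum n (h * a * transpose_mat h))"
      by (simp only:)
  qed
  also have "\<dots> = gauss_fourier n \<phi> b'"
    unfolding gauss_fourier_def by (rule sum.reindex_bij_betw[OF bij_congruence_Sym[OF h(1,2)]])
  finally show ?thesis .
qed

lemma gauss_fourier_bordered:
  assumes z: "z \<in> carrier_vec n" and B: "B \<in> Sym n"
  shows "gauss_fourier (Suc n) \<phi> (bordered p z z B)
    = (\<Sum>c\<in>UNIV. cnj (\<theta> (p * c)) * (\<Sum>w\<in>carrier_vec n. \<Sum>A\<in>Sym n.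
        cnj (\<theta> (2 * (z \<bullet> w) + mat_trace (transpose_mat B * A))) * \<phi> (quad_gauss_sum (Suc n) (bordered c w w A))))"
  unfolding gauss_fourier_def sum_Sym_Suc sum_distrib_left
  by (intro sum.cong refl)
    (simp add: mat_trace_bordered[OF z _ Sym_carrier[OF B] Sym_carrier] \<theta>_add mult.assoc)

text \<open>Orthogonality in \<open>p\<close> annihilates every corner
  \<open>c \<noteq> 0\<close>.\<close>

lemma sum_gauss_fourier_bordered:
  assumes B: "B \<in> Sym n"
  shows "(\<Sum>p\<in>UNIV. gauss_fourier (Suc n) \<phi> (bordered p (0\<^sub>v n) (0\<^sub>v n) B)) = q * border_sum n \<phi> B"
proof -
  define R where "R c = (\<Sum>w\<in>carrier_vec n. \<Sum>A\<in>Sym n.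
    cnj (\<theta> (2 * (0\<^sub>v n \<bullet> w) + mat_trace (transpose_mat B * A))) * \<phi> (quad_gauss_sum (Suc n) (bordered c w w A)))" for c
  have "(\<Sum>p\<in>UNIV. gauss_fourier (Suc n) \<phi> (bordered p (0\<^sub>v n) (0\<^sub>v n) B))
      = (\<Sum>p\<in>UNIV. \<Sum>c\<in>UNIV. cnj (\<theta> (p * c)) * R c)"
    by (simp only: gauss_fourier_bordered[OF zero_carrier_vec B] R_def)
  also have "\<dots> = (\<Sum>c\<in>UNIV. (\<Sum>p\<in>UNIV. cnj (\<theta> (c * p))) * R c)"
    by (subst sum.swap) (simp add: sum_distrib_right mult.commute[of _ "_ :: 'f"])
  also have "\<dots> = (\<Sum>c\<in>UNIV. if c = (0::'f) then q * R 0 else 0)"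
    unfolding cnj_sum_\<theta> by (intro sum.cong) auto
  also have "\<dots> = q * R 0" by simp
  also have "R 0 = border_sum n \<phi> B"
    unfolding R_def border_sum_def by (intro sum.cong refl) simp
  finally show ?thesis .
qed

lemma mat_trace_zero: "A \<in> carrier_mat n n \<Longrightarrow> mat_trace (0\<^sub>m n n * A) = (0::'f)"
  by (simp add: mat_trace_def)

text \<open>Completing the square, the terms with a non-zero corner \<open>c\<close> depend on \<open>c\<close> only
  through the sign \<open>\<eta> c\<close>, so they cancel for odd \<open>\<phi>\<close>.\<close>

lemma gauss_fourier_zero_odd:
  assumes odd: "\<And>z. \<phi> (- z) = - \<phi> z"
  shows "gauss_fourier (Suc n) \<phi> (0\<^sub>m (Suc n) (Suc n)) = border_sum n \<phi> (0\<^sub>m n n)"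
proof -
  define R where "R c = (\<Sum>w\<in>carrier_vec n. \<Sum>A\<in>Sym n. \<phi> (quad_gauss_sum (Suc n) (bordered c w w A)))" for c
  define F where "F z = (\<Sum>w\<in>(carrier_vec n :: 'f vec set). \<Sum>A\<in>Sym n. \<phi> (z * gauss_sum * quad_gauss_sum n A))" for z
  have R: "R c = F (\<eta> c)" if c: "c \<noteq> 0" for c
    unfolding R_def F_def
  proof (rule sum.cong[OF refl])
    fix w :: "'f vec" assume w: "w \<in> carrier_vec n"
    have O: "k \<cdot>\<^sub>m outer_square w \<in> Sym n" for k using w by (intro Sym_smult) simp
    have "X - Y + Y = X" "X + Y - Y = X"
      if "X \<in> carrier_mat n n" "Y \<in> carrier_mat n n" for X Y :: "'f mat"
      using that by (auto intro!: eq_matI)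
    hence cancel: "A - inverse c \<cdot>\<^sub>m outer_square w + inverse c \<cdot>\<^sub>m outer_square w = A"
      "A + inverse c \<cdot>\<^sub>m outer_square w - inverse c \<cdot>\<^sub>m outer_square w = A"
      if "A \<in> Sym n" for A
      using Sym_carrier[OF that] Sym_carrier[OF O[of "inverse c"]] by simp_all
    have minus: "A - inverse c \<cdot>\<^sub>m outer_square w \<in> Sym n" if "A \<in> Sym n" for A
    proof -
      have "A - inverse c \<cdot>\<^sub>m outer_square w = A + (- inverse c) \<cdot>\<^sub>m outer_square w"
        using Sym_carrier[OF that] w by (intro eq_matI) (auto simp: outer_square_def)
      thus ?thesis using Sym_add[OF that O[of "- inverse c"]] by simp
    qed
    \<comment> \<open>For a fixed border, adding the Schur correction permutes
      \<open>Sym n\<close>.\<close>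
    show "(\<Sum>A\<in>Sym n. \<phi> (quad_gauss_sum (Suc n) (bordered c w w A))) = (\<Sum>A\<in>Sym n. \<phi> (\<eta> c * gauss_sum * quad_gauss_sum n A))"
    proof (rule sum.reindex_bij_witness[of _ "\<lambda>A. A + inverse c \<cdot>\<^sub>m outer_square w" "\<lambda>A. A - inverse c \<cdot>\<^sub>m outer_square w"])
      fix A :: "'f mat" assume A: "A \<in> Sym n"
      show "\<phi> (\<eta> c * gauss_sum * quad_gauss_sum n (A - inverse c \<cdot>\<^sub>m outer_square w)) = \<phi> (quad_gauss_sum (Suc n) (bordered c w w A))"
        using quad_gauss_sum_bordered_nz[OF w Sym_carrier[OF minus[OF A]] c] by (simp only: cancel(1)[OF A])
    qed (use cancel minus O in \<open>auto intro: Sym_add\<close>)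
  qed
  have "F (- 1) = - F 1" by (simp add: F_def odd sum_negf)
  hence "(\<Sum>c\<in>UNIV-{0}. F (\<eta> c)) = 0" using sum_\<eta>[of F] by simp
  hence nz: "(\<Sum>c\<in>UNIV-{0}. R c) = 0" by (simp add: R)
  have "gauss_fourier (Suc n) \<phi> (0\<^sub>m (Suc n) (Suc n)) = (\<Sum>c\<in>UNIV. R c)"
    unfolding bordered_zero[symmetric] gauss_fourier_bordered[OF zero_carrier_vec zero_Sym] R_def
    by (intro sum.cong refl) (simp, intro sum.cong refl, simp add: mat_trace_zero Sym_carrier)
  also have "\<dots> = R 0 + (\<Sum>c\<in>UNIV-{0}. R c)" by (rule sum.remove) auto
  also have "R 0 = border_sum n \<phi> (0\<^sub>m n n)"
    unfolding R_def border_sum_def by (intro sum.cong refl) (simp add: mat_trace_zero Sym_carrier)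
  finally show ?thesis using nz by simp
qed

lemma border_sum_0:
  assumes "B \<in> Sym 0"
  shows "border_sum 0 \<phi> B = gauss_fourier 0 (\<lambda>z. \<phi> (q * z)) B"
proof -
  have w: "vNil = (0\<^sub>v 0 :: 'f vec)" by (intro eq_vecI) simp_all
  have "quad_gauss_sum (Suc 0) (bordered 0 vNil vNil a) = q * quad_gauss_sum 0 a" if "a \<in> Sym 0" for a
    unfolding w using that by (intro quad_gauss_sum_bordered_zero Sym_carrier)
  thus ?thesis
    unfolding border_sum_def gauss_fourier_def carrier_vec_0 by simp
qed

text \<open>In suitable coordinates the border \<open>w\<close> is the first unit vector. The remaining form then
  contains a hyperbolic plane, and only its restriction to the hyperplane orthogonal to \<open>w\<close> matters.\<close>

lemma border_sum_nz:
  assumes B: "B \<in> Sym (Suc k)" and w: "w \<in> carrier_vec (Suc k)" "w \<noteq> 0\<^sub>v (Suc k)"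
    and V: "\<And>C. C \<in> Sym k \<Longrightarrow> q * quad_gauss_sum k C = quad_gauss_sum (Suc k) B \<Longrightarrow> B *\<^sub>v w = 0\<^sub>v (Suc k)
      \<Longrightarrow> gauss_fourier k (\<lambda>z. \<phi> (q * z)) C = V"
  shows "(\<Sum>a\<in>Sym (Suc k). cnj (\<theta> (mat_trace (transpose_mat B * a))) * \<phi> (quad_gauss_sum (Suc (Suc k)) (bordered 0 w w a)))
    = (if B *\<^sub>v w = 0\<^sub>v (Suc k) then q ^ Suc k * V else 0)"
proof -
  define m where "m = Suc k"
  have Bc: "B \<in> carrier_mat m m" using B unfolding m_def by (rule Sym_carrier)
  obtain h where h: "h \<in> carrier_mat m m" "invertible_mat h" "h *\<^sub>v vCons 1 (0\<^sub>v k) = w"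
    using exists_invertible_first_col[OF w] unfolding m_def by blast
  define g where "g = transpose_mat h"
  have g: "g \<in> carrier_mat m m" "invertible_mat g" "transpose_mat g = h"
    using h invertible_mat_transpose[OF h(1,2)] by (simp_all add: g_def)
  \<comment> \<open>\<open>B\<close> in the dual coordinates: pairing \<open>B\<close> with
    \<open>h * a * transpose_mat h\<close> is pairing \<open>D\<close> with
    \<open>a\<close>.\<close>
  define D where "D = g * B * transpose_mat g"
  have D: "D \<in> Sym m" unfolding D_def using congruence_Sym[OF g(1)] B by (simp add: m_def)
  obtain p0 z0 C where z0: "z0 \<in> carrier_vec k" and C: "C \<in> Sym k" and Dz: "D = bordered p0 z0 z0 C"
    using D unfolding m_def by (rule Sym_Suc_cases)
  have e0: "vCons 1 (0\<^sub>v k) \<in> carrier_vec m" by (simp add: m_def)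
  \<comment> \<open>The first column of \<open>D\<close> is the image of
    \<open>B *\<^sub>v w\<close> under the invertible \<open>g\<close>.\<close>
  have kernel: "B *\<^sub>v w = 0\<^sub>v m \<longleftrightarrow> p0 = 0 \<and> z0 = 0\<^sub>v k"
  proof -
    have wc: "w \<in> carrier_vec m" using w by (simp add: m_def)
    have "D *\<^sub>v vCons 1 (0\<^sub>v k) = g *\<^sub>v (B *\<^sub>v w)"
    proof -
      have "D *\<^sub>v vCons 1 (0\<^sub>v k) = (g * B) *\<^sub>v (transpose_mat g *\<^sub>v vCons 1 (0\<^sub>v k))"
        unfolding D_def using g(1) Bc e0 by (intro assoc_mult_mat_vec[of _ m m _ m]) auto
      also have "\<dots> = g *\<^sub>v (B *\<^sub>v w)"
        unfolding g(3) h(3) using g(1) Bc wc by (rule assoc_mult_mat_vec)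
      finally show ?thesis .
    qed
    moreover have "D *\<^sub>v vCons 1 (0\<^sub>v k) = vCons p0 z0"
      unfolding Dz bordered_mult_vec[OF z0 z0 Sym_carrier[OF C] zero_carrier_vec]
      using z0 Sym_carrier[OF C] by (simp, intro eq_vecI) simp_all
    ultimately have eq: "vCons p0 z0 = g *\<^sub>v (B *\<^sub>v w)" by simp
    obtain l where l: "l \<in> carrier_mat m m" "l * g = 1\<^sub>m m"
      using invertible_mat_obtain_inverse[OF g(1,2)] by blast
    have Bw: "B *\<^sub>v w \<in> carrier_vec m" using Bc wc by simp
    have "B *\<^sub>v w = 0\<^sub>v m \<longleftrightarrow> g *\<^sub>v (B *\<^sub>v w) = 0\<^sub>v m"
    proof
      assume *: "g *\<^sub>v (B *\<^sub>v w) = 0\<^sub>v m"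
      have "B *\<^sub>v w = (l * g) *\<^sub>v (B *\<^sub>v w)" using l Bw by simp
      also have "\<dots> = l *\<^sub>v (g *\<^sub>v (B *\<^sub>v w))" by (rule assoc_mult_mat_vec[OF l(1) g(1) Bw])
      also have "\<dots> = 0\<^sub>v m" unfolding * using l(1) by (intro eq_vecI) auto
      finally show "B *\<^sub>v w = 0\<^sub>v m" .
    next
      assume *: "B *\<^sub>v w = 0\<^sub>v m"
      show "g *\<^sub>v (B *\<^sub>v w) = 0\<^sub>v m" unfolding * using g(1) by (intro eq_vecI) auto
    qed
    thus ?thesis unfolding eq[symmetric] by (simp add: m_def zero_vec_Suc)
  qed
  \<comment> \<open>In the new coordinates, orthogonality to \<open>w\<close> means
    \<open>t = 0\<close>, so the corner \<open>p\<close> and the border \<open>z\<close> drop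
    out.\<close>
  have quad_gauss_sum_border: "quad_gauss_sum (Suc m) (bordered 0 w w (h * bordered p z z A * transpose_mat h)) = q * quad_gauss_sum k A"
    if z: "z \<in> carrier_vec k" and A: "A \<in> Sym k" for p z A
  proof -
    define a where "a = bordered p z z A"
    have Ac: "A \<in> carrier_mat k k" using A by (rule Sym_carrier)
    have a: "a \<in> carrier_mat m m" using Ac by (simp add: a_def m_def)
    have hah: "h * a * transpose_mat h \<in> carrier_mat m m" using h(1) a by simp
    have wc: "w \<in> carrier_vec m" using w by (simp add: m_def)
    define f where "f v = (if vCons 1 (0\<^sub>v k) \<bullet> v = 0 then \<theta> (quad_form a v) else 0)" for v
    have "quad_gauss_sum (Suc m) (bordered 0 w w (h * a * transpose_mat h))
      = q * (\<Sum>u\<in>carrier_vec m. if w \<bullet> u = 0 then \<theta> (quad_form (h * a * transpose_mat h) u) else 0)"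
      by (rule quad_gauss_sum_bordered_0[OF wc hah])
    also have "(\<Sum>u\<in>carrier_vec m. if w \<bullet> u = 0 then \<theta> (quad_form (h * a * transpose_mat h) u) else 0)
      = (\<Sum>u\<in>carrier_vec m. f (g *\<^sub>v u))"
    proof (rule sum.cong[OF refl])
      fix u :: "'f vec" assume u: "u \<in> carrier_vec m"
      have "w \<bullet> u = vCons 1 (0\<^sub>v k) \<bullet> (g *\<^sub>v u)"
        using transpose_vec_mult_scalar[OF g(1) u e0] unfolding g(3) h(3) .
      thus "(if w \<bullet> u = 0 then \<theta> (quad_form (h * a * transpose_mat h) u) else 0) = f (g *\<^sub>v u)"
        unfolding f_def quad_form_congruence[OF h(1) a u] g_def by simp
    qed
    also have "\<dots> = (\<Sum>v\<in>carrier_vec m. f v)"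
      by (rule sum.reindex_bij_betw[OF bij_invertible_carrier_vec[OF g(1,2)]])
    also have "\<dots> = (\<Sum>t\<in>UNIV. \<Sum>u\<in>carrier_vec k. f (vCons t u))"
      unfolding m_def by (rule sum_carrier_vec_Suc)
    also have "\<dots> = (\<Sum>t\<in>UNIV. if t = (0::'f) then quad_gauss_sum k A else 0)"
    proof (rule sum.cong[OF refl])
      fix t
      have "f (vCons t u) = (if t = 0 then \<theta> (quad_form A u) else 0)" if u: "u \<in> carrier_vec k" for u
        using u unfolding f_def a_def quad_form_bordered[OF z Ac u] by simp
      thus "(\<Sum>u\<in>carrier_vec k. f (vCons t u)) = (if t = 0 then quad_gauss_sum k A else 0)"
        by (simp add: quad_gauss_sum_def)
    qed
    finally show ?thesis by (simp add: a_def)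
  qed
  have "(\<Sum>a\<in>Sym m. cnj (\<theta> (mat_trace (transpose_mat B * a))) * \<phi> (quad_gauss_sum (Suc m) (bordered 0 w w a)))
    = (\<Sum>a\<in>Sym m. cnj (\<theta> (mat_trace (transpose_mat B * (h * a * transpose_mat h))))
        * \<phi> (quad_gauss_sum (Suc m) (bordered 0 w w (h * a * transpose_mat h))))"
    by (rule sum.reindex_bij_betw[OF bij_congruence_Sym[OF h(1,2)], symmetric])
  also have "\<dots> = (\<Sum>a\<in>Sym m. cnj (\<theta> (mat_trace (transpose_mat D * a)))
        * \<phi> (quad_gauss_sum (Suc m) (bordered 0 w w (h * a * transpose_mat h))))"
  proof (rule sum.cong[OF refl])
    fix a :: "'f mat" assume "a \<in> Sym m"
    hence a: "a \<in> carrier_mat m m" by (rule Sym_carrier)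
    have "mat_trace (transpose_mat D * a) = mat_trace (transpose_mat B * (transpose_mat g * a * g))"
      unfolding D_def by (rule mat_trace_congruence[OF g(1) Bc a])
    also have "transpose_mat g * a * g = h * a * transpose_mat h"
      unfolding g(3) unfolding g_def ..
    finally have "mat_trace (transpose_mat D * a) = mat_trace (transpose_mat B * (h * a * transpose_mat h))" .
    thus "cnj (\<theta> (mat_trace (transpose_mat B * (h * a * transpose_mat h))))
        * \<phi> (quad_gauss_sum (Suc m) (bordered 0 w w (h * a * transpose_mat h)))
      = cnj (\<theta> (mat_trace (transpose_mat D * a)))
        * \<phi> (quad_gauss_sum (Suc m) (bordered 0 w w (h * a * transpose_mat h)))" by simp
  qed
  \<comment> \<open>Since the Gauss sum ignores \<open>p\<close> and \<open>z\<close>, these sums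
    are free: they give \<open>q * q ^ k\<close> if the first column of \<open>D\<close> vanishes
    and 0 otherwise.\<close>
  also have "\<dots> = (\<Sum>p\<in>UNIV. \<Sum>z\<in>carrier_vec k. \<Sum>A\<in>Sym k.
      cnj (\<theta> (p0 * p)) * (cnj (\<theta> ((2 \<cdot>\<^sub>v z0) \<bullet> z))
        * (cnj (\<theta> (mat_trace (transpose_mat C * A))) * \<phi> (q * quad_gauss_sum k A))))"
    unfolding m_def sum_Sym_Suc
  proof (intro sum.cong refl)
    fix p and z :: "'f vec" and A :: "'f mat" assume z: "z \<in> carrier_vec k" and A: "A \<in> Sym k"
    show "cnj (\<theta> (mat_trace (transpose_mat D * bordered p z z A)))
        * \<phi> (quad_gauss_sum (Suc (Suc k)) (bordered 0 w w (h * bordered p z z A * transpose_mat h)))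
      = cnj (\<theta> (p0 * p)) * (cnj (\<theta> ((2 \<cdot>\<^sub>v z0) \<bullet> z))
        * (cnj (\<theta> (mat_trace (transpose_mat C * A))) * \<phi> (q * quad_gauss_sum k A)))"
      unfolding Dz mat_trace_bordered[OF z0 z Sym_carrier[OF C] Sym_carrier[OF A]]
        quad_gauss_sum_border[OF z A, unfolded m_def] smult_scalar_prod_distrib[OF z0 z]
      by (simp add: \<theta>_add mult.assoc)
  qed
  also have "\<dots> = (\<Sum>p\<in>UNIV. cnj (\<theta> (p0 * p))) * ((\<Sum>z\<in>carrier_vec k. cnj (\<theta> ((2 \<cdot>\<^sub>v z0) \<bullet> z)))
      * gauss_fourier k (\<lambda>z. \<phi> (q * z)) C)"
    unfolding gauss_fourier_def by (simp only: sum_distrib_left[symmetric] sum_distrib_right[symmetric])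
  also have "(\<Sum>z\<in>carrier_vec k. cnj (\<theta> ((2 \<cdot>\<^sub>v z0) \<bullet> z))) = (if z0 = 0\<^sub>v k then q ^ k else 0)"
  proof -
    have "2 \<cdot>\<^sub>v z0 = 0\<^sub>v k \<longleftrightarrow> z0 = 0\<^sub>v k"
    proof
      assume *: "2 \<cdot>\<^sub>v z0 = 0\<^sub>v k"
      show "z0 = 0\<^sub>v k"
      proof (rule eq_vecI)
        fix i assume "i < dim_vec (0\<^sub>v k :: 'f vec)"
        thus "z0 $ i = 0\<^sub>v k $ i"
          using arg_cong[OF *, of "\<lambda>v. v $ i"] z0 two_neq_0 by simp
      qed (use z0 in simp)
    next
      assume "z0 = 0\<^sub>v k"
      thus "2 \<cdot>\<^sub>v z0 = 0\<^sub>v k" by (intro eq_vecI) simp_all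
    qed
    moreover have "(\<Sum>z\<in>carrier_vec k. cnj (\<theta> ((2 \<cdot>\<^sub>v z0) \<bullet> z)))
        = cnj (\<Sum>z\<in>carrier_vec k. \<theta> ((2 \<cdot>\<^sub>v z0) \<bullet> z))" by simp
    moreover have "2 \<cdot>\<^sub>v z0 \<in> carrier_vec k" using z0 by simp
    ultimately show ?thesis by (simp only: sum_\<theta>_scalar_prod) (simp add: q_def)
  qed
  also have "(\<Sum>p\<in>UNIV. cnj (\<theta> (p0 * p))) * ((if z0 = 0\<^sub>v k then q ^ k else 0) * gauss_fourier k (\<lambda>z. \<phi> (q * z)) C)
    = (if B *\<^sub>v w = 0\<^sub>v m then q ^ Suc k * V else 0)"
  proof (cases "B *\<^sub>v w = 0\<^sub>v m")
    case True
    hence 0: "p0 = 0" "z0 = 0\<^sub>v k" using kernel by simp_all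
    have "quad_gauss_sum m B = quad_gauss_sum m D"
      unfolding D_def by (rule quad_gauss_sum_congruence[OF g(1,2) Bc, symmetric])
    also have "\<dots> = q * quad_gauss_sum k C"
      unfolding Dz 0 m_def by (rule quad_gauss_sum_bordered_zero[OF Sym_carrier[OF C]])
    finally have "gauss_fourier k (\<lambda>z. \<phi> (q * z)) C = V"
      using V[OF C] True by (simp add: m_def)
    thus ?thesis using 0 True unfolding cnj_sum_\<theta> by simp
  next
    case False
    hence "p0 \<noteq> 0 \<or> z0 \<noteq> 0\<^sub>v k" using kernel by simp
    thus ?thesis using False unfolding cnj_sum_\<theta> by auto
  qed
  finally show ?thesis unfolding m_def .
qed

text \<open>The border \<open>w = 0\<close> leaves \<open>0 \<oplus> a\<close>, and every non-zero
  \<open>w\<close> in the kernel of \<open>B\<close> contributes the same amount. Hypothesis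
  \<open>V\<close> may presuppose such a \<open>w\<close>, so nothing has to be shown for invertible
  \<open>B\<close>.\<close>

lemma border_sum_Suc:
  assumes B: "B \<in> Sym (Suc k)"
    and V: "\<And>C w. C \<in> Sym k \<Longrightarrow> q * quad_gauss_sum k C = quad_gauss_sum (Suc k) B \<Longrightarrow> w \<in> carrier_vec (Suc k)
      \<Longrightarrow> w \<noteq> 0\<^sub>v (Suc k) \<Longrightarrow> B *\<^sub>v w = 0\<^sub>v (Suc k) \<Longrightarrow> gauss_fourier k (\<lambda>z. \<phi> (q * z)) C = V"
  shows "border_sum (Suc k) \<phi> B = gauss_fourier (Suc k) (\<lambda>z. \<phi> (q * z)) B
    + q ^ Suc k * (of_nat (card {v \<in> carrier_vec (Suc k). B *\<^sub>v v = 0\<^sub>v (Suc k)}) - 1) * V"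
proof -
  define m where "m = Suc k"
  define K where "K = {v \<in> carrier_vec m. B *\<^sub>v v = 0\<^sub>v m}"
  have Bc: "B \<in> carrier_mat m m" using B unfolding m_def by (rule Sym_carrier)
  define G where "G w = (\<Sum>a\<in>Sym m. cnj (\<theta> (mat_trace (transpose_mat B * a))) * \<phi> (quad_gauss_sum (Suc m) (bordered 0 w w a)))" for w
  have fK: "finite K" unfolding K_def by simp
  have K0: "0\<^sub>v m \<in> K" unfolding K_def using Bc by (auto intro!: eq_vecI)
  have "border_sum m \<phi> B = (\<Sum>w\<in>carrier_vec m. G w)" by (simp add: border_sum_def G_def)
  also have "\<dots> = G (0\<^sub>v m) + (\<Sum>w\<in>carrier_vec m - {0\<^sub>v m}. G w)"
    by (rule sum.remove) auto
  also have "G (0\<^sub>v m) = gauss_fourier m (\<lambda>z. \<phi> (q * z)) B"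
    unfolding G_def gauss_fourier_def by (intro sum.cong refl) (simp add: quad_gauss_sum_bordered_zero Sym_carrier)
  also have "(\<Sum>w\<in>carrier_vec m - {0\<^sub>v m}. G w) = (\<Sum>w\<in>carrier_vec m - {0\<^sub>v m}. if B *\<^sub>v w = 0\<^sub>v m then q ^ m * V else 0)"
  proof (rule sum.cong[OF refl])
    fix w :: "'f vec" assume "w \<in> carrier_vec m - {0\<^sub>v m}"
    hence w: "w \<in> carrier_vec (Suc k)" "w \<noteq> 0\<^sub>v (Suc k)" by (simp_all add: m_def)
    show "G w = (if B *\<^sub>v w = 0\<^sub>v m then q ^ m * V else 0)"
      unfolding G_def m_def by (rule border_sum_nz[OF B w]) (rule V[OF _ _ w])
  qed
  also have "\<dots> = (\<Sum>w\<in>{w \<in> carrier_vec m - {0\<^sub>v m}. B *\<^sub>v w = 0\<^sub>v m}. q ^ m * V)"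
    by (rule sum.inter_filter[symmetric]) simp
  also have "{w \<in> carrier_vec m - {0\<^sub>v m}. B *\<^sub>v w = 0\<^sub>v m} = K - {0\<^sub>v m}"
    by (auto simp: K_def)
  also have "(\<Sum>w\<in>K - {0\<^sub>v m}. q ^ m * V) = q ^ m * (of_nat (card K) - 1) * V"
  proof -
    have "card K \<ge> 1" using K0 fK by (metis One_nat_def Suc_leI card_gt_0_iff empty_iff)
    thus ?thesis using K0 fK by (simp add: card_Diff_singleton of_nat_diff algebra_simps)
  qed
  finally show ?thesis by (simp only: m_def K_def)
qed


section \<open>Recurrences for averages over the orbits of a given rank\<close>

lemma card_kernel_orbit_rep:
  assumes "r \<le> n" "c \<in> {1, \<delta>}"
  shows "card {v \<in> carrier_vec n. orbit_rep n r c *\<^sub>v v = 0\<^sub>v n} = CARD('f) ^ (n - r)"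
proof -
  define K where "K = card {v \<in> carrier_vec n. orbit_rep n r c *\<^sub>v v = 0\<^sub>v n}"
  have "q ^ n * of_nat K * q ^ r = q ^ (2 * n)"
    using quad_gauss_sum_norm_orbit_rep[OF assms] quad_gauss_sum_norm_kernel[OF orbit_rep_Sym] by (simp add: K_def)
  also have "\<dots> = q ^ n * q ^ (n - r) * q ^ r"
    using assms(1) by (simp add: power_add[symmetric] mult_2)
  finally have "of_nat K = q ^ (n - r)" using q_gt(1) by simp
  hence "(of_nat K :: complex) = of_nat (CARD('f) ^ (n - r))" by (simp add: q_def)
  thus ?thesis unfolding K_def by (simp only: of_nat_eq_iff)
qed

text \<open>The representative of size \<open>n - 1\<close> is the intended one only for
  \<open>s < n\<close>. If \<open>s = n\<close>, in particular if \<open>n = 0\<close>, the factor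
  \<open>q ^ (n - s) - 1\<close> is 0.\<close>

lemma border_sum_orbit_rep:
  assumes s: "s \<le> n" and c: "c \<in> {1, \<delta>}"
  shows "border_sum n \<phi> (orbit_rep n s c) = gauss_fourier n (\<lambda>z. \<phi> (q * z)) (orbit_rep n s c)
    + q ^ n * (q ^ (n - s) - 1) * gauss_fourier (n - 1) (\<lambda>z. \<phi> (q * z)) (orbit_rep (n - 1) s c)"
proof (cases n)
  case 0
  thus ?thesis using border_sum_0[OF orbit_rep_Sym] by simp
next
  case (Suc k)
  have card: "of_nat (card {v \<in> carrier_vec (Suc k). orbit_rep (Suc k) s c *\<^sub>v v = 0\<^sub>v (Suc k)}) = q ^ (n - s)"
    using card_kernel_orbit_rep[OF s c] by (simp add: Suc q_def)
  have "border_sum (Suc k) \<phi> (orbit_rep (Suc k) s c) = gauss_fourier (Suc k) (\<lambda>z. \<phi> (q * z)) (orbit_rep (Suc k) s c)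
    + q ^ Suc k * (of_nat (card {v \<in> carrier_vec (Suc k). orbit_rep (Suc k) s c *\<^sub>v v = 0\<^sub>v (Suc k)}) - 1)
      * gauss_fourier k (\<lambda>z. \<phi> (q * z)) (orbit_rep k s c)"
  proof (rule border_sum_Suc[OF orbit_rep_Sym])
    fix C :: "'f mat" and w
    assume C: "C \<in> Sym k" and eq: "q * quad_gauss_sum k C = quad_gauss_sum (Suc k) (orbit_rep (Suc k) s c)"
      and w: "w \<in> carrier_vec (Suc k)" "w \<noteq> 0\<^sub>v (Suc k)" "orbit_rep (Suc k) s c *\<^sub>v w = 0\<^sub>v (Suc k)"
    define K where "K = {v \<in> carrier_vec (Suc k). orbit_rep (Suc k) s c *\<^sub>v v = 0\<^sub>v (Suc k)}"
    \<comment> \<open>The non-zero kernel vector \<open>w\<close> excludes full rank.\<close>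
    have "s \<le> k"
    proof (rule ccontr)
      assume "\<not> s \<le> k"
      hence "s = Suc k" using s Suc by simp
      hence "card K = 1" using card_kernel_orbit_rep[OF s c] by (simp add: Suc K_def)
      then obtain v where "K = {v}" by (auto simp: card_1_singleton_iff)
      moreover have "0\<^sub>v (Suc k) \<in> K" unfolding K_def
        using mat_mult_zero_vec[OF orbit_rep_carrier[of "Suc k" s c]] by simp
      moreover have "w \<in> K" using w by (simp add: K_def)
      ultimately show False using w(2) by simp
    qed
    have "c \<noteq> 0" using c by auto
    hence "quad_gauss_sum (Suc k) (orbit_rep (Suc k) s c) = q * quad_gauss_sum k (orbit_rep k s c)"
      using \<open>s \<le> k\<close> by (simp add: quad_gauss_sum_orbit_rep Suc_diff_le)
    hence "quad_gauss_sum k C = quad_gauss_sum k (orbit_rep k s c)" using eq q_gt(1) by simp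
    thus "gauss_fourier k (\<lambda>z. \<phi> (q * z)) C = gauss_fourier k (\<lambda>z. \<phi> (q * z)) (orbit_rep k s c)"
      by (rule gauss_fourier_cong_gauss[OF C orbit_rep_Sym])
  qed
  thus ?thesis unfolding card by (simp only: Suc diff_Suc_1)
qed

text \<open>The coefficient of \<open>chi n s\<close> in the transform: the signed part has opposite
  values on the two orbits and cancels. For \<open>s = 0\<close> both representatives are the zero
  matrix.\<close>

definition orbit_avg :: "nat \<Rightarrow> nat \<Rightarrow> (complex \<Rightarrow> complex) \<Rightarrow> complex" where
  "orbit_avg n s \<phi> = (gauss_fourier n \<phi> (orbit_rep n s 1) + gauss_fourier n \<phi> (orbit_rep n s \<delta>)) / 2"

text \<open>For \<open>p \<noteq> 0\<close> the matrix \<open>p \<oplus> B\<close> has rank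
  \<open>s + 1\<close> and its sign is \<open>\<eta> p\<close> times that of \<open>B\<close>, so
  each of the two orbits is met by half of these \<open>p\<close>. The remaining
  \<open>p = 0\<close> keeps rank \<open>s\<close>.\<close>

lemma border_sum_orbit_rep_orbit_avg:
  assumes s: "s \<le> n" and c: "c \<in> {1, \<delta>}"
  shows "(q - 1) * orbit_avg (Suc n) (Suc s) \<phi> + gauss_fourier (Suc n) \<phi> (orbit_rep (Suc n) s c)
    = q * border_sum n \<phi> (orbit_rep n s c)"
proof -
  define B where "B = orbit_rep n s c"
  have B: "B \<in> Sym n" "B \<in> carrier_mat n n" by (simp_all add: B_def)
  have c0: "c \<noteq> 0" using c by auto
  define e where "e = (if s = 0 then 1 else \<eta> c)"
  have e: "e = 1 \<or> e = - 1" using c by (auto simp: e_def)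
  have gB: "quad_gauss_sum n B = e * gauss_sum ^ s * q ^ (n - s)"
    unfolding B_def e_def by (rule quad_gauss_sum_orbit_rep[OF s c0])
  define X where "X d = gauss_fourier (Suc n) \<phi> (orbit_rep (Suc n) (Suc s) d)" for d
  \<comment> \<open>The orbit of \<open>p \<oplus> B\<close> depends on the product of the signs, so
    for \<open>e = - 1\<close> the two representatives are interchanged.\<close>
  define F where "F z = (if z * e = 1 then X 1 else X \<delta>)" for z
  have nz: "gauss_fourier (Suc n) \<phi> (bordered p (0\<^sub>v n) (0\<^sub>v n) B) = F (\<eta> p)" if p: "p \<noteq> 0" for p
  proof -
    have g: "quad_gauss_sum (Suc n) (bordered p (0\<^sub>v n) (0\<^sub>v n) B) = (\<eta> p * e) * gauss_sum ^ Suc s * q ^ (n - s)"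
      unfolding quad_gauss_sum_bordered_diag[OF B(2) p] gB by simp
    have rep: "quad_gauss_sum (Suc n) (orbit_rep (Suc n) (Suc s) d) = \<eta> d * gauss_sum ^ Suc s * q ^ (n - s)"
      if "d \<noteq> 0" for d using quad_gauss_sum_orbit_rep[of "Suc s" "Suc n" d] s that by simp
    have S: "bordered p (0\<^sub>v n) (0\<^sub>v n) B \<in> Sym (Suc n)" using B by simp
    show ?thesis
    proof (cases "\<eta> p * e = 1")
      case True
      hence "quad_gauss_sum (Suc n) (bordered p (0\<^sub>v n) (0\<^sub>v n) B) = quad_gauss_sum (Suc n) (orbit_rep (Suc n) (Suc s) 1)"
        unfolding g rep[OF one_neq_zero] by simp
      from gauss_fourier_cong_gauss[OF S orbit_rep_Sym this] show ?thesis using True by (simp add: F_def X_def)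
    next
      case False
      hence m: "\<eta> p * e = - 1" using \<eta>_cases[OF p] e by auto
      have "quad_gauss_sum (Suc n) (bordered p (0\<^sub>v n) (0\<^sub>v n) B) = quad_gauss_sum (Suc n) (orbit_rep (Suc n) (Suc s) \<delta>)"
        unfolding g rep[OF \<delta>_neq_0] m by simp
      from gauss_fourier_cong_gauss[OF S orbit_rep_Sym this] show ?thesis using False by (simp add: F_def X_def)
    qed
  qed
  have "F 1 + F (- 1) = X 1 + X \<delta>" using e by (auto simp: F_def)
  hence *: "2 * (\<Sum>p\<in>UNIV-{0}. F (\<eta> p)) = (q - 1) * (X 1 + X \<delta>)"
    using sum_\<eta>[of F] by (simp only:)
  have "(\<Sum>p\<in>UNIV-{0}. F (\<eta> p)) = 2 * (\<Sum>p\<in>UNIV-{0}. F (\<eta> p)) / 2" by simp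
  hence "(\<Sum>p\<in>UNIV-{0}. F (\<eta> p)) = (q - 1) * orbit_avg (Suc n) (Suc s) \<phi>"
    unfolding * by (simp add: orbit_avg_def X_def)
  moreover have "gauss_fourier (Suc n) \<phi> (bordered 0 (0\<^sub>v n) (0\<^sub>v n) B) = gauss_fourier (Suc n) \<phi> (orbit_rep (Suc n) s c)"
  proof (rule gauss_fourier_cong_gauss)
    show "quad_gauss_sum (Suc n) (bordered 0 (0\<^sub>v n) (0\<^sub>v n) B) = quad_gauss_sum (Suc n) (orbit_rep (Suc n) s c)"
      unfolding quad_gauss_sum_bordered_zero[OF B(2)] gB using s c0
      by (simp add: quad_gauss_sum_orbit_rep e_def Suc_diff_le)
  qed (use B in simp_all)
  moreover have "q * border_sum n \<phi> B = gauss_fourier (Suc n) \<phi> (bordered 0 (0\<^sub>v n) (0\<^sub>v n) B)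
      + (\<Sum>p\<in>UNIV-{0}. gauss_fourier (Suc n) \<phi> (bordered p (0\<^sub>v n) (0\<^sub>v n) B))"
    unfolding sum_gauss_fourier_bordered[OF B(1), symmetric] by (rule sum.remove) auto
  moreover have "(\<Sum>p\<in>UNIV-{0}. gauss_fourier (Suc n) \<phi> (bordered p (0\<^sub>v n) (0\<^sub>v n) B)) = (\<Sum>p\<in>UNIV-{0}. F (\<eta> p))"
    by (intro sum.cong refl nz) simp
  ultimately show ?thesis unfolding B_def[symmetric] by simp
qed

lemma orbit_avg_Suc_Suc:
  assumes s: "s \<le> n"
  shows "(q - 1) * orbit_avg (Suc n) (Suc s) \<phi> + orbit_avg (Suc n) s \<phi>
    = q * (orbit_avg n s (\<lambda>z. \<phi> (q * z)) + q ^ n * (q ^ (n - s) - 1) * orbit_avg (n - 1) s (\<lambda>z. \<phi> (q * z)))"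
proof -
  have "(q - 1) * orbit_avg (Suc n) (Suc s) \<phi> + gauss_fourier (Suc n) \<phi> (orbit_rep (Suc n) s c)
    = q * (gauss_fourier n (\<lambda>z. \<phi> (q * z)) (orbit_rep n s c)
    + q ^ n * (q ^ (n - s) - 1) * gauss_fourier (n - 1) (\<lambda>z. \<phi> (q * z)) (orbit_rep (n - 1) s c))"
    if "c \<in> {1, \<delta>}" for c
    using border_sum_orbit_rep_orbit_avg[OF s that, of \<phi>] border_sum_orbit_rep[OF s that, of \<phi>] by simp
  note eqs = this[of 1, simplified] this[of \<delta>, simplified]
  have average: "a + (f1 + f2) / 2 = q * ((g1 + g2) / 2 + p * ((h1 + h2) / 2))"
    if "a + f1 = q * (g1 + p * h1)" "a + f2 = q * (g2 + p * h2)" for a f1 f2 g1 g2 h1 h2 p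
  proof -
    have "a + (f1 + f2) / 2 = ((a + f1) + (a + f2)) / 2" by (simp add: field_simps)
    also have "\<dots> = (q * (g1 + p * h1) + q * (g2 + p * h2)) / 2" by (simp only: that)
    also have "\<dots> = q * ((g1 + g2) / 2 + p * ((h1 + h2) / 2))" by (simp add: field_simps)
    finally show ?thesis .
  qed
  show ?thesis
    unfolding orbit_avg_def[of "Suc n" s] orbit_avg_def[of n] orbit_avg_def[of "n - 1"]
    by (rule average) (use eqs in simp_all)
qed

text \<open>The start of the recurrence in \<open>s\<close>. The transform is taken at the zero
  matrix itself, and oddness of \<open>\<phi>\<close> replaces the summation over
  \<open>p\<close>.\<close>

lemma orbit_avg_Suc_0:
  assumes odd: "\<And>z. \<phi> (- z) = - \<phi> z"
  shows "orbit_avg (Suc n) 0 \<phi> = orbit_avg n 0 (\<lambda>z. \<phi> (q * z)) + q ^ n * (q ^ n - 1) * orbit_avg (n - 1) 0 (\<lambda>z. \<phi> (q * z))"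
  using gauss_fourier_zero_odd[of \<phi> n, OF odd] border_sum_orbit_rep[of 0 n 1 \<phi>] unfolding orbit_avg_def orbit_rep_0 by simp

text \<open>The value of \<open>sgn_chi n \<delta> (2 * x)\<close> at \<open>a\<close>, read off from the Gauss sum of \<open>a\<close>.\<close>

definition gauss_sgn :: "nat \<Rightarrow> nat \<Rightarrow> complex \<Rightarrow> complex" where
  "gauss_sgn n x z = (if z * cnj z * q ^ (2 * x) = q ^ (2 * n) then z * \<epsilon> ^ x * q ^ x / q ^ n else 0)"

lemma cnj_q [simp]: "cnj q = q"
  by (simp add: q_def)

lemma gauss_sgn_odd: "gauss_sgn n x (- z) = - gauss_sgn n x z"
  by (simp add: gauss_sgn_def)

text \<open>Appending a zero row and column multiplies the Gauss sum by \<open>q\<close> and keeps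
  rank and sign.\<close>

lemma gauss_sgn_scale: "gauss_sgn (Suc n) x (q * z) = gauss_sgn n x z"
proof -
  have 1: "q * z * cnj (q * z) * q ^ (2 * x) = q\<^sup>2 * (z * cnj z * q ^ (2 * x))"
    by (simp add: power2_eq_square)
  have 2: "q ^ (2 * Suc n) = q\<^sup>2 * q ^ (2 * n)" by (simp add: power2_eq_square)
  have "q * z * cnj (q * z) * q ^ (2 * x) = q ^ (2 * Suc n) \<longleftrightarrow> z * cnj z * q ^ (2 * x) = q ^ (2 * n)"
    unfolding 1 2 using q_gt(1) by (simp only: mult_cancel_left) simp
  thus ?thesis using q_gt(1) by (simp only: gauss_sgn_def) simp
qed

text \<open>Combined with \<open>gauss_sgn_scale\<close> this is the effect of a hyperbolic plane:
  its Gauss sum is \<open>q\<close>, it raises size and rank by 2, and its sign is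
  \<open>\<eta> (- 1) = \<epsilon>\<close>.\<close>

lemma gauss_sgn_shift: "gauss_sgn (Suc n) (Suc x) z = \<epsilon> * gauss_sgn n x z"
proof -
  have 1: "z * cnj z * q ^ (2 * Suc x) = q\<^sup>2 * (z * cnj z * q ^ (2 * x))"
    by (simp add: power2_eq_square)
  have 2: "q ^ (2 * Suc n) = q\<^sup>2 * q ^ (2 * n)" by (simp add: power2_eq_square)
  have "z * cnj z * q ^ (2 * Suc x) = q ^ (2 * Suc n) \<longleftrightarrow> z * cnj z * q ^ (2 * x) = q ^ (2 * n)"
    unfolding 1 2 using q_gt(1) by (simp only: mult_cancel_left) simp
  thus ?thesis using q_gt(1) by (simp only: gauss_sgn_def) simp
qed

lemma orbit_avg_mult: "orbit_avg n s (\<lambda>z. k * \<phi> z) = k * orbit_avg n s \<phi>"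
  by (simp add: orbit_avg_def gauss_fourier_def sum_distrib_left algebra_simps)

definition gauss_sgn_avg :: "nat \<Rightarrow> nat \<Rightarrow> nat \<Rightarrow> complex" where
  "gauss_sgn_avg n s x = orbit_avg n s (gauss_sgn n x)"

lemma gauss_sgn_avg_shift: "orbit_avg k s (gauss_sgn (Suc k) (Suc x)) = \<epsilon> * gauss_sgn_avg k s x"
proof -
  have "gauss_sgn (Suc k) (Suc x) = (\<lambda>z. \<epsilon> * gauss_sgn k x z)" by (intro ext gauss_sgn_shift)
  thus ?thesis by (simp only: orbit_avg_mult gauss_sgn_avg_def)
qed

lemma gauss_sgn_avg_Suc_Suc:
  assumes s: "s \<le> n"
  shows "(q - 1) * gauss_sgn_avg (Suc n) (Suc s) (Suc x) + gauss_sgn_avg (Suc n) s (Suc x)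
    = q * (gauss_sgn_avg n s (Suc x) + \<epsilon> * q ^ n * (q ^ (n - s) - 1) * gauss_sgn_avg (n - 1) s x)"
proof -
  have "q ^ n * (q ^ (n - s) - 1) * orbit_avg (n - 1) s (gauss_sgn n (Suc x))
      = \<epsilon> * q ^ n * (q ^ (n - s) - 1) * gauss_sgn_avg (n - 1) s x"
    by (cases n) (simp_all add: gauss_sgn_avg_shift)
  thus ?thesis
    using orbit_avg_Suc_Suc[OF s, of "gauss_sgn (Suc n) (Suc x)"] unfolding gauss_sgn_scale gauss_sgn_avg_def[symmetric]
    by simp
qed

lemma gauss_sgn_avg_Suc_0:
  "gauss_sgn_avg (Suc n) 0 (Suc x) = gauss_sgn_avg n 0 (Suc x) + \<epsilon> * q ^ n * (q ^ n - 1) * gauss_sgn_avg (n - 1) 0 x"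
proof -
  have "q ^ n * (q ^ n - 1) * orbit_avg (n - 1) 0 (gauss_sgn n (Suc x))
      = \<epsilon> * q ^ n * (q ^ n - 1) * gauss_sgn_avg (n - 1) 0 x"
    by (cases n) (simp_all add: gauss_sgn_avg_shift)
  thus ?thesis
    using orbit_avg_Suc_0[of "gauss_sgn (Suc n) (Suc x)" n, OF gauss_sgn_odd] unfolding gauss_sgn_scale gauss_sgn_avg_def[symmetric]
    by simp
qed

lemma gauss_sgn_quad_gauss_sum:
  assumes a: "a \<in> Sym n"
  shows "gauss_sgn n x (quad_gauss_sum n a) = (if vec_space.rank n a = 2 * x then sym_sgn n \<delta> a else 0)"
proof -
  define r where "r = vec_space.rank n a"
  have norm: "quad_gauss_sum n a * cnj (quad_gauss_sum n a) * q ^ r = q ^ (2 * n)"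
    unfolding r_def by (rule quad_gauss_sum_norm_rank[OF a])
  have nz: "quad_gauss_sum n a \<noteq> 0" by (rule quad_gauss_sum_nz[OF a])
  show ?thesis
  proof (cases "r = 2 * x")
    case True
    have rn: "2 * x \<le> n" using quad_gauss_sum_eq_sym_sgn(2)[OF a] True by (simp add: r_def)
    have "quad_gauss_sum n a = sym_sgn n \<delta> a * gauss_sum ^ r * q ^ (n - r)"
      unfolding r_def by (rule quad_gauss_sum_eq_sym_sgn(1)[OF a])
    \<comment> \<open>Because the rank is even, the Gauss sum of the field enters only through its
      known square.\<close>
    also have "gauss_sum ^ r = (\<epsilon> * q) ^ x"
      unfolding True power_mult power2_eq_square gauss_sum_square ..
    finally have "quad_gauss_sum n a * \<epsilon> ^ x * q ^ x = sym_sgn n \<delta> a * (\<epsilon> * \<epsilon>) ^ x * (q ^ x * q ^ x * q ^ (n - 2 * x))"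
      by (simp add: True power_mult_distrib ac_simps del: \<epsilon>_sq)
    also have "q ^ x * q ^ x * q ^ (n - 2 * x) = q ^ n"
      using rn by (simp add: power_add[symmetric] mult_2[symmetric])
    finally have "quad_gauss_sum n a * \<epsilon> ^ x * q ^ x / q ^ n = sym_sgn n \<delta> a" using q_gt(1) by simp
    thus ?thesis using norm True by (simp add: gauss_sgn_def r_def)
  next
    case False
    have "quad_gauss_sum n a * cnj (quad_gauss_sum n a) * q ^ (2 * x) \<noteq> q ^ (2 * n)"
    proof
      assume "quad_gauss_sum n a * cnj (quad_gauss_sum n a) * q ^ (2 * x) = q ^ (2 * n)"
      hence "quad_gauss_sum n a * cnj (quad_gauss_sum n a) * q ^ (2 * x) = quad_gauss_sum n a * cnj (quad_gauss_sum n a) * q ^ r"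
        using norm by simp
      hence "q ^ (2 * x) = q ^ r" using nz by simp
      thus False using q_power_inject False by metis
    qed
    thus ?thesis using False by (simp add: gauss_sgn_def r_def)
  qed
qed

lemma rank_eq_0_iff:
  assumes a: "(a :: 'f mat) \<in> Sym n"
  shows "vec_space.rank n a = 0 \<longleftrightarrow> a = 0\<^sub>m n n"
proof
  obtain r c where r: "r \<le> n" "c \<in> {1, \<delta>}" "same_orbit n a (orbit_rep n r c)"
    using exists_orbit_rep[OF a] by blast
  assume "vec_space.rank n a = 0"
  hence "r = 0" using rank_same_orbit[OF a r] by simp
  moreover obtain g where "g \<in> carrier_mat n n" "a = g * orbit_rep n r c * transpose_mat g"
    using r(3) by (auto simp: same_orbit_def)
  ultimately show "a = 0\<^sub>m n n" by (simp add: orbit_rep_0)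
next
  assume "a = 0\<^sub>m n n"
  hence "same_orbit n a (orbit_rep n 0 1)" by (simp add: orbit_rep_0 same_orbit_refl)
  thus "vec_space.rank n a = 0" using rank_same_orbit[OF a, of 0 1] by simp
qed

lemma gauss_sgn_avg_x0: "gauss_sgn_avg n s 0 = 1"
proof -
  have "gauss_fourier n (gauss_sgn n 0) b = 1" if b: "b \<in> Sym n" for b
  proof -
    have "gauss_fourier n (gauss_sgn n 0) b = (\<Sum>a\<in>(Sym n :: 'f mat set). if a = 0\<^sub>m n n then 1 else 0)"
      unfolding gauss_fourier_def
    proof (rule sum.cong[OF refl])
      fix a :: "'f mat" assume a: "a \<in> Sym n"
      have "transpose_mat b * 0\<^sub>m n n = 0\<^sub>m n n"
        by (rule right_mult_zero_mat) (use b in \<open>simp add: Sym_carrier\<close>)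
      hence "mat_trace (transpose_mat b * 0\<^sub>m n n) = 0"
        by (simp add: mat_trace_def)
      thus "cnj (\<theta> (mat_trace (transpose_mat b * a))) * gauss_sgn n 0 (quad_gauss_sum n a) = (if a = 0\<^sub>m n n then 1 else 0)"
        using gauss_sgn_quad_gauss_sum[OF a, of 0] rank_eq_0_iff[OF a] by (auto simp: sym_sgn_def)
    qed
    thus ?thesis by simp
  qed
  thus ?thesis by (simp add: gauss_sgn_avg_def orbit_avg_def)
qed

lemma gauss_sgn_avg_0_0: "gauss_sgn_avg 0 0 (Suc x) = 0"
proof -
  have "gauss_sgn 0 (Suc x) (quad_gauss_sum 0 a) = 0" if a: "a \<in> Sym 0" for a
    using gauss_sgn_quad_gauss_sum[OF a, of "Suc x"] rank_eq_0_iff[OF a] a by (simp add: Sym_0)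
  thus ?thesis by (simp add: gauss_sgn_avg_def orbit_avg_def gauss_fourier_def)
qed

text \<open>The recurrence is solved for rank \<open>s + 1\<close> from values of rank
  \<open>s\<close> in sizes \<open>n\<close>, \<open>n - 1\<close> and \<open>n - 2\<close>, and
  \<open>kraw_step\<close> relates these three. The start \<open>s = 0\<close> is an induction of
  its own, on the size.\<close>

lemma gauss_sgn_avg_eq_kraw:
  assumes "s \<le> n"
  shows "gauss_sgn_avg n s x = \<epsilon> ^ x * kraw q (s div 2) (q ^ n) x"
  using assms
proof (induction s arbitrary: n x)
  case 0
  show ?case
  proof (induction n arbitrary: x rule: less_induct)
    case (less n)
    show ?case
    proof (cases x)
      case x: (Suc z)
      show ?thesis
      proof (cases n)
        case 0
        \<comment> \<open>In size 0 the factor at \<open>i = 0\<close> is 0, as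
          \<open>X = 1\<close>.\<close>
        have "(\<Prod>i<2 * Suc z. 1 - 1 / q ^ i) = 0" by (intro prod_zero bexI[of _ 0]) auto
        thus ?thesis using 0 x by (simp add: gauss_sgn_avg_0_0 del: prod.lessThan_Suc)
      next
        case (Suc m)
        have q: "q ^ Suc m / q = q ^ m" "q ^ Suc m / q\<^sup>2 = q ^ m / q"
          using q_gt(1) by (simp_all add: power2_eq_square)
        \<comment> \<open>For \<open>m = 0\<close> there is no size \<open>n - 2\<close>, but then
          the factor \<open>q ^ m - 1\<close> is 0.\<close>
        have m1: "(q ^ m - 1) * gauss_sgn_avg (m - 1) 0 z = (q ^ m - 1) * (\<epsilon> ^ z * kraw q 0 (q ^ m / q) z)"
        proof (cases m)
          case (Suc k)
          thus ?thesis using less.IH[of k z] \<open>n = Suc m\<close> q_gt(1) by simp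
        qed simp
        have "gauss_sgn_avg n 0 x = gauss_sgn_avg m 0 (Suc z) + \<epsilon> * q ^ m * ((q ^ m - 1) * gauss_sgn_avg (m - 1) 0 z)"
          unfolding Suc x gauss_sgn_avg_Suc_0 by simp
        also have "\<dots> = \<epsilon> ^ x * (kraw q 0 (q ^ m) (Suc z) + q ^ m * (q ^ m - 1) * kraw q 0 (q ^ m / q) z)"
          unfolding m1 using less.IH[of m "Suc z"] Suc x by (simp add: algebra_simps del: kraw.simps)
        also have "\<dots> = \<epsilon> ^ x * kraw q 0 (q ^ n) x"
          using kraw_step0[OF q_gt(1) q_power_neq_1, of "q ^ n" z] unfolding Suc x q by simp
        finally show ?thesis by simp
      qed
    qed (simp add: gauss_sgn_avg_x0)
  qed
next
  case (Suc s)
  then obtain m where n: "n = Suc m" and sm: "s \<le> m" by (cases n) auto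
  show ?case
  proof (cases x)
    case x: (Suc z)
    define y where "y = s div 2"
    define X where "X = q ^ Suc m"
    have X: "X / q = q ^ m" "X / q\<^sup>2 = q ^ m / q"
      using q_gt(1) by (simp_all add: X_def power2_eq_square)
    define k1 where "k1 = kraw q y X (Suc z)"
    define k0 where "k0 = kraw q y (X / q) (Suc z)"
    define k2 where "k2 = kraw q y (X / q\<^sup>2) z"
    have k1: "k1 = k0 + q ^ m * (X / q ^ (2 * y + 1) - 1) * k2"
      unfolding k0_def k1_def k2_def X(1)[symmetric] by (rule kraw_step[OF q_gt(1) q_power_neq_1])
    \<comment> \<open>Likewise, for \<open>s = m\<close> rank \<open>s\<close> is impossible in size
      \<open>m - 1\<close>, and the factor vanishes.\<close>
    have f: "(q ^ (m - s) - 1) * gauss_sgn_avg (m - 1) s z = (q ^ (m - s) - 1) * (\<epsilon> ^ z * k2)"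
    proof (cases "s = m")
      case False
      then obtain k where "m = Suc k" using sm by (cases m) auto
      thus ?thesis using Suc.IH[of k z] False sm q_gt(1) by (simp add: k2_def X y_def)
    qed simp
    have "gauss_sgn_avg m s (Suc z) = \<epsilon> ^ x * k0"
      using Suc.IH[OF sm, of "Suc z"] by (simp add: k0_def X y_def x)
    hence "q * (gauss_sgn_avg m s (Suc z) + \<epsilon> * q ^ m * (q ^ (m - s) - 1) * gauss_sgn_avg (m - 1) s z)
        = q * (\<epsilon> ^ x * k0 + \<epsilon> * q ^ m * ((q ^ (m - s) - 1) * gauss_sgn_avg (m - 1) s z))"
      by (simp only: mult.assoc)
    also have "\<dots> = \<epsilon> ^ x * (q * (k0 + q ^ m * (q ^ (m - s) - 1) * k2))"
      unfolding f x by (simp add: algebra_simps)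
    finally have rhs: "q * (gauss_sgn_avg m s (Suc z) + \<epsilon> * q ^ m * (q ^ (m - s) - 1) * gauss_sgn_avg (m - 1) s z)
        = \<epsilon> ^ x * (q * (k0 + q ^ m * (q ^ (m - s) - 1) * k2))" .
    have "gauss_sgn_avg (Suc m) s (Suc z) = \<epsilon> ^ x * k1"
      using Suc.IH[of "Suc m" "Suc z"] sm x by (simp add: k1_def X_def y_def)
    with gauss_sgn_avg_Suc_Suc[OF sm, of z]
    have "(q - 1) * gauss_sgn_avg n (Suc s) x + \<epsilon> ^ x * k1 = \<epsilon> ^ x * (q * (k0 + q ^ m * (q ^ (m - s) - 1) * k2))"
      unfolding rhs n x by simp
    hence main: "(q - 1) * gauss_sgn_avg n (Suc s) x
        = \<epsilon> ^ x * (q * (k0 + q ^ m * (q ^ (m - s) - 1) * k2) - k1)"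
      unfolding right_diff_distrib[of "\<epsilon> ^ x"] by (simp only: eq_diff_eq)
    have q1: "q - 1 \<noteq> 0" using q_power_neq_1[of 1] by simp
    \<comment> \<open>For even \<open>s\<close> the value of \<open>s div 2\<close> stays, and the
      recurrence must reproduce the value at \<open>s\<close>; for odd \<open>s\<close> it grows by
      one, and the recursion of \<open>kraw\<close> in \<open>y\<close> appears.\<close>
    have "q * (k0 + q ^ m * (q ^ (m - s) - 1) * k2) - k1 = (q - 1) * kraw q (Suc s div 2) X x"
    proof (cases "even s")
      case True
      hence s: "s = 2 * y" by (simp add: y_def)
      have "X / q ^ (2 * y + 1) = q ^ (m - s)"
        using sm q_gt(1) by (simp add: X_def s power_diff)
      moreover have "Suc s div 2 = y" by (simp add: s)
      ultimately have "k0 + q ^ m * (q ^ (m - s) - 1) * k2 = k1"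
        and "kraw q (Suc s div 2) X x = k1" using k1 by (simp_all add: k1_def x)
      thus ?thesis by (simp only: left_diff_distrib mult_1_left)
    next
      case False
      hence s: "s = 2 * y + 1" by (simp add: y_def)
      have div: "Suc s div 2 = Suc y" by (simp add: s)
      have "q ^ m = q ^ (m - s) * q ^ s" using sm by (simp add: power_add[symmetric])
      also have "q ^ s = q ^ (2 * y) * q" by (simp add: s)
      finally have qm: "q ^ m = q ^ (m - s) * q ^ (2 * y) * q" by simp
      have "X / q ^ (2 * y + 1) = q * q ^ (m - s)"
        using q_gt(1) by (simp add: X_def qm)
      hence k0: "k0 = k1 - q ^ m * (q * q ^ (m - s) - 1) * k2" using k1 by simp
      have "X\<^sup>2 / q ^ (2 * y + 2) = q * q ^ m * q ^ (m - s)"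
        using q_gt(1) by (simp add: X_def power2_eq_square qm)
      hence kk: "kraw q (Suc s div 2) X x = k1 - q * q ^ m * q ^ (m - s) * k2"
        unfolding div x kraw.simps k1_def[symmetric] k2_def[symmetric] by simp
      show ?thesis unfolding k0 kk by (simp add: algebra_simps)
    qed
    from main[unfolded this]
    have "(q - 1) * gauss_sgn_avg n (Suc s) x = (q - 1) * (\<epsilon> ^ x * kraw q (Suc s div 2) X x)"
      by (simp only: mult.left_commute)
    thus ?thesis using q1 by (simp add: X_def n)
  qed (simp add: gauss_sgn_avg_x0)
qed

subsection \<open>The matrix of the Fourier transformation\<close>

text \<open>On an orbit of rank \<open>r\<close> at most two basis functions are non-zero, which
  leaves \<open>c r\<close> plus or minus \<open>d r\<close>.\<close>

lemma is_expansion_orbit_rep: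
  assumes "is_expansion n \<delta> \<theta> F c d" and r: "r \<le> n" "e \<in> {1, \<delta>}"
    and a: "a \<in> Sym n" "same_orbit n a (orbit_rep n r e)"
  shows "F (sym_char \<theta> a) = c r + (if r = 0 then 0 else d r * \<eta> e)"
proof -
  note rank = rank_same_orbit[OF a(1) r a(2)] and sgn = sym_sgn_same_orbit[OF a(1) r a(2)]
  have "F (sym_char \<theta> a) = (\<Sum>s=0..n. c s * chi n s a) + (\<Sum>s=1..n. d s * sgn_chi n \<delta> s a)"
    using assms(1) a(1) unfolding is_expansion_def by blast
  also have "(\<Sum>s=0..n. c s * chi n s a) = (\<Sum>s=0..n. if s = r then c r else 0)"
    by (intro sum.cong refl) (auto simp: chi_def rank)
  also have "\<dots> = c r" using r(1) by simp
  also have "(\<Sum>s=1..n. d s * sgn_chi n \<delta> s a) = (\<Sum>s=1..n. if s = r then d r * \<eta> e else 0)"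
    by (intro sum.cong refl) (auto simp: sgn_chi_def chi_def rank sgn)
  also have "\<dots> = (if r = 0 then 0 else d r * \<eta> e)" using r(1) by simp
  finally show ?thesis .
qed

text \<open>The values on the two orbits of rank \<open>s\<close> are \<open>c s + d s\<close> and
  \<open>c s - d s\<close>, which determine both; outside the index ranges the convention of value 0
  does. Thus the definite description has a unique solution.\<close>

lemma expansion_coeffs_eqI:
  assumes E: "is_expansion n \<delta> \<theta> F c d"
  shows "expansion_coeffs n \<delta> \<theta> F = (c, d)"
  unfolding expansion_coeffs_def
proof (rule the_equality)
  show "case (c, d) of (c, d) \<Rightarrow> is_expansion n \<delta> \<theta> F c d" using E by simp
next
  fix p assume "case p of (c, d) \<Rightarrow> is_expansion n \<delta> \<theta> F c d"
  then obtain c' d' where p: "p = (c', d')" and E': "is_expansion n \<delta> \<theta> F c' d'" by (cases p) auto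
  have eq: "c s + (if s = 0 then 0 else d s * \<eta> e) = c' s + (if s = 0 then 0 else d' s * \<eta> e)"
    if "s \<le> n" "e \<in> {1, \<delta>}" for s e
    using is_expansion_orbit_rep[OF E that orbit_rep_Sym same_orbit_refl[OF orbit_rep_carrier]]
      is_expansion_orbit_rep[OF E' that orbit_rep_Sym same_orbit_refl[OF orbit_rep_carrier]] by simp
  have cd: "c s = c' s \<and> d s = d' s" for s
  proof (cases "s \<in> {1..n}")
    case True
    hence *: "c s + d s = c' s + d' s" "c s - d s = c' s - d' s"
      using eq[of s 1] eq[of s \<delta>] by simp_all
    have "(c s + d s) + (c s - d s) = (c' s + d' s) + (c' s - d' s)" unfolding * ..
    hence "c s = c' s" by simp
    thus ?thesis using *(1) by simp
  next
    case False
    hence "d s = 0" "d' s = 0" using E E' unfolding is_expansion_def by blast+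
    hence "d s = d' s" by simp
    moreover have "c s = c' s"
    proof (cases "s = 0")
      case True
      thus ?thesis using eq[of 0 1] by simp
    next
      case F: False
      hence "s \<notin> {0..n}" using False by simp
      hence "c s = 0" "c' s = 0" using E E' unfolding is_expansion_def by blast+
      thus ?thesis by simp
    qed
    ultimately show ?thesis by simp
  qed
  have "c = c'" by (rule ext) (use cd in blast)
  moreover have "d = d'" by (rule ext) (use cd in blast)
  ultimately show "p = (c, d)" using p by simp
qed

text \<open>The transform is constant on orbits, so half-sum and half-difference of its values at
  the two representatives form an expansion; the half-sum is the average.\<close>

lemma Psi2_eq_gauss_sgn_avg:
  assumes s: "s \<le> n"
  shows "Psi2 n \<delta> \<theta> s (2 * x) = gauss_sgn_avg n s x"
proof -
  define f where "f b = gauss_fourier n (gauss_sgn n x) b" for b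
  define F where "F = fourier n (sgn_chi n \<delta> (2 * x))"
  have F: "F (sym_char \<theta> b) = f b" if b: "b \<in> Sym n" for b
    unfolding F_def f_def fourier_def gauss_fourier_def sym_char_def
    by (intro sum.cong refl) (simp add: gauss_sgn_quad_gauss_sum sgn_chi_def chi_def)
  define c where "c r = (if r \<le> n then (f (orbit_rep n r 1) + f (orbit_rep n r \<delta>)) / 2 else 0)" for r
  define d where "d r = (if r \<in> {1..n} then (f (orbit_rep n r 1) - f (orbit_rep n r \<delta>)) / 2 else 0)" for r
  have "is_expansion n \<delta> \<theta> F c d"
    unfolding is_expansion_def
  proof (intro conjI ballI allI impI)
    fix a :: "'f mat" assume a: "a \<in> Sym n"
    obtain r e where r: "r \<le> n" "e \<in> {1, \<delta>}" "same_orbit n a (orbit_rep n r e)"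
      using exists_orbit_rep[OF a] by blast
    note rank = rank_same_orbit[OF a r] and sgn = sym_sgn_same_orbit[OF a r]
    have "F (sym_char \<theta> a) = f (orbit_rep n r e)"
      unfolding F[OF a] f_def
      by (rule gauss_fourier_cong_gauss[OF a orbit_rep_Sym quad_gauss_sum_same_orbit[OF r(3)]]) simp
    also have "\<dots> = c r + (if r = 0 then 0 else d r * \<eta> e)"
      using r(1,2) by (auto simp: c_def d_def orbit_rep_0 field_simps)
    also have "c r = (\<Sum>s=0..n. if s = r then c r else 0)" using r(1) by simp
    also have "(\<Sum>s=0..n. if s = r then c r else 0) = (\<Sum>s=0..n. c s * chi n s a)"
      by (intro sum.cong refl) (auto simp: chi_def rank)
    also have "(if r = 0 then 0 else d r * \<eta> e) = (\<Sum>s=1..n. if s = r then d r * \<eta> e else 0)"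
      using r(1) by simp
    also have "\<dots> = (\<Sum>s=1..n. d s * sgn_chi n \<delta> s a)"
      by (intro sum.cong refl) (auto simp: sgn_chi_def chi_def rank sgn)
    finally show "F (sym_char \<theta> a) = (\<Sum>s=0..n. c s * chi n s a) + (\<Sum>s=1..n. d s * sgn_chi n \<delta> s a)" .
  next
    fix s assume "s \<notin> {0..n}"
    thus "c s = 0" by (simp add: c_def)
  next
    fix s assume "s \<notin> {1..n}"
    thus "d s = 0" unfolding d_def by (simp only: if_False)
  qed
  from expansion_coeffs_eqI[OF this] show ?thesis
    using s by (simp add: Psi2_def F_def[symmetric] c_def f_def gauss_sgn_avg_def orbit_avg_def)
qed

end

theorem proposition6p4p4:
  fixes \<theta> :: "'f::{field,finite} \<Rightarrow> complex"
    and \<delta> :: 'f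
    and n s r N x y :: nat
    and q \<epsilon> :: complex
  assumes "odd CARD('f)"
    and "additive_character \<theta>" and "\<exists>t. \<theta> t \<noteq> 1"
    and "\<nexists>t. \<delta> = t\<^sup>2"
    and "q = of_nat CARD('f)"
    and "\<epsilon> = (if CARD('f) mod 4 = 1 then 1 else - 1)"
    and "2 \<le> n" and "s \<le> n" and "even r" and "2 \<le> r" and "r \<le> n"
    and "N = n div 2" and "y = s div 2" and "x = r div 2"
  shows "Psi2 n \<delta> \<theta> s r =
     (- \<epsilon>) ^ x * q ^ (x\<^sup>2) * qpoch (q powi (2 * int N - (- 1) ^ n)) (q powi (- 2)) x
     * qbinom N x (q\<^sup>2)
     * affine_q_Krawtchouk y x (q powi (- 2 * int N + (- 1) ^ n)) N (q\<^sup>2)"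
proof -
  interpret finite_field_character \<theta> \<delta> q \<epsilon>
    by unfold_locales (fact assms)+
  have r: "r = 2 * x" using \<open>even r\<close> \<open>x = r div 2\<close> by simp
  have y: "y \<le> n div 2" using \<open>s \<le> n\<close> \<open>y = s div 2\<close> by (simp add: div_le_mono)
  have "Psi2 n \<delta> \<theta> s r = \<epsilon> ^ x * kraw q y (q ^ n) x"
    unfolding r Psi2_eq_gauss_sgn_avg[OF \<open>s \<le> n\<close>] \<open>y = s div 2\<close> by (rule gauss_sgn_avg_eq_kraw[OF \<open>s \<le> n\<close>])
  moreover have "(- \<epsilon>) ^ x = \<epsilon> ^ x * (- 1) ^ x"
    by (simp only: power_minus[of \<epsilon>] mult.commute)
  ultimately show ?thesis
    by (simp only: kraw_eq_affine_q_Krawtchouk[OF q_gt(1) q_power_neq_1 y] \<open>N = n div 2\<close> mult.assoc)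
qed

end
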